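(* Let $F$ be a field with a valuation $v:F^\times\to\Gamma$ ($\Gamma$ a totally ordered abelian group) and residue field $k$. Let $\mathcal L_v$ denote the $R_F$-submodule of $\overline{\mathcal{RP}}(F)$ generated by the set $\{[a]\in\overline{\mathcal{RP}}(F): v(a)\ne0\}$. Then there is a short exact sequence of $R_F$-modules $$0\to\mathcal L_v\to\overline{\mathcal{RP}}(F)\xrightarrow{\,S_v\,}\mathrm{Ind}^F_k\,\overline{\mathcal{RP}}(k)\to0.$$
   Context: For a field $F$, $R_F=\mathbb Z[F^\times/(F^\times)^2]$; $\langle x\rangle\in R_F$ is the square class of $x\in F^\times$; $\langle\!\langle x\rangle\!\rangle=\langle x\rangle-1$. If $F$ has at least $4$ elements, $\mathcal{RP}(F)$ is the $R_F$-module with generators $[x]$, $x\in F^\times$, and relations $[1]=0$ and, for all $x,y\in F^\times\setminus\{1\}$, $$0=[x]-[y]+\langle x\rangle\left[\tfrac yx\right]-\langle x^{-1}-1\rangle\left[\tfrac{1-x^{-1}}{1-y^{-1}}\right]+\langle 1-x\rangle\left[\tfrac{1-x}{1-y}\right].$$ Put $\psi_1(x)=[x]+\langle-1\rangle[x^{-1}]$ and let $\mathcal K^{(1)}_F$ be the $R_F$-submodule generated by all $\psi_1(x)$, $x\in F^\times$. The element $C_F=[x]+\langle-1\rangle[1-x]+\langle\!\langle1-x\rangle\!\rangle\psi_1(x)$ ($x\ne0,1$) is independent of $x$ and $6C_F=0$. Small fields: $\mathcal{RP}(\mathbb F_2)$ is a group of order $3$ with distinguished generator $C_{\mathbb F_2}$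 (with $[1]=0$ and $\mathcal K^{(1)}_{\mathbb F_2}=0$). $\mathcal{RP}(\mathbb F_3)$ is the cyclic $R_{\mathbb F_3}$-module generated by $[-1]$ with the single relation $2([-1]+\langle-1\rangle[-1])=0$ (and $[1]=0$), and $C_{\mathbb F_3}=\psi_1(-1)=(1+\langle-1\rangle)[-1]$. For every field: $D_F=2C_F$, $\mathcal D_F=R_FD_F$, $\widetilde{\mathcal{RP}}(F)=\mathcal{RP}(F)/\mathcal K^{(1)}_F$ and $\overline{\mathcal{RP}}(F)=\widetilde{\mathcal{RP}}(F)/\mathcal D_F$ (with $\mathcal D_F$ identified with its image in $\widetilde{\mathcal{RP}}(F)$). A valuation $v:F^\times\to\Gamma$ is a (surjective) group homomorphism with $v(a+b)\ge\min\{v(a),v(b)\}$ whenever $a,b,a+b\in F^\times$. $U=\{a\in F^\times:v(a)=0\}$; reduction $a\mapsto\bar a$ induces $U/U^2\to k^\times/(k^\times)^2$, so any $R_k$-module $M$ is a $\mathbb Z[U/U^2]$-module, and $\mathrm{Ind}^F_kM:=R_F\otimes_{\mathbb Z[U/U^2]}M$. $S_v:\overline{\mathcal{RP}}(F)\to\mathrm{Ind}^F_k\overline{\mathcal{RP}}(k)$ is the well-defined $R_F$-homomorphism with $S_v([a])=1\otimes[\bar a]$ if $v(a)=0$ and $S_v([a])=0$ if $v(a)\ne0$. *)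

theory Defs
  imports "HOL-Algebra.Module" "HOL-Algebra.AbelCoset" "HOL-Algebra.Free_Abelian_Groups"
begin

text \<open>
  The fields \<open>F\<close> and \<open>k\<close> are types of class \<^class>\<open>field\<close>, passed as \<open>TYPE('a)\<close> where needed.
  Groups, group rings and modules are HOL-Algebra structures.  The ring multiplication of a
  HOL-Algebra module record plays no role in a module, so it is left \<^const>\<open>undefined\<close>.
\<close>

section \<open>Modules\<close>

definition group_ring :: "('g, 'm) monoid_scheme \<Rightarrow> ('g \<Rightarrow>\<^sub>0 int) ring" where
  "group_ring G =
    \<lparr>carrier = {f. Poly_Mapping.keys f \<subseteq> carrier G},
     monoid.mult = (\<lambda>f g. frag_extend (\<lambda>a. frag_extend (\<lambda>b. frag_of (a \<otimes>\<^bsub>G\<^esub> b)) g) f),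
     monoid.one = frag_of \<one>\<^bsub>G\<^esub>,
     ring.zero = 0,
     ring.add = (+)\<rparr>"

definition free_module :: "('r, 'm) ring_scheme \<Rightarrow> 's set \<Rightarrow> ('r, 's \<Rightarrow> 'r) module" where
  "free_module R S =
    \<lparr>carrier = {f. (\<forall>s. f s \<in> carrier R) \<and> (\<forall>s. s \<notin> S \<longrightarrow> f s = \<zero>\<^bsub>R\<^esub>) \<and>
                   finite {s. f s \<noteq> \<zero>\<^bsub>R\<^esub>}},
     monoid.mult = undefined,
     monoid.one = undefined,
     ring.zero = (\<lambda>s. \<zero>\<^bsub>R\<^esub>),
     ring.add = (\<lambda>f g s. f s \<oplus>\<^bsub>R\<^esub> g s),
     smult = (\<lambda>r f s. r \<otimes>\<^bsub>R\<^esub> f s)\<rparr>"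

definition free_gen :: "('r, 'm) ring_scheme \<Rightarrow> 's \<Rightarrow> 's \<Rightarrow> 'r" where
  "free_gen R s = (\<lambda>t. if t = s then \<one>\<^bsub>R\<^esub> else \<zero>\<^bsub>R\<^esub>)"

definition span_submodule ::
    "('r, 'm) ring_scheme \<Rightarrow> ('r, 'b, 'n) module_scheme \<Rightarrow> 'b set \<Rightarrow> 'b set" where
  "span_submodule R M S = \<Inter>{H. submodule H R M \<and> S \<subseteq> H}"

text \<open>The quotient of a module \<open>M\<close> by a submodule \<open>N\<close>; its elements are the cosets \<open>N +> x\<close>.\<close>

definition quotient_module :: "('r, 'b, 'n) module_scheme \<Rightarrow> 'b set \<Rightarrow> ('r, 'b set) module" where
  "quotient_module M N =
    \<lparr>carrier = a_rcosets\<^bsub>M\<^esub> N,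
     monoid.mult = undefined,
     monoid.one = undefined,
     ring.zero = N,
     ring.add = set_add M,
     smult = (\<lambda>r X. \<Union>x\<in>X. N +>\<^bsub>M\<^esub> (r \<odot>\<^bsub>M\<^esub> x))\<rparr>"

definition module_hom ::
    "('r, 'm) ring_scheme \<Rightarrow> ('r, 'b, 'n) module_scheme \<Rightarrow> ('r, 'c, 'p) module_scheme \<Rightarrow> ('b \<Rightarrow> 'c) set"
  where
  "module_hom R M N = {h \<in> carrier M \<rightarrow> carrier N.
     (\<forall>x\<in>carrier M. \<forall>y\<in>carrier M. h (x \<oplus>\<^bsub>M\<^esub> y) = h x \<oplus>\<^bsub>N\<^esub> h y) \<and>
     (\<forall>r\<in>carrier R. \<forall>x\<in>carrier M. h (r \<odot>\<^bsub>M\<^esub> x) = r \<odot>\<^bsub>N\<^esub> h x)}"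

text \<open>\<open>short_exact_sequence R A f B g C\<close>: the sequence \<open>0 \<rightarrow> A \<rightarrow> B \<rightarrow> C \<rightarrow> 0\<close> of \<open>R\<close>-modules with
  maps \<open>f\<close> and \<open>g\<close> is exact.\<close>

definition short_exact_sequence ::
    "('r, 'm) ring_scheme \<Rightarrow> ('r, 'a, 'n) module_scheme \<Rightarrow> ('a \<Rightarrow> 'b) \<Rightarrow>
     ('r, 'b, 'p) module_scheme \<Rightarrow> ('b \<Rightarrow> 'c) \<Rightarrow> ('r, 'c, 'q) module_scheme \<Rightarrow> bool" where
  "short_exact_sequence R A f B g C \<longleftrightarrow>
     Module.module R A \<and> Module.module R B \<and> Module.module R C \<and>
     f \<in> module_hom R A B \<and> g \<in> module_hom R B C \<and>
     inj_on f (carrier A) \<and>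
     f ` carrier A = a_kernel B C g \<and>
     g ` carrier B = carrier C"

text \<open>\<open>tensor_kernel A \<phi> R M\<close> is the subgroup of the free abelian group on \<open>R \<times> M\<close> by which one
  divides to obtain \<open>R \<otimes>\<^bsub>A\<^esub> M\<close>, where \<open>R\<close> is an \<open>A\<close>-module through the ring homomorphism
  \<open>\<phi> : A \<rightarrow> R\<close>.\<close>

definition tensor_kernel ::
    "('s, 'l) ring_scheme \<Rightarrow> ('s \<Rightarrow> 'r) \<Rightarrow> ('r, 'm) ring_scheme \<Rightarrow> ('s, 'b, 'n) module_scheme \<Rightarrow>
     ('r \<times> 'b \<Rightarrow>\<^sub>0 int) set" where
  "tensor_kernel A \<phi> R M = generate (free_Abelian_group (carrier R \<times> carrier M))
    ({frag_of (r \<oplus>\<^bsub>R\<^esub> r', m) - frag_of (r, m) - frag_of (r', m) | r r' m.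
        r \<in> carrier R \<and> r' \<in> carrier R \<and> m \<in> carrier M} \<union>
     {frag_of (r, m \<oplus>\<^bsub>M\<^esub> m') - frag_of (r, m) - frag_of (r, m') | r m m'.
        r \<in> carrier R \<and> m \<in> carrier M \<and> m' \<in> carrier M} \<union>
     {frag_of (r \<otimes>\<^bsub>R\<^esub> \<phi> a, m) - frag_of (r, a \<odot>\<^bsub>M\<^esub> m) | r a m.
        r \<in> carrier R \<and> a \<in> carrier A \<and> m \<in> carrier M})"

definition tensor_elt ::
    "('s, 'l) ring_scheme \<Rightarrow> ('s \<Rightarrow> 'r) \<Rightarrow> ('r, 'm) ring_scheme \<Rightarrow> ('s, 'b, 'n) module_scheme \<Rightarrow>
     'r \<Rightarrow> 'b \<Rightarrow> ('r \<times> 'b \<Rightarrow>\<^sub>0 int) set" where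
  "tensor_elt A \<phi> R M r m =
     tensor_kernel A \<phi> R M #>\<^bsub>free_Abelian_group (carrier R \<times> carrier M)\<^esub> frag_of (r, m)"

definition extend_scalars ::
    "('s, 'l) ring_scheme \<Rightarrow> ('s \<Rightarrow> 'r) \<Rightarrow> ('r, 'm) ring_scheme \<Rightarrow> ('s, 'b, 'n) module_scheme \<Rightarrow>
     ('r, ('r \<times> 'b \<Rightarrow>\<^sub>0 int) set) module" where
  "extend_scalars A \<phi> R M =
    (let E = free_Abelian_group (carrier R \<times> carrier M); N = tensor_kernel A \<phi> R M in
     \<lparr>carrier = rcosets\<^bsub>E\<^esub> N,
      monoid.mult = undefined,
      monoid.one = undefined,
      ring.zero = N,
      ring.add = (\<lambda>X Y. X <#>\<^bsub>E\<^esub> Y),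
      smult = (\<lambda>s X. \<Union>f\<in>X. N #>\<^bsub>E\<^esub> frag_extend (\<lambda>(r, m). frag_of (s \<otimes>\<^bsub>R\<^esub> r, m)) f)\<rparr>)"

definition restrict_scalars ::
    "('s \<Rightarrow> 'r) \<Rightarrow> ('r, 'b, 'n) module_scheme \<Rightarrow> ('s, 'b) module" where
  "restrict_scalars \<psi> M =
    \<lparr>carrier = carrier M, monoid.mult = monoid.mult M, monoid.one = monoid.one M, ring.zero = ring.zero M, ring.add = ring.add M,
     smult = (\<lambda>a x. \<psi> a \<odot>\<^bsub>M\<^esub> x)\<rparr>"

section \<open>Square classes\<close>

definition field_units :: "'a::field itself \<Rightarrow> 'a monoid" where
  "field_units F = \<lparr>carrier = UNIV - {0}, monoid.mult = (*), one = 1\<rparr>"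

definition group_squares :: "('g, 'm) monoid_scheme \<Rightarrow> 'g set" where
  "group_squares G = {x \<otimes>\<^bsub>G\<^esub> x | x. x \<in> carrier G}"

definition sq_ring :: "'a::field itself \<Rightarrow> ('a set \<Rightarrow>\<^sub>0 int) ring" where
  "sq_ring F = group_ring (field_units F Mod group_squares (field_units F))"

definition sq_class :: "'a::field \<Rightarrow> ('a set \<Rightarrow>\<^sub>0 int)" where
  "sq_class x =
     frag_of (group_squares (field_units TYPE('a)) #>\<^bsub>field_units TYPE('a)\<^esub> x)"

definition pfister :: "'a::field \<Rightarrow> ('a set \<Rightarrow>\<^sub>0 int)" where
  "pfister x = sq_class x \<ominus>\<^bsub>sq_ring TYPE('a)\<^esub> \<one>\<^bsub>sq_ring TYPE('a)\<^esub>"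

section \<open>Refined pre-Bloch groups\<close>

text \<open>The generators are the symbols \<open>Sym x\<close> with \<open>x \<noteq> 0\<close>.  Only for the field with two elements
  there is the further generator \<open>Const\<close>, the distinguished generator of \<open>RP(\<bbbF>\<^sub>2)\<close>.\<close>

datatype 'a rp_gen = Sym 'a | Const

definition rp_gens :: "'a::field itself \<Rightarrow> 'a rp_gen set" where
  "rp_gens F = Sym ` (UNIV - {0}) \<union> (if card (UNIV :: 'a set) = 2 then {Const} else {})"

definition rp_free :: "'a::field itself \<Rightarrow> ('a set \<Rightarrow>\<^sub>0 int, 'a rp_gen \<Rightarrow> ('a set \<Rightarrow>\<^sub>0 int)) module"
  where "rp_free F = free_module (sq_ring F) (rp_gens F)"

abbreviation rp_sym :: "'a::field \<Rightarrow> 'a rp_gen \<Rightarrow> ('a set \<Rightarrow>\<^sub>0 int)" where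
  "rp_sym x \<equiv> free_gen (sq_ring TYPE('a)) (Sym x)"

definition five_term :: "'a::field \<Rightarrow> 'a \<Rightarrow> 'a rp_gen \<Rightarrow> ('a set \<Rightarrow>\<^sub>0 int)" where
  "five_term x y =
    (let M = rp_free TYPE('a) in
     rp_sym x \<ominus>\<^bsub>M\<^esub> rp_sym y
       \<oplus>\<^bsub>M\<^esub> sq_class x \<odot>\<^bsub>M\<^esub> rp_sym (y / x)
       \<ominus>\<^bsub>M\<^esub> sq_class (inverse x - 1) \<odot>\<^bsub>M\<^esub> rp_sym ((1 - inverse x) / (1 - inverse y))
       \<oplus>\<^bsub>M\<^esub> sq_class (1 - x) \<odot>\<^bsub>M\<^esub> rp_sym ((1 - x) / (1 - y)))"

definition rp_relations :: "'a::field itself \<Rightarrow> ('a rp_gen \<Rightarrow> ('a set \<Rightarrow>\<^sub>0 int)) set" where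
  "rp_relations F =
    (let M = rp_free F in
     insert (rp_sym 1)
      (if card (UNIV :: 'a set) = 2 then
         (let c = free_gen (sq_ring F) Const in {c \<oplus>\<^bsub>M\<^esub> c \<oplus>\<^bsub>M\<^esub> c})
       else if card (UNIV :: 'a set) = 3 then
         (let p = rp_sym (-1) \<oplus>\<^bsub>M\<^esub> sq_class (-1) \<odot>\<^bsub>M\<^esub> rp_sym (-1) in {p \<oplus>\<^bsub>M\<^esub> p})
       else {five_term x y | x y. x \<notin> {0, 1} \<and> y \<notin> {0, 1}}))"

definition rp_kernel :: "'a::field itself \<Rightarrow> ('a rp_gen \<Rightarrow> ('a set \<Rightarrow>\<^sub>0 int)) set" where
  "rp_kernel F = span_submodule (sq_ring F) (rp_free F) (rp_relations F)"

definition RP :: "'a::field itself \<Rightarrow>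
    ('a set \<Rightarrow>\<^sub>0 int, ('a rp_gen \<Rightarrow> ('a set \<Rightarrow>\<^sub>0 int)) set) module" where
  "RP F = quotient_module (rp_free F) (rp_kernel F)"

definition rp :: "'a::field \<Rightarrow> ('a rp_gen \<Rightarrow> ('a set \<Rightarrow>\<^sub>0 int)) set" where
  "rp x = rp_kernel TYPE('a) +>\<^bsub>rp_free TYPE('a)\<^esub> rp_sym x"

definition psi1 :: "'a::field \<Rightarrow> ('a rp_gen \<Rightarrow> ('a set \<Rightarrow>\<^sub>0 int)) set" where
  "psi1 x = (let M = RP TYPE('a) in rp x \<oplus>\<^bsub>M\<^esub> sq_class (-1) \<odot>\<^bsub>M\<^esub> rp (inverse x))"

definition K1 :: "'a::field itself \<Rightarrow> ('a rp_gen \<Rightarrow> ('a set \<Rightarrow>\<^sub>0 int)) set set" where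
  "K1 F = span_submodule (sq_ring F) (RP F) {psi1 x | x. x \<noteq> 0}"

text \<open>For a field with at least four elements the expression below does not depend on the
  choice of \<open>x\<close>.\<close>

definition C_elt :: "'a::field itself \<Rightarrow> ('a rp_gen \<Rightarrow> ('a set \<Rightarrow>\<^sub>0 int)) set" where
  "C_elt F =
    (if card (UNIV :: 'a set) = 2 then
       rp_kernel F +>\<^bsub>rp_free F\<^esub> free_gen (sq_ring F) Const
     else if card (UNIV :: 'a set) = 3 then psi1 (-1)
     else
       (let M = RP F; x = (SOME x. x \<noteq> 0 \<and> x \<noteq> 1) in
        rp x \<oplus>\<^bsub>M\<^esub> sq_class (-1) \<odot>\<^bsub>M\<^esub> rp (1 - x) \<oplus>\<^bsub>M\<^esub> pfister (1 - x) \<odot>\<^bsub>M\<^esub> psi1 x))"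

definition D_sub :: "'a::field itself \<Rightarrow> ('a rp_gen \<Rightarrow> ('a set \<Rightarrow>\<^sub>0 int)) set set" where
  "D_sub F = span_submodule (sq_ring F) (RP F) {C_elt F \<oplus>\<^bsub>RP F\<^esub> C_elt F}"

definition RP_tilde :: "'a::field itself \<Rightarrow>
    ('a set \<Rightarrow>\<^sub>0 int, ('a rp_gen \<Rightarrow> ('a set \<Rightarrow>\<^sub>0 int)) set set) module" where
  "RP_tilde F = quotient_module (RP F) (K1 F)"

definition D_tilde :: "'a::field itself \<Rightarrow> ('a rp_gen \<Rightarrow> ('a set \<Rightarrow>\<^sub>0 int)) set set set" where
  "D_tilde F = (\<lambda>d. K1 F +>\<^bsub>RP F\<^esub> d) ` D_sub F"

definition RP_bar :: "'a::field itself \<Rightarrow>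
    ('a set \<Rightarrow>\<^sub>0 int, ('a rp_gen \<Rightarrow> ('a set \<Rightarrow>\<^sub>0 int)) set set set) module" where
  "RP_bar F = quotient_module (RP_tilde F) (D_tilde F)"

definition rp_bar :: "'a::field \<Rightarrow> ('a rp_gen \<Rightarrow> ('a set \<Rightarrow>\<^sub>0 int)) set set set" where
  "rp_bar x = D_tilde TYPE('a) +>\<^bsub>RP_tilde TYPE('a)\<^esub> (K1 TYPE('a) +>\<^bsub>RP TYPE('a)\<^esub> rp x)"

section \<open>Valuations and specialization\<close>

text \<open>Valuations are total functions whose value at \<open>0\<close> is irrelevant.\<close>

definition valuation :: "('a::field \<Rightarrow> 'g::linordered_ab_group_add) \<Rightarrow> bool" where
  "valuation v \<longleftrightarrow>
     (\<forall>a b. a \<noteq> 0 \<longrightarrow> b \<noteq> 0 \<longrightarrow> v (a * b) = v a + v b) \<and>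
     v ` (UNIV - {0}) = UNIV \<and>
     (\<forall>a b. a \<noteq> 0 \<longrightarrow> b \<noteq> 0 \<longrightarrow> a + b \<noteq> 0 \<longrightarrow> min (v a) (v b) \<le> v (a + b))"

definition valuation_ring :: "('a::field \<Rightarrow> 'g::linordered_ab_group_add) \<Rightarrow> 'a set" where
  "valuation_ring v = {a. a = 0 \<or> 0 \<le> v a}"

definition valuation_ideal :: "('a::field \<Rightarrow> 'g::linordered_ab_group_add) \<Rightarrow> 'a set" where
  "valuation_ideal v = {a. a = 0 \<or> 0 < v a}"

text \<open>The type \<open>'k\<close> is the residue field of \<open>v\<close>, with reduction map \<open>red\<close>: a surjective ring
  homomorphism from the valuation ring whose kernel is the maximal ideal.  The values of \<open>red\<close>
  outside the valuation ring are irrelevant.\<close>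

definition residue_field ::
    "('a::field \<Rightarrow> 'g::linordered_ab_group_add) \<Rightarrow> ('a \<Rightarrow> 'k::field) \<Rightarrow> bool" where
  "residue_field v red \<longleftrightarrow>
     (\<forall>a\<in>valuation_ring v. \<forall>b\<in>valuation_ring v.
        red (a + b) = red a + red b \<and> red (a * b) = red a * red b) \<and>
     red 1 = 1 \<and>
     red ` valuation_ring v = UNIV \<and>
     {a \<in> valuation_ring v. red a = 0} = valuation_ideal v"

definition val_units :: "('a::field \<Rightarrow> 'g::linordered_ab_group_add) \<Rightarrow> 'a monoid" where
  "val_units v = (field_units TYPE('a))\<lparr>carrier := {a. a \<noteq> 0 \<and> v a = 0}\<rparr>"

definition unit_sq_ring ::
    "('a::field \<Rightarrow> 'g::linordered_ab_group_add) \<Rightarrow> ('a set \<Rightarrow>\<^sub>0 int) ring" where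
  "unit_sq_ring v = group_ring (val_units v Mod group_squares (val_units v))"

text \<open>The ring homomorphisms from \<open>\<int>[U/U\<^sup>2]\<close> to \<open>R\<^sub>F\<close> and to \<open>R\<^sub>k\<close> induced by the inclusion of \<open>U\<close>
  and by reduction.  On a coset \<open>c\<close> of the squares of \<open>U\<close> they are given by the square class of
  \<open>F\<close> containing \<open>c\<close> and the square class of \<open>k\<close> containing the image of \<open>c\<close>.\<close>

definition unit_incl :: "('a::field set \<Rightarrow>\<^sub>0 int) \<Rightarrow> ('a set \<Rightarrow>\<^sub>0 int)" where
  "unit_incl = frag_extend (\<lambda>c.
     frag_of (group_squares (field_units TYPE('a)) <#>\<^bsub>field_units TYPE('a)\<^esub> c))"

definition unit_red :: "('a::field \<Rightarrow> 'k::field) \<Rightarrow> ('a set \<Rightarrow>\<^sub>0 int) \<Rightarrow> ('k set \<Rightarrow>\<^sub>0 int)" where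
  "unit_red red = frag_extend (\<lambda>c.
     frag_of (group_squares (field_units TYPE('k)) <#>\<^bsub>field_units TYPE('k)\<^esub> red ` c))"

definition Ind ::
    "('a::field \<Rightarrow> 'g::linordered_ab_group_add) \<Rightarrow> ('a \<Rightarrow> 'k::field) \<Rightarrow>
     ('k set \<Rightarrow>\<^sub>0 int, 'b, 'n) module_scheme \<Rightarrow>
     ('a set \<Rightarrow>\<^sub>0 int, (('a set \<Rightarrow>\<^sub>0 int) \<times> 'b \<Rightarrow>\<^sub>0 int) set) module" where
  "Ind v red M = extend_scalars (unit_sq_ring v) unit_incl (sq_ring TYPE('a))
                   (restrict_scalars (unit_red red) M)"

text \<open>\<open>ind_one v red M m\<close> is the element \<open>1 \<otimes> m\<close>.\<close>

definition ind_one ::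
    "('a::field \<Rightarrow> 'g::linordered_ab_group_add) \<Rightarrow> ('a \<Rightarrow> 'k::field) \<Rightarrow>
     ('k set \<Rightarrow>\<^sub>0 int, 'b, 'n) module_scheme \<Rightarrow> 'b \<Rightarrow>
     (('a set \<Rightarrow>\<^sub>0 int) \<times> 'b \<Rightarrow>\<^sub>0 int) set" where
  "ind_one v red M m = tensor_elt (unit_sq_ring v) unit_incl (sq_ring TYPE('a))
                   (restrict_scalars (unit_red red) M) \<one>\<^bsub>sq_ring TYPE('a)\<^esub> m"

text \<open>The map \<open>S\<^sub>v\<close>.  A homomorphism is determined by its values on the generators, so with the
  convention that it is \<^const>\<open>undefined\<close> outside the carrier it is unique as a function of HOL.\<close>

definition specialization ::
    "('a::field \<Rightarrow> 'g::linordered_ab_group_add) \<Rightarrow> ('a \<Rightarrow> 'k::field) \<Rightarrow>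
     ('a rp_gen \<Rightarrow> ('a set \<Rightarrow>\<^sub>0 int)) set set set \<Rightarrow>
     (('a set \<Rightarrow>\<^sub>0 int) \<times> ('k rp_gen \<Rightarrow> ('k set \<Rightarrow>\<^sub>0 int)) set set set \<Rightarrow>\<^sub>0 int) set" where
  "specialization v red = (THE S.
     S \<in> extensional (carrier (RP_bar TYPE('a))) \<and>
     S \<in> module_hom (sq_ring TYPE('a)) (RP_bar TYPE('a)) (Ind v red (RP_bar TYPE('k))) \<and>
     (\<forall>a. a \<noteq> 0 \<longrightarrow> v a = 0 \<longrightarrow> S (rp_bar a) = ind_one v red (RP_bar TYPE('k)) (rp_bar (red a))) \<and>
     (\<forall>a. a \<noteq> 0 \<longrightarrow> v a \<noteq> 0 \<longrightarrow> S (rp_bar a) = \<zero>\<^bsub>Ind v red (RP_bar TYPE('k))\<^esub>))"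

definition L_sub :: "('a::field \<Rightarrow> 'g::linordered_ab_group_add) \<Rightarrow>
    ('a rp_gen \<Rightarrow> ('a set \<Rightarrow>\<^sub>0 int)) set set set set" where
  "L_sub v = span_submodule (sq_ring TYPE('a)) (RP_bar TYPE('a)) {rp_bar a | a. a \<noteq> 0 \<and> v a \<noteq> 0}"

end

theory Submission
  imports Defs "HOL-Library.Function_Algebras"
begin

text \<open>
  In \<open>RP_bar\<close> the symbol \<open>[p\<^sub>0, p\<^sub>1, p\<^sub>2, p\<^sub>3]\<close> attached to four points of the projective line is
  totally antisymmetric: \<open>[x] = - \<langle>-1\<rangle>[1/x]\<close> holds because \<open>\<psi>\<^sub>1\<close> is killed, \<open>[x] = - \<langle>-1\<rangle>[1 - x]\<close>
  because \<open>3C = 0\<close> modulo \<open>\<psi>\<^sub>1\<close> and \<open>2C\<close> is killed, and \<open>[x] = - \<langle>x\<rangle>[1/x]\<close> follows from the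
  five-term relation.  Together with \<open>[1] = 0\<close> and the five-term relation these identities present
  \<open>RP_bar\<close> uniformly for all fields, including those with two or three elements.

  Hence \<open>S\<^sub>v\<close> is well defined as soon as it respects the five-term relation, which is a case
  distinction on the residues of \<open>x\<close> and \<open>y\<close> relative to \<open>0, 1, \<infinity>\<close>.  For the kernel one constructs an
  inverse modulo \<open>L\<close> by lifting residues.  If \<open>u \<equiv> 1\<close> modulo the maximal ideal, three terms of the
  five-term relation at \<open>(x, 1 - 1/u)\<close> lie in \<open>L\<close>, and what remains gives \<open>[xu] = - \<langle>x\<rangle>[1 - x] =
  \<langle>-x\<rangle>[x] = [x]\<close>; applying \<open>\<langle>-xu\<rangle>[xu] = [xu]\<close> once more gives \<open>\<langle>u\<rangle>[x] = [x]\<close>.  So neither the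
  lifts of symbols nor those of square classes matter.
\<close>

section \<open>Group rings\<close>

text \<open>Elements of \<open>RP_bar\<close> are cosets of cosets of cosets, and those of
  \<open>Ind\<close> are cosets of formal sums. To avoid computing with them, \<open>RP\<close>,
  \<open>RP_tilde\<close> and \<open>RP_bar\<close> are presented by one and the same free module
  with one action; only the projection changes. Maps are additive maps between the free objects,
  computed modulo congruences: \<open>tens_eq\<close> modulo the tensor relations,
  \<open>L_eq\<close> modulo the preimage of \<open>L_sub v\<close>. The obstacle in the five-term
  relation is that \<open><c>\<close> moves across the tensor sign only for a unit \<open>c\<close>,
  while coefficients such as \<open><x>\<close> and \<open><1 - x>\<close> need not come from units.
  If they do not, the relation over \<open>k\<close> cannot be invoked, and the terms have to
  vanish, cancel, or pair up under a common coefficient. The identity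
  \<open>[x] = - <x>[1/x]\<close> is robust in this respect: for a nonunit \<open>x\<close> both of
  its terms specialize to zero. For the inverse the obstacle is that lifts of symbols and of square
  classes are chosen without regard to multiplication. The lifting map is additive by construction,
  but it respects scalars and relations only modulo \<open>L_pre\<close>.\<close>

lemma group_ring_simps [simp]:
  "f \<in> carrier (group_ring G) \<longleftrightarrow> Poly_Mapping.keys f \<subseteq> carrier G"
  "\<one>\<^bsub>group_ring G\<^esub> = frag_of \<one>\<^bsub>G\<^esub>"
  "\<zero>\<^bsub>group_ring G\<^esub> = 0"
  "f \<oplus>\<^bsub>group_ring G\<^esub> g = f + g"
  by (simp_all add: group_ring_def)

text \<open>The multiplication of \<open>group_ring\<close> nests two \<open>frag_extend\<close>.
  Additivity in its right factor is additivity of \<open>frag_extend\<close> in the function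
  argument.\<close>

lemma frag_extend_fun_diff: "frag_extend (\<lambda>a. p a - q a) f = frag_extend p f - frag_extend q f"
  using subset_UNIV[of "Poly_Mapping.keys f"]
  by (induction f rule: frag_induction) (auto simp: frag_extend_diff)

lemma frag_extend_fun_add: "frag_extend (\<lambda>a. p a + q a) f = frag_extend p f + frag_extend q f"
  using subset_UNIV[of "Poly_Mapping.keys f"]
  by (induction f rule: frag_induction) (auto simp: frag_extend_diff)

lemma group_ring_mult_of [simp]:
  "frag_of a \<otimes>\<^bsub>group_ring G\<^esub> frag_of b = frag_of (a \<otimes>\<^bsub>G\<^esub> b)"
  by (simp add: group_ring_def)

lemma group_ring_mult_diff:
  "(f - g) \<otimes>\<^bsub>group_ring G\<^esub> h = f \<otimes>\<^bsub>group_ring G\<^esub> h - g \<otimes>\<^bsub>group_ring G\<^esub> h"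
  "h \<otimes>\<^bsub>group_ring G\<^esub> (f - g) = h \<otimes>\<^bsub>group_ring G\<^esub> f - h \<otimes>\<^bsub>group_ring G\<^esub> g"
  by (simp_all add: group_ring_def frag_extend_diff frag_extend_fun_diff)

lemma group_ring_mult_add:
  "(f + g) \<otimes>\<^bsub>group_ring G\<^esub> h = f \<otimes>\<^bsub>group_ring G\<^esub> h + g \<otimes>\<^bsub>group_ring G\<^esub> h"
  "h \<otimes>\<^bsub>group_ring G\<^esub> (f + g) = h \<otimes>\<^bsub>group_ring G\<^esub> f + h \<otimes>\<^bsub>group_ring G\<^esub> g"
  by (simp_all add: group_ring_def frag_extend_add frag_extend_fun_add)

lemma group_ring_mult_zero [simp]:
  "0 \<otimes>\<^bsub>group_ring G\<^esub> h = 0" "h \<otimes>\<^bsub>group_ring G\<^esub> 0 = 0"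
  using group_ring_mult_diff[of G 0 0 h] group_ring_mult_diff[of G h 0 0] by simp_all

text \<open>Both sides of each law are additive in every factor, so induction over differences
  leaves only basis elements, where the law is that of \<open>G\<close>.\<close>

lemma (in comm_group) cring_group_ring: "cring (group_ring G)"
proof -
  let ?R = "group_ring G"
  have mult_closed: "f \<otimes>\<^bsub>?R\<^esub> g \<in> carrier ?R" if "f \<in> carrier ?R" "g \<in> carrier ?R" for f g
  proof -
    have g: "Poly_Mapping.keys g \<subseteq> carrier G"
      using that by simp
    have *: "Poly_Mapping.keys (frag_of a \<otimes>\<^bsub>?R\<^esub> g) \<subseteq> carrier G" if "a \<in> carrier G" for a
      using g
    proof (induction g rule: frag_induction)
      case (diff p q)
      then show ?case
        using keys_diff[of "frag_of a \<otimes>\<^bsub>?R\<^esub> p"] by (fastforce simp: group_ring_mult_diff)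
    qed (use that in auto)
    have "Poly_Mapping.keys f \<subseteq> carrier G"
      using that by simp
    then have "Poly_Mapping.keys (f \<otimes>\<^bsub>?R\<^esub> g) \<subseteq> carrier G"
    proof (induction f rule: frag_induction)
      case (diff p q)
      then show ?case
        using keys_diff[of "p \<otimes>\<^bsub>?R\<^esub> g"] by (fastforce simp: group_ring_mult_diff)
    qed (use * in auto)
    then show ?thesis by simp
  qed
  have one: "\<one>\<^bsub>?R\<^esub> \<otimes>\<^bsub>?R\<^esub> f = f" if "f \<in> carrier ?R" for f
  proof -
    have "Poly_Mapping.keys f \<subseteq> carrier G"
      using that by simp
    then show ?thesis
      by (induction f rule: frag_induction) (auto simp: group_ring_mult_diff)
  qed
  have comm: "f \<otimes>\<^bsub>?R\<^esub> g = g \<otimes>\<^bsub>?R\<^esub> f" if "f \<in> carrier ?R" "g \<in> carrier ?R" for f g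
  proof -
    have g: "Poly_Mapping.keys g \<subseteq> carrier G"
      using that by simp
    have *: "frag_of a \<otimes>\<^bsub>?R\<^esub> g = g \<otimes>\<^bsub>?R\<^esub> frag_of a" if "a \<in> carrier G" for a
      using g by (induction g rule: frag_induction) (auto simp: group_ring_mult_diff that m_comm)
    have "Poly_Mapping.keys f \<subseteq> carrier G"
      using that by simp
    then show ?thesis
      by (induction f rule: frag_induction) (auto simp: group_ring_mult_diff *)
  qed
  have assoc: "(f \<otimes>\<^bsub>?R\<^esub> g) \<otimes>\<^bsub>?R\<^esub> h = f \<otimes>\<^bsub>?R\<^esub> (g \<otimes>\<^bsub>?R\<^esub> h)"
    if "f \<in> carrier ?R" "g \<in> carrier ?R" "h \<in> carrier ?R" for f g h
  proof -
    have keys: "Poly_Mapping.keys f \<subseteq> carrier G" "Poly_Mapping.keys g \<subseteq> carrier G"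
      "Poly_Mapping.keys h \<subseteq> carrier G"
      using that by simp_all
    have 1: "(frag_of a \<otimes>\<^bsub>?R\<^esub> frag_of b) \<otimes>\<^bsub>?R\<^esub> h = frag_of a \<otimes>\<^bsub>?R\<^esub> (frag_of b \<otimes>\<^bsub>?R\<^esub> h)"
      if "a \<in> carrier G" "b \<in> carrier G" for a b
      using keys(3)
    proof (induction h rule: frag_induction)
      case (diff p q)
      then show ?case
        by (metis group_ring_mult_diff(2))
    qed (auto simp: that m_assoc)
    have 2: "(frag_of a \<otimes>\<^bsub>?R\<^esub> g) \<otimes>\<^bsub>?R\<^esub> h = frag_of a \<otimes>\<^bsub>?R\<^esub> (g \<otimes>\<^bsub>?R\<^esub> h)"
      if "a \<in> carrier G" for a
      using keys(2)
    proof (induction g rule: frag_induction)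
      case (diff p q)
      then show ?case
        by (metis group_ring_mult_diff)
    qed (use 1 that in auto)
    show ?thesis
      using keys(1)
    proof (induction f rule: frag_induction)
      case (diff p q)
      then show ?case
        by (metis group_ring_mult_diff(1))
    qed (use 2 in auto)
  qed
  show ?thesis
  proof (rule cringI)
    have "\<exists>g. Poly_Mapping.keys g \<subseteq> carrier G \<and> g + f = 0"
      if "Poly_Mapping.keys f \<subseteq> carrier G" for f :: "'a \<Rightarrow>\<^sub>0 int"
      using that by (intro exI[of _ "- f"]) simp
    then show "abelian_group ?R"
      by (intro abelian_groupI) (auto dest: subsetD[OF keys_add] simp: Bex_def add_ac)
    show "Group.comm_monoid ?R"
      by (rule comm_monoidI) (use mult_closed one comm assoc in \<open>auto\<close>)
  qed (auto simp: group_ring_mult_add)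
qed

section \<open>Presentations of modules\<close>

context module
begin

lemma submodule_zero: "submodule H R M \<Longrightarrow> \<zero>\<^bsub>M\<^esub> \<in> H"
  by (auto dest!: submodule.axioms(1) subgroup.one_closed)

lemma submodule_minus:
  "\<lbrakk>submodule H R M; x \<in> H; y \<in> H\<rbrakk> \<Longrightarrow> x \<ominus>\<^bsub>M\<^esub> y \<in> H"
  by (simp add: a_minus_def submoduleE)

lemma span_is_submodule:
  assumes "S \<subseteq> carrier M"
  shows "submodule (span_submodule R M S) R M"
proof (rule submoduleI)
  show "span_submodule R M S \<subseteq> carrier M"
    using assms carrier_is_submodule by (auto simp: span_submodule_def)
qed (auto simp: span_submodule_def submodule_zero submoduleE)

lemma subset_span: "S \<subseteq> span_submodule R M S"
  by (auto simp: span_submodule_def)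

lemma span_least: "\<lbrakk>submodule H R M; S \<subseteq> H\<rbrakk> \<Longrightarrow> span_submodule R M S \<subseteq> H"
  by (auto simp: span_submodule_def)

end

text \<open>Elements of \<open>M\<close> are represented by elements of a subgroup \<open>X\<close> of a type of class
  \<^class>\<open>ab_group_add\<close>.  The action on \<open>X\<close> satisfies the module laws only up to \<open>\<pi>\<close>.\<close>

locale presented_module = cring R for R :: "('r, 'm) ring_scheme" (structure) +
  fixes M :: "('r, 'c, 'n) module_scheme"
    and X :: "'b::ab_group_add set" and act :: "'r \<Rightarrow> 'b \<Rightarrow> 'b" and \<pi> :: "'b \<Rightarrow> 'c"
  assumes X_zero [simp, intro]: "0 \<in> X"
    and X_diff [simp, intro]: "\<lbrakk>f \<in> X; g \<in> X\<rbrakk> \<Longrightarrow> f - g \<in> X"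
    and act_closed [simp, intro]: "\<lbrakk>r \<in> carrier R; f \<in> X\<rbrakk> \<Longrightarrow> act r f \<in> X"
    and carrier_eq: "carrier M = \<pi> ` X"
    and proj_add: "\<lbrakk>f \<in> X; g \<in> X\<rbrakk> \<Longrightarrow> \<pi> f \<oplus>\<^bsub>M\<^esub> \<pi> g = \<pi> (f + g)"
    and proj_zero: "\<zero>\<^bsub>M\<^esub> = \<pi> 0"
    and proj_smult: "\<lbrakk>r \<in> carrier R; f \<in> X\<rbrakk> \<Longrightarrow> r \<odot>\<^bsub>M\<^esub> \<pi> f = \<pi> (act r f)"
    and act_add_left: "\<lbrakk>r \<in> carrier R; s \<in> carrier R; f \<in> X\<rbrakk> \<Longrightarrow>
          \<pi> (act (r \<oplus> s) f) = \<pi> (act r f + act s f)"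
    and act_add: "\<lbrakk>r \<in> carrier R; f \<in> X; g \<in> X\<rbrakk> \<Longrightarrow> \<pi> (act r (f + g)) = \<pi> (act r f + act r g)"
    and act_mult: "\<lbrakk>r \<in> carrier R; s \<in> carrier R; f \<in> X\<rbrakk> \<Longrightarrow>
          \<pi> (act (r \<otimes> s) f) = \<pi> (act r (act s f))"
    and act_one: "f \<in> X \<Longrightarrow> \<pi> (act \<one> f) = \<pi> f"
begin

lemma X_minus [simp, intro]: "f \<in> X \<Longrightarrow> - f \<in> X"
  using X_diff[OF X_zero] by simp

lemma X_add [simp, intro]: "\<lbrakk>f \<in> X; g \<in> X\<rbrakk> \<Longrightarrow> f + g \<in> X"
  using X_diff[of f "- g"] by simp

lemma presented_is_module: "Module.module R M"
proof (rule moduleI)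
  show "abelian_group M"
  proof (rule abelian_groupI)
    fix x assume "x \<in> carrier M"
    then obtain f where "f \<in> X" "x = \<pi> f"
      by (auto simp: carrier_eq)
    then show "\<exists>y\<in>carrier M. y \<oplus>\<^bsub>M\<^esub> x = \<zero>\<^bsub>M\<^esub>"
      by (intro bexI[of _ "\<pi> (- f)"]) (simp_all add: proj_add proj_zero carrier_eq)
  qed (auto simp: carrier_eq proj_add proj_zero add_ac)
qed (use cring_axioms in \<open>auto simp: carrier_eq proj_add proj_zero proj_smult act_add_left act_add act_mult act_one\<close>)

sublocale M: Module.module R M
  by (rule presented_is_module)

lemma proj_closed [simp, intro]: "f \<in> X \<Longrightarrow> \<pi> f \<in> carrier M"
  by (simp add: carrier_eq)

lemma proj_minus: "f \<in> X \<Longrightarrow> \<ominus>\<^bsub>M\<^esub> \<pi> f = \<pi> (- f)"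
  by (rule M.minus_equality) (simp_all add: proj_add proj_zero)

lemma proj_diff: "\<lbrakk>f \<in> X; g \<in> X\<rbrakk> \<Longrightarrow> \<pi> f \<ominus>\<^bsub>M\<^esub> \<pi> g = \<pi> (f - g)"
  by (simp add: a_minus_def proj_minus proj_add)

lemma proj_eq_iff: "\<lbrakk>f \<in> X; g \<in> X\<rbrakk> \<Longrightarrow> \<pi> f = \<pi> g \<longleftrightarrow> \<pi> (f - g) = \<zero>\<^bsub>M\<^esub>"
  by (metis M.add.inv_closed M.add.r_inv M.minus_equality M.add.inv_inv a_minus_def proj_closed proj_diff)

text \<open>The counterpart in \<open>X\<close> of a submodule. It mentions \<open>act\<close> but
  not \<open>\<pi>\<close>, so one set serves for all quotients that share \<open>X\<close> and
  \<open>act\<close>.\<close>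

definition invariant :: "'b set \<Rightarrow> bool" where
  "invariant Z \<longleftrightarrow> Z \<subseteq> X \<and> 0 \<in> Z \<and> (\<forall>f\<in>Z. \<forall>g\<in>Z. f - g \<in> Z) \<and>
     (\<forall>r\<in>carrier R. \<forall>f\<in>Z. act r f \<in> Z)"

lemma invariant_preimage:
  assumes "submodule K R M"
  shows "invariant {f \<in> X. \<pi> f \<in> K}"
proof -
  have "\<pi> 0 \<in> K"
    using M.submodule_zero[OF assms] by (simp add: proj_zero)
  moreover have "\<pi> (f - g) \<in> K" if "f \<in> X" "\<pi> f \<in> K" "g \<in> X" "\<pi> g \<in> K" for f g
    using M.submodule_minus[OF assms that(2,4)] that by (simp add: proj_diff)
  moreover have "\<pi> (act r f) \<in> K" if "r \<in> carrier R" "f \<in> X" "\<pi> f \<in> K" for r f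
    using M.submoduleE(4)[OF assms that(1,3)] that by (simp add: proj_smult)
  ultimately show ?thesis
    by (auto simp: invariant_def)
qed

lemma invariant_add:
  assumes "invariant Z" "f \<in> Z" "g \<in> Z"
  shows "f + g \<in> Z"
proof -
  have "f - (0 - g) \<in> Z"
    using assms unfolding invariant_def by blast
  then show ?thesis by simp
qed

lemma submodule_image:
  assumes "invariant Z"
  shows "submodule (\<pi> ` Z) R M"
proof (rule M.submoduleI)
  have ZX: "f \<in> X" if "f \<in> Z" for f
    using assms that by (auto simp: invariant_def)
  show "\<pi> ` Z \<subseteq> carrier M"
    using ZX by auto
  show "\<zero>\<^bsub>M\<^esub> \<in> \<pi> ` Z"
    using assms by (auto simp: invariant_def proj_zero)
  show "\<ominus>\<^bsub>M\<^esub> x \<in> \<pi> ` Z" if "x \<in> \<pi> ` Z" for x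
  proof -
    from that obtain f where f: "f \<in> Z" "x = \<pi> f"
      by auto
    have "0 - f \<in> Z"
      using assms f(1) unfolding invariant_def by blast
    then show ?thesis
      using f ZX by (auto simp: proj_minus)
  qed
  show "x \<oplus>\<^bsub>M\<^esub> y \<in> \<pi> ` Z" if "x \<in> \<pi> ` Z" "y \<in> \<pi> ` Z" for x y
    using that assms ZX by (auto simp: proj_add intro!: imageI invariant_add)
  show "r \<odot>\<^bsub>M\<^esub> x \<in> \<pi> ` Z" if "r \<in> carrier R" "x \<in> \<pi> ` Z" for r x
    using that assms ZX by (auto simp: proj_smult invariant_def)
qed

text \<open>A preimage of an element of the span differs from some element of \<open>Z\<close> by
  something that projects to zero, and \<open>ker\<close> puts that into \<open>Z\<close>. Applied
  to each quotient in turn, it reduces a statement about nested spans to one about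
  \<open>Z\<close>.\<close>

lemma span_preimage_subset:
  assumes Z: "invariant Z" and ker: "\<And>f. f \<in> X \<Longrightarrow> \<pi> f = \<zero>\<^bsub>M\<^esub> \<Longrightarrow> f \<in> Z" and S: "S \<subseteq> \<pi> ` Z"
    and f: "f \<in> X" "\<pi> f \<in> span_submodule R M S"
  shows "f \<in> Z"
proof -
  have "\<pi> f \<in> \<pi> ` Z"
    using M.span_least[OF submodule_image[OF Z] S] f by auto
  then obtain g where g: "g \<in> Z" "\<pi> f = \<pi> g"
    by auto
  then have gX: "g \<in> X"
    using Z by (auto simp: invariant_def)
  have "f - g \<in> Z"
    using ker[of "f - g"] f g gX proj_eq_iff[of f g] by auto
  from invariant_add[OF Z this g(1)] show ?thesis
    by simp
qed

lemma quotient_module_zero_iff: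
  assumes "submodule K R M" "f \<in> X"
  shows "K +>\<^bsub>M\<^esub> \<pi> f = \<zero>\<^bsub>quotient_module M K\<^esub> \<longleftrightarrow> \<pi> f \<in> K"
proof -
  interpret K: abelian_subgroup K M
    using assms(1) by (intro abelian_subgroupI3 additive_subgroup.intro M.abelian_group_axioms)
      (auto dest: submodule.axioms(1))
  show ?thesis
    using assms(2) M.a_coset_join1[OF _ _ K.a_subgroup] M.a_coset_join2[OF _ K.a_subgroup]
    by (auto simp: quotient_module_def)
qed

text \<open>Only the projection changes, so quotients can be iterated while the representatives stay
  in \<open>X\<close>.\<close>

lemma presented_quotient_module:
  assumes K: "submodule K R M"
  shows "presented_module R (quotient_module M K) X act (\<lambda>f. K +>\<^bsub>M\<^esub> \<pi> f)"
proof -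
  interpret K: abelian_subgroup K M
    using K by (intro abelian_subgroupI3 additive_subgroup.intro M.abelian_group_axioms)
      (auto dest: submodule.axioms(1))
  show ?thesis
  proof (unfold_locales, goal_cases)
    case 4
    show ?case
      by (auto simp: quotient_module_def A_RCOSETS_def' carrier_eq)
  next
    case (5 f g)
    then show ?case
      by (simp add: quotient_module_def K.a_rcos_sum proj_add)
  next
    case 6
    have "K +>\<^bsub>M\<^esub> \<zero>\<^bsub>M\<^esub> = K"
      using K.a_subset by (simp add: M.a_coset_add_zero)
    then show ?case
      by (simp add: quotient_module_def flip: proj_zero)
  next
    \<comment> \<open>The scalar multiple of a coset is defined as a union over its elements. It is
      a coset because all members of the union coincide.\<close>
    case (7 r f)
    have "K +>\<^bsub>M\<^esub> (r \<odot>\<^bsub>M\<^esub> y) = K +>\<^bsub>M\<^esub> (r \<odot>\<^bsub>M\<^esub> \<pi> f)" if y: "y \<in> K +>\<^bsub>M\<^esub> \<pi> f" for y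
    proof -
      obtain h where h: "h \<in> K" "y = h \<oplus>\<^bsub>M\<^esub> \<pi> f"
        using y by (auto simp: a_r_coset_def')
      have "h \<in> carrier M"
        using h(1) K.a_subset by auto
      then have "r \<odot>\<^bsub>M\<^esub> y = r \<odot>\<^bsub>M\<^esub> h \<oplus>\<^bsub>M\<^esub> r \<odot>\<^bsub>M\<^esub> \<pi> f"
        using 7 by (simp add: h M.smult_r_distr)
      moreover have "r \<odot>\<^bsub>M\<^esub> h \<in> K"
        using K h(1) 7 M.submoduleE(4) by blast
      ultimately have "r \<odot>\<^bsub>M\<^esub> y \<in> K +>\<^bsub>M\<^esub> (r \<odot>\<^bsub>M\<^esub> \<pi> f)"
        by (auto simp: a_r_coset_def')
      then show ?thesis
        using M.a_repr_independence[OF _ _ K.a_subgroup] 7 by (metis M.smult_closed proj_closed)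
    qed
    moreover have "\<pi> f \<in> K +>\<^bsub>M\<^esub> \<pi> f"
      using 7 K.a_rcos_self by auto
    ultimately show ?case
      using 7 by (auto simp: quotient_module_def proj_smult)
  qed (simp_all add: act_add_left act_add act_mult act_one)
qed

end

text \<open>Serves twice: against the zero map it makes the kernel of the specialization a
  submodule, and against a second candidate it yields uniqueness.\<close>

lemma submodule_equalizer:
  assumes M: "Module.module R M" and N: "Module.module R N"
    and h: "h \<in> module_hom R M N" and h': "h' \<in> module_hom R M N"
  shows "submodule {x \<in> carrier M. h x = h' x} R M"
proof -
  interpret M: Module.module R M by fact
  interpret N: Module.module R N by fact
  have hom: "g \<zero>\<^bsub>M\<^esub> = \<zero>\<^bsub>N\<^esub>" "x \<in> carrier M \<Longrightarrow> g (\<ominus>\<^bsub>M\<^esub> x) = \<ominus>\<^bsub>N\<^esub> g x" if g: "g \<in> module_hom R M N" for g x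
  proof -
    have cl: "g x \<in> carrier N" if "x \<in> carrier M" for x
      using g that by (auto simp: module_hom_def)
    have add: "g (x \<oplus>\<^bsub>M\<^esub> y) = g x \<oplus>\<^bsub>N\<^esub> g y" if "x \<in> carrier M" "y \<in> carrier M" for x y
      using g that by (auto simp: module_hom_def)
    show 0: "g \<zero>\<^bsub>M\<^esub> = \<zero>\<^bsub>N\<^esub>"
      using add[of "\<zero>\<^bsub>M\<^esub>" "\<zero>\<^bsub>M\<^esub>"] cl[of "\<zero>\<^bsub>M\<^esub>"] by (simp add: N.add.r_cancel_one')
    show "g (\<ominus>\<^bsub>M\<^esub> x) = \<ominus>\<^bsub>N\<^esub> g x" if x: "x \<in> carrier M"
      using add[of "\<ominus>\<^bsub>M\<^esub> x" x] cl x 0 by (intro N.minus_equality[symmetric]) (simp_all add: M.l_neg)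
  qed
  show ?thesis
    by (rule M.submoduleI) (use hom[OF h] hom[OF h'] h h' in \<open>auto simp: module_hom_def\<close>)
qed

lemma zero_module_hom:
  assumes "Module.module R N"
  shows "(\<lambda>x. \<zero>\<^bsub>N\<^esub>) \<in> module_hom R M N"
proof -
  interpret Module.module R N by fact
  show ?thesis
    by (simp add: module_hom_def)
qed

section \<open>Free modules over group rings\<close>

text \<open>A group element times a generator. These elements generate the free module as an abelian
  group, which is what inductions on it use.\<close>

definition free_elt :: "'g \<Rightarrow> 's \<Rightarrow> 's \<Rightarrow> 'g \<Rightarrow>\<^sub>0 int" where
  "free_elt c s = (\<lambda>t. if t = s then frag_of c else 0)"

lemma carrier_free_group_ring_module:
  "carrier (free_module (group_ring G) S) =
     {f. (\<forall>s. Poly_Mapping.keys (f s) \<subseteq> carrier G) \<and> (\<forall>s. s \<notin> S \<longrightarrow> f s = 0) \<and> finite {s. f s \<noteq> 0}}"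
  by (simp add: free_module_def)

lemma free_gen_eq_free_elt: "free_gen (group_ring G) s = free_elt \<one>\<^bsub>G\<^esub> s"
  by (simp add: free_gen_def free_elt_def fun_eq_iff)

lemma free_module_smult_free_elt [simp]:
  "frag_of c \<odot>\<^bsub>free_module (group_ring G) S\<^esub> free_elt d s = free_elt (c \<otimes>\<^bsub>G\<^esub> d) s"
  by (auto simp: free_module_def free_elt_def fun_eq_iff)

lemma free_module_smult_diff:
  "r \<odot>\<^bsub>free_module (group_ring G) S\<^esub> (f - g) =
     r \<odot>\<^bsub>free_module (group_ring G) S\<^esub> f - r \<odot>\<^bsub>free_module (group_ring G) S\<^esub> g"
  "(r - r') \<odot>\<^bsub>free_module (group_ring G) S\<^esub> f =
     r \<odot>\<^bsub>free_module (group_ring G) S\<^esub> f - r' \<odot>\<^bsub>free_module (group_ring G) S\<^esub> f"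
  by (auto simp: free_module_def fun_eq_iff group_ring_mult_diff)

lemma free_module_smult_add:
  "r \<odot>\<^bsub>free_module (group_ring G) S\<^esub> (f + g) =
     r \<odot>\<^bsub>free_module (group_ring G) S\<^esub> f + r \<odot>\<^bsub>free_module (group_ring G) S\<^esub> g"
  "(r + r') \<odot>\<^bsub>free_module (group_ring G) S\<^esub> f =
     r \<odot>\<^bsub>free_module (group_ring G) S\<^esub> f + r' \<odot>\<^bsub>free_module (group_ring G) S\<^esub> f"
  by (auto simp: free_module_def fun_eq_iff group_ring_mult_add)

lemma free_module_smult_zero [simp]:
  "r \<odot>\<^bsub>free_module (group_ring G) S\<^esub> 0 = 0" "0 \<odot>\<^bsub>free_module (group_ring G) S\<^esub> f = 0"
  by (auto simp: free_module_def fun_eq_iff)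

lemma (in comm_group) presented_free_module:
  "presented_module (group_ring G) (free_module (group_ring G) S)
     (carrier (free_module (group_ring G) S)) (smult (free_module (group_ring G) S)) (\<lambda>f. f)"
proof -
  let ?R = "group_ring G" let ?M = "free_module ?R S"
  interpret R: cring ?R
    by (rule cring_group_ring)
  have X: "f - g \<in> carrier ?M" if f: "f \<in> carrier ?M" and g: "g \<in> carrier ?M" for f g
  proof -
    have "finite ({s. f s \<noteq> 0} \<union> {s. g s \<noteq> 0})"
      using f g unfolding carrier_free_group_ring_module by simp
    then have "finite {s. (f - g) s \<noteq> 0}"
      by (rule rev_finite_subset) auto
    moreover have "Poly_Mapping.keys ((f - g) s) \<subseteq> carrier G" for s
    proof -
      have "Poly_Mapping.keys (f s) \<subseteq> carrier G" "Poly_Mapping.keys (g s) \<subseteq> carrier G"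
        using f g unfolding carrier_free_group_ring_module by blast+
      then show ?thesis
        using keys_diff[of "f s" "g s"] by auto
    qed
    moreover have "(f - g) s = 0" if "s \<notin> S" for s
      using f g that unfolding carrier_free_group_ring_module by simp
    ultimately show ?thesis
      unfolding carrier_free_group_ring_module by blast
  qed
  have smult: "r \<odot>\<^bsub>?M\<^esub> f \<in> carrier ?M" if r: "r \<in> carrier ?R" and f: "f \<in> carrier ?M" for r f
  proof -
    have eq: "r \<odot>\<^bsub>?M\<^esub> f = (\<lambda>s. r \<otimes>\<^bsub>?R\<^esub> f s)"
      by (simp add: free_module_def)
    have "finite {s. f s \<noteq> 0}"
      using f unfolding carrier_free_group_ring_module by simp
    then have "finite {s. r \<otimes>\<^bsub>?R\<^esub> f s \<noteq> 0}"
      by (rule rev_finite_subset) auto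
    moreover have "Poly_Mapping.keys (r \<otimes>\<^bsub>?R\<^esub> f s) \<subseteq> carrier G" for s
    proof -
      have "f s \<in> carrier ?R"
        using f unfolding carrier_free_group_ring_module by simp
      then show ?thesis
        using R.m_closed[OF r] by simp
    qed
    moreover have "r \<otimes>\<^bsub>?R\<^esub> f s = 0" if "s \<notin> S" for s
      using f that unfolding carrier_free_group_ring_module by simp
    ultimately show ?thesis
      unfolding eq carrier_free_group_ring_module by blast
  qed
  show ?thesis
  proof (unfold_locales, goal_cases)
    case (10 r s f)
    then have "\<forall>t. f t \<in> carrier ?R"
      by (simp add: free_module_def)
    with 10 show ?case
      by (simp add: free_module_def R.m_assoc del: group_ring_simps)
  next
    case (11 f)
    then have "\<forall>t. f t \<in> carrier ?R"
      by (simp add: free_module_def)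
    then show ?case
      by (simp add: free_module_def del: group_ring_simps)
  next
    case 1
    show ?case by (simp add: carrier_free_group_ring_module)
  next
    case (2 f g)
    then show ?case by (rule X)
  next
    case (3 r f)
    then show ?case by (rule smult)
  qed (simp_all add: free_module_smult_add, simp_all add: free_module_def fun_eq_iff)
qed

text \<open>Induction on the finite support. The value at one point is split off, and this value is
  itself an integral combination of group elements.\<close>

lemma (in comm_group) free_module_induct [consumes 1, case_names zero diff free_elt]:
  assumes f: "f \<in> carrier (free_module (group_ring G) S)"
    and zero: "P 0"
    and diff: "\<And>f g. \<lbrakk>f \<in> carrier (free_module (group_ring G) S);
      g \<in> carrier (free_module (group_ring G) S); P f; P g\<rbrakk> \<Longrightarrow> P (f - g)"
    and free_elt: "\<And>c s. \<lbrakk>c \<in> carrier G; s \<in> S\<rbrakk> \<Longrightarrow> P (free_elt c s)"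
  shows "P f"
proof -
  let ?X = "carrier (free_module (group_ring G) S)"
  interpret presented_module "group_ring G" "free_module (group_ring G) S" ?X
    "smult (free_module (group_ring G) S)" "\<lambda>f. f"
    by (rule presented_free_module)
  \<comment> \<open>Membership in the carrier is carried along because \<open>diff\<close> demands
    it.\<close>
  define Q where "Q f \<longleftrightarrow> f \<in> ?X \<and> P f" for f
  have Q_diff: "Q (f - g)" if "Q f" "Q g" for f g
    using that diff[of f g] X_diff[of f g] unfolding Q_def by blast
  have Q_zero: "Q 0"
    using zero by (simp add: Q_def)
  have Q_add: "Q (f + g)" if "Q f" "Q g" for f g
    using Q_diff[OF that(1) Q_diff[OF Q_zero that(2)]] by (simp only: diff_0 diff_minus_eq_add)
  have single: "Q (\<lambda>t. if t = s then r else 0)" if "s \<in> S" "Poly_Mapping.keys r \<subseteq> carrier G" for s r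
    using that(2)
  proof (induction r rule: frag_induction)
    case zero
    then show ?case
      using Q_zero by (simp add: zero_fun_def)
  next
    case (one c)
    then show ?case
      using free_elt[of c s] that(1)
      by (auto simp: Q_def free_elt_def carrier_free_group_ring_module)
  next
    case (diff a b)
    have "(\<lambda>t. if t = s then a - b else 0) =
        (\<lambda>t. if t = s then a else 0) - (\<lambda>t. if t = s then b else 0)"
      by (simp add: fun_eq_iff)
    with Q_diff[OF diff(1) diff(2)] show ?case
      by metis
  qed
  have "finite A \<Longrightarrow> f \<in> ?X \<Longrightarrow> {s. f s \<noteq> 0} = A \<Longrightarrow> Q f" for A f
  proof (induction A arbitrary: f rule: finite_induct)
    case empty
    then have "f = 0"
      by (auto simp: fun_eq_iff)
    then show ?case
      using Q_zero by metis
  next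
    case (insert s A)
    define g where "g = (\<lambda>t. if t = s then f s else 0)"
    have "s \<in> S" "Poly_Mapping.keys (f s) \<subseteq> carrier G"
      using insert.prems by (auto simp: carrier_free_group_ring_module)
    then have "Q g"
      unfolding g_def by (rule single)
    moreover have "Q (f - g)"
    proof (rule insert.IH)
      show "f - g \<in> ?X"
        using insert.prems \<open>Q g\<close> by (auto simp: Q_def)
      have "t \<in> insert s A \<longleftrightarrow> f t \<noteq> 0" for t
        using insert.prems by auto
      then show "{t. (f - g) t \<noteq> 0} = A"
        using insert.hyps by (auto simp: g_def split: if_splits)
    qed
    ultimately show ?case
      using Q_add[of "f - g" g] by (simp only: diff_add_cancel)
  qed
  then show ?thesis
    using f by (auto simp: Q_def carrier_free_group_ring_module)
qed

text \<open>Built from one additive map of the coefficients for each generator. This admits maps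
  that are not linear over the group ring, such as \<open>gamma\<close>.\<close>

definition free_extend :: "('s \<Rightarrow> ('g \<Rightarrow>\<^sub>0 int) \<Rightarrow> 'b::ab_group_add) \<Rightarrow> ('s \<Rightarrow> ('g \<Rightarrow>\<^sub>0 int)) \<Rightarrow> 'b" where
  "free_extend \<Phi> f = (\<Sum>s | f s \<noteq> 0. \<Phi> s (f s))"

lemma free_extend_diff:
  assumes \<Phi>: "\<And>s a b. \<Phi> s (a - b) = \<Phi> s a - \<Phi> s b"
    and f: "f \<in> carrier (free_module (group_ring G) S)"
    and g: "g \<in> carrier (free_module (group_ring G) S)"
  shows "free_extend \<Phi> (f - g) = free_extend \<Phi> f - free_extend \<Phi> g"
proof -
  let ?A = "{s. f s \<noteq> 0} \<union> {s. g s \<noteq> 0}"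
  have fin: "finite ?A"
    using f g by (auto simp: carrier_free_group_ring_module)
  have [simp]: "\<Phi> s 0 = 0" for s
    using \<Phi>[of s 0 0] by simp
  have *: "free_extend \<Phi> h = (\<Sum>s\<in>?A. \<Phi> s (h s))" if "{s. h s \<noteq> 0} \<subseteq> ?A" for h
    unfolding free_extend_def by (rule sum.mono_neutral_left[OF fin that]) auto
  have "free_extend \<Phi> (f - g) = (\<Sum>s\<in>?A. \<Phi> s ((f - g) s))"
    by (rule *[of "f - g"]) auto
  also have "\<dots> = (\<Sum>s\<in>?A. \<Phi> s (f s)) - (\<Sum>s\<in>?A. \<Phi> s (g s))"
    by (simp only: minus_apply \<Phi> sum_subtractf)
  also have "\<dots> = free_extend \<Phi> f - free_extend \<Phi> g"
    by (simp only: *[of f, OF Un_upper1] *[of g, OF Un_upper2])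
  finally show ?thesis .
qed

lemma free_extend_zero [simp]: "free_extend \<Phi> 0 = 0"
  by (simp add: free_extend_def)

lemma free_extend_free_elt [simp]: "free_extend \<Phi> (free_elt c s) = \<Phi> s (frag_of c)"
proof -
  have "{t. free_elt c s t \<noteq> 0} = {s}"
    by (auto simp: free_elt_def)
  then show ?thesis
    by (simp add: free_extend_def free_elt_def)
qed

section \<open>Extension of scalars\<close>

locale scalar_extension = cring R for R :: "('r, 'm) ring_scheme" (structure) +
  fixes A :: "('s, 'l) ring_scheme" and \<phi> :: "'s \<Rightarrow> 'r" and M :: "('s, 'b, 'n) module_scheme"
  assumes \<phi>_closed: "a \<in> carrier A \<Longrightarrow> \<phi> a \<in> carrier R"
    and M_add_closed: "\<lbrakk>m \<in> carrier M; m' \<in> carrier M\<rbrakk> \<Longrightarrow> m \<oplus>\<^bsub>M\<^esub> m' \<in> carrier M"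
    and M_smult_closed: "\<lbrakk>a \<in> carrier A; m \<in> carrier M\<rbrakk> \<Longrightarrow> a \<odot>\<^bsub>M\<^esub> m \<in> carrier M"
begin

abbreviation "E \<equiv> free_Abelian_group (carrier R \<times> carrier M)"
abbreviation "N \<equiv> tensor_kernel A \<phi> R M"

definition tensor_act :: "'r \<Rightarrow> ('r \<times> 'b \<Rightarrow>\<^sub>0 int) \<Rightarrow> ('r \<times> 'b \<Rightarrow>\<^sub>0 int)" where
  "tensor_act s = frag_extend (\<lambda>(r, m). frag_of (s \<otimes> r, m))"

lemma keys_frag_diff_subset:
  "\<lbrakk>Poly_Mapping.keys a \<subseteq> S; Poly_Mapping.keys b \<subseteq> S\<rbrakk> \<Longrightarrow> Poly_Mapping.keys (a - b) \<subseteq> S"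
  using keys_diff[of a b] by blast

lemma E_diff: "\<lbrakk>a \<in> carrier E; b \<in> carrier E\<rbrakk> \<Longrightarrow> a - b \<in> carrier E"
  using keys_frag_diff_subset by simp

definition tensor_gens :: "('r \<times> 'b \<Rightarrow>\<^sub>0 int) set" where
  "tensor_gens =
     {frag_of (r \<oplus> r', m) - frag_of (r, m) - frag_of (r', m) | r r' m.
        r \<in> carrier R \<and> r' \<in> carrier R \<and> m \<in> carrier M} \<union>
     {frag_of (r, m \<oplus>\<^bsub>M\<^esub> m') - frag_of (r, m) - frag_of (r, m') | r m m'.
        r \<in> carrier R \<and> m \<in> carrier M \<and> m' \<in> carrier M} \<union>
     {frag_of (r \<otimes> \<phi> a, m) - frag_of (r, a \<odot>\<^bsub>M\<^esub> m) | r a m.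
        r \<in> carrier R \<and> a \<in> carrier A \<and> m \<in> carrier M}"

lemma tensor_kernel_eq: "N = generate E tensor_gens"
  by (simp add: tensor_kernel_def tensor_gens_def)

lemma tensor_gens_subset: "tensor_gens \<subseteq> carrier E"
  unfolding tensor_gens_def
  by (auto intro!: E_diff simp: \<phi>_closed M_add_closed M_smult_closed
      simp del: carrier_free_Abelian_group_iff)

lemma tensor_gens_kernel: "h \<in> tensor_gens \<Longrightarrow> h \<in> N"
  unfolding tensor_kernel_eq by (rule generate.incl)

lemma subgroup_tensor_kernel: "subgroup N E"
  unfolding tensor_kernel_eq
  by (rule group.generate_is_subgroup[OF group_free_Abelian_group tensor_gens_subset])

lemma normal_tensor_kernel: "N \<lhd> E"
  using subgroup_tensor_kernel comm_group.normal_iff_subgroup[OF abelian_free_Abelian_group] by blast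

lemma tensor_kernel_subset: "f \<in> N \<Longrightarrow> Poly_Mapping.keys f \<subseteq> carrier R \<times> carrier M"
  using subgroup.mem_carrier[OF subgroup_tensor_kernel] by simp

lemma tensor_kernel_zero: "0 \<in> N"
  using subgroup.one_closed[OF subgroup_tensor_kernel] by simp

lemma tensor_kernel_add: "f \<in> N \<Longrightarrow> g \<in> N \<Longrightarrow> f + g \<in> N"
  using subgroup.m_closed[OF subgroup_tensor_kernel] by simp

lemma tensor_kernel_minus: "f \<in> N \<Longrightarrow> - f \<in> N"
  using subgroup.m_inv_closed[OF subgroup_tensor_kernel, of f] tensor_kernel_subset[of f] by simp

lemma tensor_kernel_diff: "f \<in> N \<Longrightarrow> g \<in> N \<Longrightarrow> f - g \<in> N"
  using tensor_kernel_add[of f "- g"] tensor_kernel_minus[of g] by simp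

lemma tensor_kernel_left_add:
  "\<lbrakk>r \<in> carrier R; r' \<in> carrier R; m \<in> carrier M\<rbrakk> \<Longrightarrow>
     frag_of (r \<oplus> r', m) - frag_of (r, m) - frag_of (r', m) \<in> N"
  by (rule tensor_gens_kernel) (unfold tensor_gens_def, blast)

lemma tensor_kernel_right_add:
  "\<lbrakk>r \<in> carrier R; m \<in> carrier M; m' \<in> carrier M\<rbrakk> \<Longrightarrow>
     frag_of (r, m \<oplus>\<^bsub>M\<^esub> m') - frag_of (r, m) - frag_of (r, m') \<in> N"
  by (rule tensor_gens_kernel) (unfold tensor_gens_def, blast)

lemma tensor_kernel_balanced:
  "\<lbrakk>r \<in> carrier R; a \<in> carrier A; m \<in> carrier M\<rbrakk> \<Longrightarrow>
     frag_of (r \<otimes> \<phi> a, m) - frag_of (r, a \<odot>\<^bsub>M\<^esub> m) \<in> N"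
  by (rule tensor_gens_kernel) (unfold tensor_gens_def, blast)

text \<open>Differences replace the products and inverses of \<open>generate\<close>, so a property
  only has to hold for the three families of relations and be stable under subtraction.\<close>

lemma tensor_kernel_induct [consumes 1, case_names zero diff left right balanced]:
  assumes "f \<in> N"
    and zero: "P 0"
    and diff: "\<And>f g. \<lbrakk>f \<in> N; g \<in> N; P f; P g\<rbrakk> \<Longrightarrow> P (f - g)"
    and left: "\<And>r r' m. \<lbrakk>r \<in> carrier R; r' \<in> carrier R; m \<in> carrier M\<rbrakk> \<Longrightarrow>
      P (frag_of (r \<oplus> r', m) - frag_of (r, m) - frag_of (r', m))"
    and right: "\<And>r m m'. \<lbrakk>r \<in> carrier R; m \<in> carrier M; m' \<in> carrier M\<rbrakk> \<Longrightarrow>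
      P (frag_of (r, m \<oplus>\<^bsub>M\<^esub> m') - frag_of (r, m) - frag_of (r, m'))"
    and balanced: "\<And>r a m. \<lbrakk>r \<in> carrier R; a \<in> carrier A; m \<in> carrier M\<rbrakk> \<Longrightarrow>
      P (frag_of (r \<otimes> \<phi> a, m) - frag_of (r, a \<odot>\<^bsub>M\<^esub> m))"
  shows "P f"
proof -
  have *: "f \<in> N \<Longrightarrow> - f \<in> N \<and> P (- f)" if "P f" for f
    using diff[OF tensor_kernel_zero _ zero that] tensor_kernel_minus by simp
  have gens: "P h" if "h \<in> tensor_gens" for h
    using that unfolding tensor_gens_def
    by (elim UnE CollectE exE conjE) (simp_all only: left right balanced)
  have "f \<in> generate E tensor_gens"
    using assms(1) by (simp add: tensor_kernel_eq)
  then have "f \<in> N \<and> P f"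
  proof (induction rule: generate.induct)
    case one
    then show ?case
      using zero tensor_kernel_zero by simp
  next
    case (incl h)
    then show ?case
      using gens tensor_gens_kernel by blast
  next
    case (inv h)
    have "inv\<^bsub>E\<^esub> h = - h"
      by (rule inv_free_Abelian_group[OF tensor_kernel_subset[OF tensor_gens_kernel[OF inv]]])
    then show ?case
      using *[OF gens[OF inv] tensor_gens_kernel[OF inv]] by simp
  next
    case (eng h1 h2)
    then show ?case
      using diff[of h1 "- h2"] *[of h2] tensor_kernel_add[of h1 h2] by simp
  qed
  then show ?thesis ..
qed

lemma tensor_coset_eq_iff:
  assumes "f \<in> carrier E" "g \<in> carrier E"
  shows "N #>\<^bsub>E\<^esub> f = N #>\<^bsub>E\<^esub> g \<longleftrightarrow> f - g \<in> N"
proof -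
  interpret E: group E by simp
  interpret N: subgroup N E by (rule subgroup_tensor_kernel)
  have "N #>\<^bsub>E\<^esub> f = N #>\<^bsub>E\<^esub> g \<longleftrightarrow> f \<in> N #>\<^bsub>E\<^esub> g"
    using assms E.repr_independence[of f N g] E.rcos_self[of f N] N.subgroup_axioms by blast
  also have "\<dots> \<longleftrightarrow> f - g \<in> N"
    using assms N.rcos_module[OF E.group_axioms, of g f] by simp
  finally show ?thesis .
qed

lemma tensor_act_zero [simp]: "tensor_act s 0 = 0"
  by (simp add: tensor_act_def)

lemma tensor_act_of [simp]: "tensor_act s (frag_of (r, m)) = frag_of (s \<otimes> r, m)"
  by (simp add: tensor_act_def)

lemma tensor_act_diff: "tensor_act s (f - g) = tensor_act s f - tensor_act s g"
  by (simp add: tensor_act_def frag_extend_diff)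

lemma tensor_act_add: "tensor_act s (f + g) = tensor_act s f + tensor_act s g"
  by (simp add: tensor_act_def frag_extend_add)

lemma tensor_act_keys:
  assumes "s \<in> carrier R" "Poly_Mapping.keys f \<subseteq> carrier R \<times> carrier M"
  shows "Poly_Mapping.keys (tensor_act s f) \<subseteq> carrier R \<times> carrier M"
  using assms(2)
proof (induction f rule: frag_induction)
  case (diff a b)
  then show ?case
    by (simp add: tensor_act_diff keys_frag_diff_subset)
next
  case (one x)
  then show ?case
    using assms(1) by (cases x) auto
qed simp

lemma tensor_act_kernel:
  assumes s: "s \<in> carrier R" and "f \<in> N"
  shows "tensor_act s f \<in> N"
  using assms(2)
proof (induction rule: tensor_kernel_induct)
  case (left r r' m)
  then show ?case
    using tensor_kernel_left_add[of "s \<otimes> r" "s \<otimes> r'" m] s by (simp add: tensor_act_diff r_distr)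
next
  case (right r m m')
  then show ?case
    using tensor_kernel_right_add[of "s \<otimes> r" m m'] s by (simp add: tensor_act_diff)
next
  case (balanced r a m)
  then show ?case
    using tensor_kernel_balanced[of "s \<otimes> r" a m] s \<phi>_closed by (simp add: tensor_act_diff m_assoc)
qed (simp_all add: tensor_kernel_zero tensor_kernel_diff tensor_act_diff)

text \<open>A pair with first entry \<open>r \<oplus> s\<close> is a basis element of its own, so
  additivity in the scalar is a tensor relation and not an identity of formal sums. This is why
  \<open>presented_module\<close> asks for module laws only after projection.\<close>

lemma tensor_act_add_left:
  assumes r: "r \<in> carrier R" "s \<in> carrier R" and f: "Poly_Mapping.keys f \<subseteq> carrier R \<times> carrier M"
  shows "tensor_act (r \<oplus> s) f - (tensor_act r f + tensor_act s f) \<in> N"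
  using f
proof (induction f rule: frag_induction)
  case zero
  then show ?case by (simp add: tensor_kernel_zero)
next
  case (one x)
  then show ?case
    using tensor_kernel_left_add[of "r \<otimes> fst x" "s \<otimes> fst x" "snd x"] r
    by (cases x) (auto simp: l_distr diff_diff_eq)
next
  case (diff a b)
  then show ?case
    using tensor_kernel_diff[OF diff] by (simp add: tensor_act_diff algebra_simps)
qed

lemma presented_extend_scalars:
  "presented_module R (extend_scalars A \<phi> R M) (carrier E) tensor_act (\<lambda>f. N #>\<^bsub>E\<^esub> f)"
proof -
  interpret E: group E by simp
  interpret N: normal N E by (rule normal_tensor_kernel)
  have *: "tensor_act (r \<otimes> s) f = tensor_act r (tensor_act s f)"
    if "r \<in> carrier R" "s \<in> carrier R" "Poly_Mapping.keys f \<subseteq> carrier R \<times> carrier M" for r s f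
    using that(3)
    by (induction f rule: frag_induction) (auto simp: that(1,2) tensor_act_diff m_assoc)
  have **: "tensor_act \<one> f = f" if "Poly_Mapping.keys f \<subseteq> carrier R \<times> carrier M" for f
    using that by (induction f rule: frag_induction) (auto simp: tensor_act_diff)
  show ?thesis
  proof (unfold_locales, goal_cases)
    case (7 r f)
    have "N #>\<^bsub>E\<^esub> tensor_act r g = N #>\<^bsub>E\<^esub> tensor_act r f" if g: "g \<in> N #>\<^bsub>E\<^esub> f" for g
    proof -
      obtain n where n: "n \<in> N" "g = n + f"
        using g by (auto simp: r_coset_def)
      then have "Poly_Mapping.keys g \<subseteq> carrier R \<times> carrier M"
        using 7 tensor_kernel_subset[of n] keys_add[of n f] by auto
      then show ?thesis
        using 7 n tensor_act_kernel[of r n] tensor_act_keys[of r f] tensor_act_keys[of r g]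
        by (subst tensor_coset_eq_iff) (simp_all add: tensor_act_add)
    qed
    moreover have "f \<in> N #>\<^bsub>E\<^esub> f"
      using 7 E.rcos_self N.subgroup_axioms by blast
    moreover have "r \<odot>\<^bsub>extend_scalars A \<phi> R M\<^esub> (N #>\<^bsub>E\<^esub> f) = (\<Union>g\<in>N #>\<^bsub>E\<^esub> f. N #>\<^bsub>E\<^esub> tensor_act r g)"
      by (simp add: extend_scalars_def Let_def tensor_act_def)
    ultimately show ?case
      by blast
  next
    case 4
    show ?case
      by (auto simp: extend_scalars_def Let_def RCOSETS_def)
  next
    case (5 f g)
    then show ?case
      using N.rcos_sum[of f g] by (simp add: extend_scalars_def Let_def)
  next
    case 6
    show ?case
      using E.coset_mult_one[OF N.subset] by (simp add: extend_scalars_def Let_def)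
  next
    case (8 r s f)
    then have "Poly_Mapping.keys (tensor_act r f + tensor_act s f) \<subseteq> carrier R \<times> carrier M"
      using tensor_act_keys[of r f] tensor_act_keys[of s f] keys_add[of "tensor_act r f" "tensor_act s f"]
      by auto
    then show ?case
      using 8 tensor_act_add_left[of r s f] tensor_act_keys[of "r \<oplus> s" f]
      by (subst tensor_coset_eq_iff) auto
  qed (auto simp: keys_frag_diff_subset tensor_act_keys tensor_act_add * **)
qed

end

section \<open>Square classes\<close>

lemma subgroup_squares:
  assumes "comm_group G"
  shows "subgroup (group_squares G) G"
proof -
  interpret comm_group G by fact
  show ?thesis
  proof
    show "group_squares G \<subseteq> carrier G"
      by (auto simp: group_squares_def)
    have "\<one>\<^bsub>G\<^esub> = \<one>\<^bsub>G\<^esub> \<otimes>\<^bsub>G\<^esub> \<one>\<^bsub>G\<^esub>"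
      by simp
    then show "\<one>\<^bsub>G\<^esub> \<in> group_squares G"
      unfolding group_squares_def by blast
    fix x assume "x \<in> group_squares G"
    then obtain a where a: "a \<in> carrier G" "x = a \<otimes>\<^bsub>G\<^esub> a"
      by (auto simp: group_squares_def)
    have "inv\<^bsub>G\<^esub> x = inv\<^bsub>G\<^esub> a \<otimes>\<^bsub>G\<^esub> inv\<^bsub>G\<^esub> a"
      by (simp add: a inv_mult)
    then show "inv\<^bsub>G\<^esub> x \<in> group_squares G"
      using a unfolding group_squares_def by blast
    fix y assume "y \<in> group_squares G"
    then obtain b where b: "b \<in> carrier G" "y = b \<otimes>\<^bsub>G\<^esub> b"
      by (auto simp: group_squares_def)
    have "x \<otimes>\<^bsub>G\<^esub> y = (a \<otimes>\<^bsub>G\<^esub> b) \<otimes>\<^bsub>G\<^esub> (a \<otimes>\<^bsub>G\<^esub> b)"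
      by (simp add: a b m_ac)
    then show "x \<otimes>\<^bsub>G\<^esub> y \<in> group_squares G"
      using a b unfolding group_squares_def by blast
  qed
qed

lemma field_units_simps [simp]:
  "x \<in> carrier (field_units F) \<longleftrightarrow> x \<noteq> 0" "x \<otimes>\<^bsub>field_units F\<^esub> y = x * y"
  "\<one>\<^bsub>field_units F\<^esub> = 1"
  by (simp_all add: field_units_def)

lemma comm_group_field_units: "comm_group (field_units TYPE('a::field))"
proof (rule comm_groupI)
  fix x :: 'a assume "x \<in> carrier (field_units TYPE('a))"
  then show "\<exists>y\<in>carrier (field_units TYPE('a)). y \<otimes>\<^bsub>field_units TYPE('a)\<^esub> x = \<one>\<^bsub>field_units TYPE('a)\<^esub>"
    by (intro bexI[of _ "inverse x"]) simp_all
qed (auto simp: mult_ac)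

definition sq_group :: "'a::field itself \<Rightarrow> 'a set monoid" where
  "sq_group F = field_units F Mod group_squares (field_units F)"

definition sq_coset :: "'a::field \<Rightarrow> 'a set" where
  "sq_coset x = group_squares (field_units TYPE('a)) #>\<^bsub>field_units TYPE('a)\<^esub> x"

lemma sq_ring_eq: "sq_ring F = group_ring (sq_group F)"
  by (simp add: sq_ring_def sq_group_def)

lemma sq_class_eq: "sq_class x = frag_of (sq_coset x)"
  by (simp add: sq_class_def sq_coset_def)

lemma squares_normal:
  "group_squares (field_units TYPE('a::field)) \<lhd> field_units TYPE('a)"
  using comm_group.normal_iff_subgroup[OF comm_group_field_units]
    subgroup_squares[OF comm_group_field_units] by blast

lemma comm_group_sq_group: "comm_group (sq_group TYPE('a::field))"
  unfolding sq_group_def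
  by (rule comm_group.abelian_FactGroup[OF comm_group_field_units subgroup_squares[OF comm_group_field_units]])

lemma carrier_sq_group: "carrier (sq_group TYPE('a::field)) = sq_coset ` (UNIV - {0})"
  by (auto simp: sq_group_def FactGroup_def RCOSETS_def sq_coset_def)

lemma sq_coset_carrier [simp]: "x \<noteq> 0 \<Longrightarrow> sq_coset (x::'a::field) \<in> carrier (sq_group TYPE('a))"
  by (auto simp: carrier_sq_group)

lemma sq_coset_mult [simp]:
  "\<lbrakk>x \<noteq> 0; y \<noteq> 0\<rbrakk> \<Longrightarrow> sq_coset (x::'a::field) \<otimes>\<^bsub>sq_group TYPE('a)\<^esub> sq_coset y = sq_coset (x * y)"
  unfolding sq_group_def sq_coset_def FactGroup_def
  using normal.rcos_sum[OF squares_normal, of x y] by simp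

lemma sq_coset_one [simp]: "\<one>\<^bsub>sq_group TYPE('a::field)\<^esub> = sq_coset 1"
proof -
  interpret group "field_units TYPE('a)"
    by (rule comm_group.axioms(2)[OF comm_group_field_units])
  show ?thesis
    using coset_mult_one[OF normal_imp_subgroup[OF squares_normal, THEN subgroup.subset]]
    by (simp add: sq_group_def sq_coset_def FactGroup_def)
qed

lemma mem_sq_coset: "x \<in> sq_coset y \<longleftrightarrow> (\<exists>z. z \<noteq> 0 \<and> x = y * (z * z))"
  by (auto simp: sq_coset_def r_coset_def group_squares_def mult_ac)

lemma sq_coset_eqI: 
  fixes x :: "'a::field"
  assumes "x = y * (z * z)" "y \<noteq> 0" "z \<noteq> 0"
  shows "sq_coset x = sq_coset y"
proof (intro Set.set_eqI iffI)
  fix t assume "t \<in> sq_coset x"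
  then obtain w where "w \<noteq> 0" "t = x * (w * w)"
    by (auto simp: mem_sq_coset)
  then have "t = y * ((z * w) * (z * w))" "z * w \<noteq> 0"
    using assms by (simp_all add: mult_ac)
  then show "t \<in> sq_coset y"
    unfolding mem_sq_coset by blast
next
  fix t assume "t \<in> sq_coset y"
  then obtain w where "w \<noteq> 0" "t = y * (w * w)"
    by (auto simp: mem_sq_coset)
  then have "t = x * ((w / z) * (w / z))" "w / z \<noteq> 0"
    using assms by (simp_all add: field_simps)
  then show "t \<in> sq_coset x"
    unfolding mem_sq_coset by blast
qed

lemma sq_coset_eqD:
  assumes "sq_coset x = sq_coset y"
  obtains z where "z \<noteq> 0" "x = y * (z * z)"
proof -
  have "x \<in> sq_coset x"
    unfolding mem_sq_coset by (rule exI[of _ 1]) simp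
  then show thesis
    using that assms by (auto simp: mem_sq_coset)
qed

section \<open>A presentation of the reduced refined pre-Bloch group\<close>

lemma cring_sq_ring: "cring (sq_ring TYPE('a::field))"
  unfolding sq_ring_eq by (rule comm_group.cring_group_ring[OF comm_group_sq_group])

lemma group_ring_minus: 
  assumes "comm_group G" "f \<in> carrier (group_ring G)"
  shows "\<ominus>\<^bsub>group_ring G\<^esub> f = - f"
proof -
  interpret cring "group_ring G"
    by (rule comm_group.cring_group_ring[OF assms(1)])
  show ?thesis
    by (rule minus_equality) (use assms in simp_all)
qed

text \<open>The representative of \<open><c>[x]\<close>; it depends on \<open>c\<close> only through
  the square class.\<close>

definition rp_elt :: "'a::field \<Rightarrow> 'a \<Rightarrow> 'a rp_gen \<Rightarrow> ('a set \<Rightarrow>\<^sub>0 int)" where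
  "rp_elt c x = free_elt (sq_coset c) (Sym x)"

abbreviation rp_X :: "('a::field rp_gen \<Rightarrow> ('a set \<Rightarrow>\<^sub>0 int)) set" where
  "rp_X \<equiv> carrier (rp_free TYPE('a))"

definition scale :: "'a::field \<Rightarrow> ('a rp_gen \<Rightarrow> ('a set \<Rightarrow>\<^sub>0 int)) \<Rightarrow> 'a rp_gen \<Rightarrow> ('a set \<Rightarrow>\<^sub>0 int)" where
  "scale c f = sq_class c \<odot>\<^bsub>rp_free TYPE('a)\<^esub> f"

lemma rp_free_eq: "rp_free TYPE('a::field) = free_module (group_ring (sq_group TYPE('a))) (rp_gens TYPE('a))"
  by (simp add: rp_free_def sq_ring_eq)

lemma scale_diff: "scale c (f - g) = scale c f - scale c g"
  by (simp add: scale_def rp_free_eq free_module_smult_diff)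

lemma scale_add: "scale c (f + g) = scale c f + scale c g"
  by (simp add: scale_def rp_free_eq free_module_smult_add)

lemma scale_zero [simp]: "scale c 0 = 0"
  by (simp add: scale_def rp_free_eq)

lemma scale_rps [simp]: "\<lbrakk>c \<noteq> 0; d \<noteq> 0\<rbrakk> \<Longrightarrow> scale c (rp_elt d x) = rp_elt (c * d) x"
  by (simp add: scale_def rp_free_eq sq_class_eq rp_elt_def)

lemma rp_elt_eqI: "\<lbrakk>c = d * (z * z); d \<noteq> 0; z \<noteq> 0\<rbrakk> \<Longrightarrow> rp_elt c x = rp_elt d x"
  by (simp add: rp_elt_def sq_coset_eqI)

lemma rp_sym_eq: "rp_sym x = rp_elt 1 x"
  by (simp add: rp_elt_def sq_ring_eq free_gen_eq_free_elt)

lemma free_elt_closed: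
  "\<lbrakk>c \<in> carrier G; s \<in> S\<rbrakk> \<Longrightarrow> free_elt c s \<in> carrier (free_module (group_ring G) S)"
  by (auto simp: carrier_free_group_ring_module free_elt_def)

lemma rp_elt_closed [simp]: "\<lbrakk>c \<noteq> 0; x \<noteq> 0\<rbrakk> \<Longrightarrow> rp_elt c x \<in> rp_X"
  unfolding rp_elt_def rp_free_eq by (rule free_elt_closed) (auto simp: rp_gens_def)

lemma presented_rp_free:
  "presented_module (sq_ring TYPE('a::field)) (rp_free TYPE('a)) rp_X
     (smult (rp_free TYPE('a))) (\<lambda>f. f)"
  unfolding rp_free_eq sq_ring_eq by (rule comm_group.presented_free_module[OF comm_group_sq_group])

interpretation free: presented_module "sq_ring TYPE('a::field)" "rp_free TYPE('a)" rp_X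
    "smult (rp_free TYPE('a))" "\<lambda>f. f"
  by (rule presented_rp_free)

lemma sq_class_closed [simp]: "c \<noteq> 0 \<Longrightarrow> sq_class (c::'a::field) \<in> carrier (sq_ring TYPE('a))"
  by (simp add: sq_class_eq sq_ring_eq)

lemma sq_ring_induct [consumes 1, case_names zero diff sq_class]:
  fixes r :: "'a::field set \<Rightarrow>\<^sub>0 int"
  assumes r: "r \<in> carrier (sq_ring TYPE('a))"
    and zero: "P 0"
    and diff: "\<And>r s. \<lbrakk>r \<in> carrier (sq_ring TYPE('a)); s \<in> carrier (sq_ring TYPE('a)); P r; P s\<rbrakk> \<Longrightarrow> P (r - s)"
    and sq: "\<And>c. c \<noteq> 0 \<Longrightarrow> P (sq_class c)"
  shows "P r"
proof (rule free_Abelian_group_induct[where S = "sq_coset ` (UNIV - {0})"])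
  show "Poly_Mapping.keys r \<subseteq> sq_coset ` (UNIV - {0})"
    using r by (simp add: sq_ring_eq carrier_sq_group)
  show "P (x - y)" if "Poly_Mapping.keys x \<subseteq> sq_coset ` (UNIV - {0})"
    "Poly_Mapping.keys y \<subseteq> sq_coset ` (UNIV - {0})" "P x" "P y" for x y
    using that by (intro diff) (simp_all add: sq_ring_eq carrier_sq_group)
  show "P (frag_of a)" if a: "a \<in> sq_coset ` (UNIV - {0})" for a
    using a sq by (auto simp: sq_class_eq)
qed (rule zero)

lemma scale_closed [simp]: "\<lbrakk>c \<noteq> 0; f \<in> rp_X\<rbrakk> \<Longrightarrow> scale c f \<in> rp_X"
  unfolding scale_def by (rule free.act_closed) simp_all

lemma pfister_eq:
  fixes c :: "'a::field"
  assumes "c \<noteq> 0"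
  shows "pfister c = sq_class c - sq_class 1"
  using assms
  by (simp add: pfister_def a_minus_def sq_ring_eq group_ring_minus[OF comm_group_sq_group] sq_class_eq)

lemma pfister_smult:
  fixes c :: "'a::field"
  assumes "c \<noteq> 0"
  shows "pfister c \<odot>\<^bsub>rp_free TYPE('a)\<^esub> f = scale c f - scale 1 f"
  unfolding pfister_eq[OF assms] scale_def rp_free_eq by (rule free_module_smult_diff)

lemma pfister_closed [simp]: "c \<noteq> 0 \<Longrightarrow> pfister (c::'a::field) \<in> carrier (sq_ring TYPE('a))"
  unfolding pfister_eq using keys_diff[of "sq_class c" "sq_class 1"] sq_class_closed[of c]
    sq_class_closed[of 1] by (auto simp: sq_ring_eq)

definition five_elt :: "'a::field \<Rightarrow> 'a \<Rightarrow> 'a rp_gen \<Rightarrow> ('a set \<Rightarrow>\<^sub>0 int)" where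
  "five_elt x y = rp_elt 1 x - rp_elt 1 y + rp_elt x (y / x)
     - rp_elt (inverse x - 1) ((1 - inverse x) / (1 - inverse y)) + rp_elt (1 - x) ((1 - x) / (1 - y))"

definition psi_elt :: "'a::field \<Rightarrow> 'a rp_gen \<Rightarrow> ('a set \<Rightarrow>\<^sub>0 int)" where
  "psi_elt x = rp_elt 1 x + rp_elt (-1) (inverse x)"

lemma psi_elt_closed [simp]: "x \<noteq> 0 \<Longrightarrow> psi_elt x \<in> rp_X"
  by (simp add: psi_elt_def)

lemma five_term_args:
  fixes x y :: "'a::field"
  assumes "x \<notin> {0, 1}" "y \<notin> {0, 1}"
  shows "x \<noteq> 0" "y \<noteq> 0" "1 - x \<noteq> 0" "1 - y \<noteq> 0" "inverse x - 1 \<noteq> 0" "1 - inverse x \<noteq> 0"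
    "1 - inverse y \<noteq> 0"
  using assms by auto

lemma five_elt_closed:
  assumes "x \<notin> {0, 1}" "y \<notin> {0, 1}"
  shows "five_elt x y \<in> rp_X"
  unfolding five_elt_def using five_term_args[OF assms]
  by (intro free.X_diff free.X_add rp_elt_closed) simp_all

lemma five_term_eq:
  assumes "x \<notin> {0, 1}" "y \<notin> {0, 1}"
  shows "five_term x y = five_elt x y"
  unfolding five_term_def Let_def rp_sym_eq five_elt_def
  using five_term_args[OF assms]
  by (simp add: free.proj_diff free.proj_add flip: scale_def)

lemma rp_relations_closed: "rp_relations TYPE('a::field) \<subseteq> rp_X"
proof -
  have const: "free_gen (sq_ring TYPE('a)) Const \<in> rp_X" if "card (UNIV :: 'a set) = 2"
    unfolding sq_ring_eq rp_free_eq free_gen_eq_free_elt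
    by (rule free_elt_closed) (use that in \<open>simp_all add: rp_gens_def\<close>)
  show ?thesis
    using const
    by (auto simp: rp_relations_def Let_def rp_sym_eq five_term_eq five_elt_closed free.proj_add simp flip: scale_def)
qed

text \<open>\<open>rp_proj1\<close>, \<open>rp_proj2\<close> and \<open>rp_proj\<close> lead from
  the same free module to \<open>RP\<close>, \<open>RP_tilde\<close> and
  \<open>RP_bar\<close>.\<close>

definition rp_proj1 :: "('a::field rp_gen \<Rightarrow> ('a set \<Rightarrow>\<^sub>0 int)) \<Rightarrow> _" where
  "rp_proj1 f = rp_kernel TYPE('a) +>\<^bsub>rp_free TYPE('a)\<^esub> f"

lemma submodule_rp_kernel: "submodule (rp_kernel TYPE('a::field)) (sq_ring TYPE('a)) (rp_free TYPE('a))"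
  unfolding rp_kernel_def by (rule free.M.span_is_submodule[OF rp_relations_closed])

interpretation RP: presented_module "sq_ring TYPE('a::field)" "RP TYPE('a)" rp_X
    "smult (rp_free TYPE('a))" rp_proj1
  unfolding RP_def rp_proj1_def by (rule free.presented_quotient_module[OF submodule_rp_kernel])

lemma psi1_eq: "x \<noteq> 0 \<Longrightarrow> psi1 x = rp_proj1 (psi_elt x)"
  by (simp add: psi1_def rp_def Let_def rp_sym_eq RP.proj_add RP.proj_smult psi_elt_def flip: rp_proj1_def scale_def)

lemma submodule_K1: "submodule (K1 TYPE('a::field)) (sq_ring TYPE('a)) (RP TYPE('a))"
  unfolding K1_def by (rule RP.M.span_is_submodule) (auto simp: psi1_eq)

definition rp_proj2 :: "('a::field rp_gen \<Rightarrow> ('a set \<Rightarrow>\<^sub>0 int)) \<Rightarrow> _" where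
  "rp_proj2 f = K1 TYPE('a) +>\<^bsub>RP TYPE('a)\<^esub> rp_proj1 f"

interpretation RP_tilde: presented_module "sq_ring TYPE('a::field)" "RP_tilde TYPE('a)" rp_X
    "smult (rp_free TYPE('a))" rp_proj2
  unfolding RP_tilde_def rp_proj2_def by (rule RP.presented_quotient_module[OF submodule_K1])

text \<open>A representative of \<open>C_elt\<close>, with the same case distinction and the same
  choice of \<open>x\<close>.\<close>

definition C_rep :: "'a::field rp_gen \<Rightarrow> ('a set \<Rightarrow>\<^sub>0 int)" where
  "C_rep = (if card (UNIV :: 'a set) = 2 then free_elt (sq_coset 1) Const
     else if card (UNIV :: 'a set) = 3 then psi_elt (- 1)
     else (let x = (SOME x. x \<noteq> 0 \<and> x \<noteq> 1) in
       rp_elt 1 x + rp_elt (- 1) (1 - x) + (scale (1 - x) (psi_elt x) - scale 1 (psi_elt x))))"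

text \<open>Infinite fields are included, since \<open>card\<close> of an infinite set is 0.\<close>

lemma ex_other_element:
  fixes x :: "'a::field"
  assumes "card (UNIV :: 'a set) \<noteq> 2" "card (UNIV :: 'a set) \<noteq> 3"
  obtains y where "y \<notin> {0, 1, x}"
proof (rule ccontr)
  assume "\<not> thesis"
  then have U: "(UNIV :: 'a set) = {0, 1, x}"
    using that by blast
  then have "card (UNIV :: 'a set) = card {0, 1, x}"
    by simp
  also have "\<dots> = 2 \<or> \<dots> = 3"
    by (auto simp: card_insert_if)
  finally show False
    using assms by simp
qed

lemma some_element:
  assumes "card (UNIV :: 'a::field set) \<noteq> 2" "card (UNIV :: 'a set) \<noteq> 3"
  shows "(SOME x::'a. x \<noteq> 0 \<and> x \<noteq> 1) \<notin> {0, 1}"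
proof -
  obtain y :: 'a where "y \<notin> {0, 1, 0}"
    using ex_other_element[OF assms] .
  then have "y \<noteq> 0 \<and> y \<noteq> 1"
    by simp
  from someI[of "\<lambda>x. x \<noteq> 0 \<and> x \<noteq> 1", OF this] show ?thesis
    by simp
qed

lemma const_scale: "\<lbrakk>c \<noteq> 0; d \<noteq> 0\<rbrakk> \<Longrightarrow> scale c (free_elt (sq_coset d) Const) = free_elt (sq_coset (c * d)) Const"
  by (simp add: scale_def rp_free_eq sq_class_eq)

lemma const_closed:
  assumes "card (UNIV :: 'a::field set) = 2" "c \<noteq> 0"
  shows "free_elt (sq_coset c) Const \<in> (rp_X :: ('a rp_gen \<Rightarrow> _) set)"
  unfolding rp_free_eq by (rule free_elt_closed) (use assms in \<open>simp_all add: rp_gens_def\<close>)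

lemma C_rep_closed [simp]: "C_rep \<in> (rp_X :: ('a::field rp_gen \<Rightarrow> _) set)"
  using some_element[where 'a = 'a]
  by (auto simp: C_rep_def Let_def const_closed)

lemma C_elt_eq: "C_elt TYPE('a::field) = rp_proj1 C_rep"
proof -
  consider "card (UNIV :: 'a set) = 2" | "card (UNIV :: 'a set) = 3"
    | "card (UNIV :: 'a set) \<noteq> 2" "card (UNIV :: 'a set) \<noteq> 3"
    by blast
  then show ?thesis
  proof cases
    case 3
    define x :: 'a where "x = (SOME x. x \<noteq> 0 \<and> x \<noteq> 1)"
    have x: "x \<noteq> 0" "1 - x \<noteq> 0"
      using some_element[OF 3] by (simp_all add: x_def)
    have "C_elt TYPE('a) = rp_proj1 (rp_elt 1 x) \<oplus>\<^bsub>RP TYPE('a)\<^esub> sq_class (-1) \<odot>\<^bsub>RP TYPE('a)\<^esub> rp_proj1 (rp_elt 1 (1 - x))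
        \<oplus>\<^bsub>RP TYPE('a)\<^esub> pfister (1 - x) \<odot>\<^bsub>RP TYPE('a)\<^esub> rp_proj1 (psi_elt x)"
      using 3 x by (simp add: C_elt_def Let_def rp_def rp_sym_eq psi1_eq flip: x_def rp_proj1_def)
    also have "\<dots> = rp_proj1 (rp_elt 1 x + rp_elt (- 1) (1 - x) + (scale (1 - x) (psi_elt x) - scale 1 (psi_elt x)))"
      using x by (simp add: RP.proj_smult RP.proj_add pfister_smult flip: scale_def)
    finally show ?thesis
      using 3 by (simp add: C_rep_def Let_def flip: x_def)
  qed (simp_all add: C_elt_def C_rep_def psi1_eq rp_proj1_def sq_ring_eq free_gen_eq_free_elt)
qed

lemma submodule_D_sub: "submodule (D_sub TYPE('a::field)) (sq_ring TYPE('a)) (RP TYPE('a))"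
  unfolding D_sub_def by (rule RP.M.span_is_submodule) (auto simp: C_elt_eq RP.proj_add)

text \<open>Describes the image of \<open>D_sub\<close> by representatives, so that
  \<open>submodule_image\<close> applies.\<close>

lemma D_tilde_eq: "D_tilde TYPE('a::field) = rp_proj2 ` {f \<in> rp_X. rp_proj1 f \<in> D_sub TYPE('a)}"
proof -
  have "D_sub TYPE('a) \<subseteq> carrier (RP TYPE('a))"
    by (rule RP.M.submoduleE(1)[OF submodule_D_sub])
  then have "D_sub TYPE('a) = rp_proj1 ` {f \<in> rp_X. rp_proj1 f \<in> D_sub TYPE('a)}"
    by (auto simp: RP.carrier_eq)
  then show ?thesis
    unfolding D_tilde_def rp_proj2_def by (metis image_image)
qed

lemma submodule_D_tilde: "submodule (D_tilde TYPE('a::field)) (sq_ring TYPE('a)) (RP_tilde TYPE('a))"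
  unfolding D_tilde_eq
  by (rule RP_tilde.submodule_image[OF RP.invariant_preimage[OF submodule_D_sub]])

definition rp_proj :: "('a::field rp_gen \<Rightarrow> ('a set \<Rightarrow>\<^sub>0 int)) \<Rightarrow> _" where
  "rp_proj f = D_tilde TYPE('a) +>\<^bsub>RP_tilde TYPE('a)\<^esub> rp_proj2 f"

interpretation RP_bar: presented_module "sq_ring TYPE('a::field)" "RP_bar TYPE('a)" rp_X
    "smult (rp_free TYPE('a))" rp_proj
  unfolding RP_bar_def rp_proj_def by (rule RP_tilde.presented_quotient_module[OF submodule_D_tilde])

lemma rp_bar_eq: "rp_bar x = rp_proj (rp_elt 1 x)"
  by (simp add: rp_bar_def rp_proj_def rp_proj2_def rp_proj1_def rp_def rp_sym_eq)

definition rp_ker :: "('a::field rp_gen \<Rightarrow> ('a set \<Rightarrow>\<^sub>0 int)) set" where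
  "rp_ker = {f \<in> rp_X. rp_proj f = \<zero>\<^bsub>RP_bar TYPE('a)\<^esub>}"

section \<open>Relations in the reduced refined pre-Bloch group\<close>

lemma rp_proj1_zero_iff:
  "f \<in> rp_X \<Longrightarrow> rp_proj1 f = \<zero>\<^bsub>RP TYPE('a::field)\<^esub> \<longleftrightarrow> f \<in> rp_kernel TYPE('a)"
  using free.quotient_module_zero_iff[OF submodule_rp_kernel] by (simp add: rp_proj1_def RP_def)

lemma rp_proj2_zero_iff:
  "f \<in> rp_X \<Longrightarrow> rp_proj2 f = \<zero>\<^bsub>RP_tilde TYPE('a::field)\<^esub> \<longleftrightarrow> rp_proj1 f \<in> K1 TYPE('a)"
  using RP.quotient_module_zero_iff[OF submodule_K1] by (simp add: rp_proj2_def RP_tilde_def)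

lemma rp_proj_zero_iff:
  "f \<in> rp_X \<Longrightarrow> rp_proj f = \<zero>\<^bsub>RP_bar TYPE('a::field)\<^esub> \<longleftrightarrow> rp_proj2 f \<in> D_tilde TYPE('a)"
  using RP_tilde.quotient_module_zero_iff[OF submodule_D_tilde] by (simp add: rp_proj_def RP_bar_def)

abbreviation rp_invariant :: "('a::field rp_gen \<Rightarrow> ('a set \<Rightarrow>\<^sub>0 int)) set \<Rightarrow> bool" where
  "rp_invariant \<equiv> presented_module.invariant (sq_ring TYPE('a)) rp_X (smult (rp_free TYPE('a)))"

lemma rp_invariantD:
  assumes "rp_invariant Z"
  shows "0 \<in> Z" "f \<in> Z \<Longrightarrow> g \<in> Z \<Longrightarrow> f - g \<in> Z" "f \<in> Z \<Longrightarrow> - f \<in> Z"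
    "f \<in> Z \<Longrightarrow> g \<in> Z \<Longrightarrow> f + g \<in> Z" "c \<noteq> 0 \<Longrightarrow> f \<in> Z \<Longrightarrow> scale c f \<in> Z" "f \<in> Z \<Longrightarrow> f \<in> rp_X"
proof -
  show 0: "0 \<in> Z" and 1: "f \<in> Z \<Longrightarrow> g \<in> Z \<Longrightarrow> f - g \<in> Z" for f g
    using assms by (auto simp: free.invariant_def)
  show "f \<in> Z \<Longrightarrow> - f \<in> Z"
    using 1[OF 0, of f] by simp
  show "f \<in> Z \<Longrightarrow> g \<in> Z \<Longrightarrow> f + g \<in> Z"
    by (rule free.invariant_add[OF assms])
  show "c \<noteq> 0 \<Longrightarrow> f \<in> Z \<Longrightarrow> scale c f \<in> Z"
    using assms sq_class_closed[of c] unfolding free.invariant_def scale_def by blast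
  show "f \<in> Z \<Longrightarrow> f \<in> rp_X"
    using assms by (auto simp: free.invariant_def)
qed

text \<open>Every scalar is an integral combination of square classes, so stability under
  \<open>scale\<close> and under differences gives stability under all scalars.\<close>

lemma rp_invariantI:
  assumes "Z \<subseteq> rp_X" "0 \<in> Z" and diff: "\<And>f g. f \<in> Z \<Longrightarrow> g \<in> Z \<Longrightarrow> f - g \<in> Z"
    and scale: "\<And>c f. c \<noteq> 0 \<Longrightarrow> f \<in> Z \<Longrightarrow> scale c f \<in> Z"
  shows "rp_invariant (Z :: ('a::field rp_gen \<Rightarrow> ('a set \<Rightarrow>\<^sub>0 int)) set)"
proof -
  have "r \<odot>\<^bsub>rp_free TYPE('a)\<^esub> f \<in> Z" if r: "r \<in> carrier (sq_ring TYPE('a))" and f: "f \<in> Z" for r f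
  proof -
    have "Poly_Mapping.keys r \<subseteq> sq_coset ` (UNIV - {0})"
      using r by (simp add: sq_ring_eq carrier_sq_group)
    then show ?thesis
    proof (induction r rule: frag_induction)
      case zero
      have "0 \<odot>\<^bsub>rp_free TYPE('a)\<^esub> f = 0"
        unfolding rp_free_eq by (rule free_module_smult_zero)
      then show ?case
        using assms(2) by metis
    next
      case (one x)
      then show ?case
        using scale[OF _ f] by (auto simp: scale_def sq_class_eq)
    next
      case (diff a b)
      then show ?case
        using assms(3) unfolding rp_free_eq free_module_smult_diff(2) by blast
    qed
  qed
  then show ?thesis
    using assms by (auto simp: free.invariant_def)
qed

text \<open>The element \<open>C_F\<close> without the multiple of \<open>psi1 x\<close>, which
  vanishes in \<open>RP_tilde\<close>.\<close>

definition C_at :: "'a::field \<Rightarrow> 'a rp_gen \<Rightarrow> ('a set \<Rightarrow>\<^sub>0 int)" where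
  "C_at x = rp_elt 1 x + rp_elt (-1) (1 - x)"

definition phi_elt :: "'a::field \<Rightarrow> 'a rp_gen \<Rightarrow> ('a set \<Rightarrow>\<^sub>0 int)" where
  "phi_elt x = rp_elt 1 x + rp_elt x (inverse x)"

lemma card2_cases:
  fixes x :: "'a::field"
  assumes "card (UNIV :: 'a set) = 2"
  shows "x = 0 \<or> x = 1"
proof -
  have "{0, 1 :: 'a} = UNIV"
    using assms by (intro card_subset_eq card_ge_0_finite) simp_all
  then show ?thesis by auto
qed

text \<open>For \<open>x\<close> outside \<open>0, 1\<close> the element \<open>x + 1\<close> is
  neither \<open>1\<close> nor \<open>x\<close>, hence it is \<open>0\<close>.\<close>

lemma card3_cases:
  fixes x :: "'a::field"
  assumes "card (UNIV :: 'a set) = 3"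
  shows "x = 0 \<or> x = 1 \<or> x = - 1"
proof (cases "x = 0 \<or> x = 1")
  case False
  then have "{0, 1, x} = UNIV"
    using assms by (intro card_subset_eq card_ge_0_finite) simp_all
  then have "x + 1 \<in> {0, 1, x}"
    by simp
  then show ?thesis
    using False by (auto simp: eq_neg_iff_add_eq_0)
qed auto

lemma rp_const_eq: "free_gen (sq_ring TYPE('a::field)) Const = free_elt (sq_coset (1::'a)) Const"
  by (simp add: sq_ring_eq free_gen_eq_free_elt)

text \<open>The tool for checking that a map out of \<open>RP_bar\<close> is well defined, with one
  list of relations for every field: over three elements the defining relation is twice
  \<open>psi_elt (- 1)\<close>, and over two elements \<open>Const\<close> itself is required. The
  three steps treat the defining relations, then \<open>K1\<close>, then
  \<open>D_sub\<close>.\<close>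

lemma rp_ker_subset:
  fixes Z :: "('a::field rp_gen \<Rightarrow> ('a set \<Rightarrow>\<^sub>0 int)) set"
  assumes Z: "rp_invariant Z"
    and one: "rp_elt 1 1 \<in> Z"
    and psi: "\<And>x. x \<noteq> 0 \<Longrightarrow> psi_elt x \<in> Z"
    and c: "\<And>x. x \<notin> {0, 1} \<Longrightarrow> C_at x \<in> Z"
    and five: "\<And>x y. x \<notin> {0, 1} \<Longrightarrow> y \<notin> {0, 1} \<Longrightarrow> five_elt x y \<in> Z"
    and const: "card (UNIV :: 'a set) = 2 \<Longrightarrow> free_elt (sq_coset 1) Const \<in> Z"
  shows "rp_ker \<subseteq> Z"
proof -
  note [simp] = rp_invariantD[OF Z]
  have relations: "rp_relations TYPE('a) \<subseteq> Z"
  proof -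
    have "psi_elt (- 1) + psi_elt (- 1) \<in> Z"
      using psi[of "- 1"] by simp
    then show ?thesis
      using one five const
      by (auto simp: rp_relations_def Let_def rp_sym_eq rp_const_eq five_term_eq free.proj_add psi_elt_def
          const_closed simp flip: scale_def)
  qed
  have step1: "f \<in> Z" if "f \<in> rp_kernel TYPE('a)" for f
  proof (rule free.span_preimage_subset[OF Z])
    show "f \<in> rp_X"
      using free.M.submoduleE(1)[OF submodule_rp_kernel] that by blast
  qed (use relations that in \<open>simp_all add: rp_kernel_def free.proj_zero\<close>)
  have step2: "f \<in> Z" if "f \<in> rp_X" "rp_proj1 f \<in> K1 TYPE('a)" for f
    by (rule RP.span_preimage_subset[OF Z _ _ that(1), of "{psi1 x |x. x \<noteq> 0}"])
      (use step1 that(2) psi in \<open>auto simp: K1_def psi1_eq rp_proj1_zero_iff\<close>)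
  have C_rep: "C_rep \<in> Z"
    using const psi[of "- 1"] some_element[where 'a = 'a]
      c[of "SOME x. x \<noteq> 0 \<and> x \<noteq> 1"] psi[of "SOME x. x \<noteq> 0 \<and> x \<noteq> 1"]
    by (auto simp: C_rep_def Let_def C_at_def)
  have step3: "f \<in> Z" if "f \<in> rp_X" "rp_proj1 f \<in> D_sub TYPE('a)" for f
    by (rule RP.span_preimage_subset[OF Z _ _ that(1), of "{C_elt TYPE('a) \<oplus>\<^bsub>RP TYPE('a)\<^esub> C_elt TYPE('a)}"])
      (use step1 that(2) C_rep in \<open>auto simp: D_sub_def C_elt_eq RP.proj_add rp_proj1_zero_iff\<close>)
  show ?thesis
  proof
    fix f assume "f \<in> (rp_ker :: ('a rp_gen \<Rightarrow> _) set)"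
    then have f: "f \<in> rp_X" "rp_proj2 f \<in> D_tilde TYPE('a)"
      by (auto simp: rp_ker_def rp_proj_zero_iff)
    then obtain g where g: "g \<in> rp_X" "rp_proj1 g \<in> D_sub TYPE('a)" "rp_proj2 f = rp_proj2 g"
      by (auto simp: D_tilde_eq)
    then have "rp_proj2 (f - g) = \<zero>\<^bsub>RP_tilde TYPE('a)\<^esub>"
      using RP_tilde.proj_eq_iff[OF f(1) g(1)] by simp
    then have "f - g \<in> Z"
      using f g by (intro step2) (simp_all add: rp_proj2_zero_iff)
    from rp_invariantD(4)[OF Z this step3[OF g(1,2)]] have "f - g + g \<in> Z" .
    then show "f \<in> Z"
      by (simp only: diff_add_cancel)
  qed
qed

lemma rp_ker_invariant: "rp_invariant (rp_ker :: ('a::field rp_gen \<Rightarrow> _) set)"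
proof -
  have "submodule {\<zero>\<^bsub>RP_bar TYPE('a)\<^esub>} (sq_ring TYPE('a)) (RP_bar TYPE('a))"
    by (rule RP_bar.M.submoduleI) simp_all
  from RP_bar.invariant_preimage[OF this] show ?thesis
    by (simp add: rp_ker_def)
qed

lemmas rp_ker_closed = rp_invariantD[OF rp_ker_invariant]

lemma rp_ker_I:
  "\<lbrakk>f \<in> rp_X; rp_proj1 f \<in> D_sub TYPE('a::field)\<rbrakk> \<Longrightarrow> f \<in> rp_ker"
  "\<lbrakk>f \<in> rp_X; rp_proj1 f \<in> K1 TYPE('a)\<rbrakk> \<Longrightarrow> f \<in> rp_ker"
  "\<lbrakk>f \<in> rp_X; f \<in> rp_kernel TYPE('a)\<rbrakk> \<Longrightarrow> f \<in> rp_ker"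
proof -
  show D: "f \<in> rp_ker" if "f \<in> rp_X" "rp_proj1 f \<in> D_sub TYPE('a)" for f
    using that by (auto simp: rp_ker_def rp_proj_zero_iff D_tilde_eq)
  show K: "f \<in> rp_ker" if "f \<in> rp_X" "rp_proj1 f \<in> K1 TYPE('a)" for f
    using that RP_tilde.M.submodule_zero[OF submodule_D_tilde]
    by (auto simp: rp_ker_def rp_proj_zero_iff simp flip: rp_proj2_zero_iff)
  show "f \<in> rp_ker" if "f \<in> rp_X" "f \<in> rp_kernel TYPE('a)" for f
    using that RP.M.submodule_zero[OF submodule_K1]
    by (intro K) (auto simp flip: rp_proj1_zero_iff)
qed

lemma relation_in_rp_ker:
  assumes "f \<in> rp_relations TYPE('a::field)"
  shows "f \<in> rp_ker"
proof (rule rp_ker_I(3))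
  show "f \<in> rp_X"
    using assms rp_relations_closed by blast
  show "f \<in> rp_kernel TYPE('a)"
    unfolding rp_kernel_def using free.M.subset_span assms by blast
qed

lemma one_in_rp_ker: "rp_elt 1 1 \<in> rp_ker"
  by (rule relation_in_rp_ker) (simp add: rp_relations_def Let_def rp_sym_eq)

lemma psi_in_rp_ker: 
  fixes x :: "'a::field"
  assumes "x \<noteq> 0"
  shows "psi_elt x \<in> rp_ker"
proof (rule rp_ker_I(2))
  have "psi1 x \<in> K1 TYPE('a)"
    unfolding K1_def using assms by (intro subsetD[OF RP.M.subset_span]) blast
  then show "rp_proj1 (psi_elt x) \<in> K1 TYPE('a)"
    using assms by (simp add: psi1_eq)
qed (use assms in simp)

lemma double_C_in_rp_ker: "C_rep + C_rep \<in> (rp_ker :: ('a::field rp_gen \<Rightarrow> _) set)"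
proof (rule rp_ker_I(1))
  show "rp_proj1 (C_rep + C_rep :: 'a rp_gen \<Rightarrow> _) \<in> D_sub TYPE('a)"
    unfolding D_sub_def by (rule subsetD[OF RP.M.subset_span]) (auto simp: C_elt_eq RP.proj_add)
qed simp

text \<open>Three times the generator is a defining relation and twice the generator is divided
  out.\<close>

lemma const_in_rp_ker:
  assumes card: "card (UNIV :: 'a::field set) = 2" and c: "c \<noteq> (0::'a)"
  shows "free_elt (sq_coset c) Const \<in> rp_ker"
proof -
  have "c = 1"
    using card2_cases[OF card] c by blast
  let ?c = "free_elt (sq_coset (1::'a)) Const"
  have cl: "?c \<in> rp_X"
    using card by (simp add: const_closed)
  have "?c + ?c + ?c \<in> rp_ker"
    using cl card by (intro relation_in_rp_ker)
      (simp add: rp_relations_def Let_def rp_const_eq free.proj_add)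
  moreover have "?c + ?c \<in> rp_ker"
    using double_C_in_rp_ker[where 'a = 'a] card by (simp add: C_rep_def)
  ultimately have "?c + ?c + ?c - (?c + ?c) \<in> rp_ker"
    by (rule rp_ker_closed)
  then show ?thesis
    by (simp add: \<open>c = 1\<close>)
qed

text \<open>\<open>1/x - 1\<close> is \<open>x (1 - x)\<close> times the square of
  \<open>1/x\<close>. In this form the coefficient is symmetric in \<open>x\<close> and
  \<open>1 - x\<close>.\<close>

lemma five_elt_canonical:
  assumes "x \<notin> {0, 1}" "y \<notin> {0, 1}"
  shows "five_elt x y = rp_elt 1 x - rp_elt 1 y + rp_elt x (y / x)
     - rp_elt (x * (1 - x)) (((1 - x) * y) / (x * (1 - y))) + rp_elt (1 - x) ((1 - x) / (1 - y))"
proof -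
  have "rp_elt (inverse x - 1) z = rp_elt (x * (1 - x)) z" for z
    by (rule rp_elt_eqI[where z = "inverse x"]) (use assms in \<open>auto simp: field_simps\<close>)
  moreover have "(1 - inverse x) / (1 - inverse y) = ((1 - x) * y) / (x * (1 - y))"
    using assms by (auto simp: field_simps)
  ultimately show ?thesis
    by (simp only: five_elt_def)
qed

lemma five_elt_in_rp_ker:
  fixes x y :: "'a::field"
  assumes xy: "x \<notin> {0, 1}" "y \<notin> {0, 1}"
  shows "five_elt x y \<in> rp_ker"
proof -
  consider "card (UNIV :: 'a set) = 2" | "card (UNIV :: 'a set) = 3"
    | "card (UNIV :: 'a set) \<noteq> 2" "card (UNIV :: 'a set) \<noteq> 3"
    by blast
  then show ?thesis
  proof cases
    case 1
    then show ?thesis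
      using card2_cases[of x] xy by simp
  next
    case 2
    \<comment> \<open>Over three elements both arguments are \<open>- 1\<close>; the first two terms
      cancel and the ratios in the other three are \<open>1\<close>.\<close>
    then have "x = y"
      using card3_cases[of x] card3_cases[of y] xy by auto
    then have "five_elt x y = scale x (rp_elt 1 1) - scale (x * (1 - x)) (rp_elt 1 1) + scale (1 - x) (rp_elt 1 1)"
      using xy by (simp add: five_elt_canonical)
    also have "\<dots> \<in> rp_ker"
      using xy by (intro rp_ker_closed(2,4,5) one_in_rp_ker) auto
    finally show ?thesis .
  next
    case 3
    then show ?thesis
      using xy by (intro relation_in_rp_ker) (auto simp: rp_relations_def Let_def simp flip: five_term_eq)
  qed
qed

text \<open>The independence of \<open>C\<close> of \<open>x\<close>: modulo \<open>psi_elt\<close>, the five-term relations at \<open>(x, y)\<close> and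
  at \<open>(1 - x, 1 - y)\<close> differ only in their first two terms.\<close>

lemma C_at_diff_in_rp_ker:
  fixes x y :: "'a::field"
  assumes xy: "x \<notin> {0, 1}" "y \<notin> {0, 1}"
  shows "C_at x - C_at y \<in> rp_ker"
proof -
  define z where "z = ((1 - x) * y) / (x * (1 - y))"
  have nz: "x \<noteq> 0" "y \<noteq> 0" "1 - x \<noteq> 0" "1 - y \<noteq> 0" "z \<noteq> 0"
    using xy by (auto simp: z_def)
  have inv: "inverse z = (x * (1 - y)) / ((1 - x) * y)"
    by (simp add: z_def)
  have A: "five_elt (1 - x) (1 - y) = rp_elt 1 (1 - x) - rp_elt 1 (1 - y) + rp_elt (1 - x) ((1 - y) / (1 - x))
      - rp_elt (x * (1 - x)) (inverse z) + rp_elt x (x / y)"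
    using xy by (subst five_elt_canonical) (auto simp: inv mult_ac)
  have B: "five_elt x y = rp_elt 1 x - rp_elt 1 y + rp_elt x (y / x)
      - rp_elt (x * (1 - x)) z + rp_elt (1 - x) ((1 - x) / (1 - y))"
    unfolding z_def by (rule five_elt_canonical[OF xy])
  have "C_at x - C_at y = five_elt x y + scale (-1) (five_elt (1 - x) (1 - y))
      - (scale x (psi_elt (y / x)) - scale (x * (1 - x)) (psi_elt z) + scale (1 - x) (psi_elt ((1 - x) / (1 - y))))"
    unfolding A B C_at_def psi_elt_def using nz by (simp add: scale_add scale_diff)
  also have "\<dots> \<in> rp_ker"
    using nz xy by (intro rp_ker_closed(2,4,5) five_elt_in_rp_ker psi_in_rp_ker) auto
  finally show ?thesis .
qed

text \<open>The arguments form an orbit of \<open>t \<mapsto> 1 - 1/t\<close>, which has order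
  three. One minus each of them is the inverse of another, so the six symbols pair up to multiples
  of \<open>psi_elt\<close>. As \<open>C\<close> is independent of the argument, this says
  \<open>3C = 0\<close>.\<close>

lemma C_at_sum_in_rp_ker:
  fixes x :: "'a::field"
  assumes x: "x \<notin> {0, 1}"
  shows "C_at x + C_at (1 - inverse x) + C_at (inverse (1 - x)) \<in> rp_ker"
proof -
  have nz: "x \<noteq> 0" "1 - x \<noteq> 0" "1 - inverse x \<noteq> 0"
    using x by auto
  have "1 - inverse (1 - x) = inverse (1 - inverse x)"
    using nz by (auto simp: field_simps)
  then have "C_at x + C_at (1 - inverse x) + C_at (inverse (1 - x)) =
      psi_elt x + scale (-1) (psi_elt (1 - x)) + psi_elt (1 - inverse x)"
    by (simp only: C_at_def psi_elt_def) (simp add: scale_add)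
  also have "\<dots> \<in> rp_ker"
    using nz by (intro rp_ker_closed(4,5) psi_in_rp_ker) auto
  finally show ?thesis .
qed

text \<open>In \<open>RP_tilde\<close> the element \<open>C\<close> is killed by 3, so dividing by \<open>2C\<close> kills \<open>C\<close> itself.\<close>

lemma C_at_in_rp_ker:
  fixes x :: "'a::field"
  assumes x: "x \<notin> {0, 1}"
  shows "C_at x \<in> rp_ker"
proof -
  consider "card (UNIV :: 'a set) = 2" | "card (UNIV :: 'a set) = 3"
    | "card (UNIV :: 'a set) \<noteq> 2" "card (UNIV :: 'a set) \<noteq> 3"
    by blast
  then show ?thesis
  proof cases
    case 1
    then show ?thesis
      using card2_cases[of x] x by simp
  next
    case 2
    \<comment> \<open>Over three elements \<open>x\<close>, \<open>1 - x\<close> and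
      \<open>1/x\<close> coincide, so \<open>C_at\<close> is already a value of
      \<open>psi_elt\<close>.\<close>
    have "x = - 1" "1 - x = - 1"
      using card3_cases[OF 2, of x] card3_cases[OF 2, of "1 - x"] x by auto
    then have "inverse x = 1 - x"
      by simp
    then have "C_at x = psi_elt x"
      by (simp only: C_at_def psi_elt_def)
    then show ?thesis
      using psi_in_rp_ker[of x] x by simp
  next
    case 3
    define s :: 'a where "s = (SOME x. x \<noteq> 0 \<and> x \<noteq> 1)"
    have s: "s \<notin> {0, 1}"
      unfolding s_def by (rule some_element[OF 3])
    have nz: "s \<noteq> 0" "1 - s \<noteq> 0"
      using s by auto
    have C: "C_rep = C_at s + (scale (1 - s) (psi_elt s) - scale 1 (psi_elt s))"
      using 3 by (simp add: C_rep_def C_at_def Let_def flip: s_def)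
    have psi: "scale (1 - s) (psi_elt s) - scale 1 (psi_elt s) \<in> rp_ker"
      using nz by (intro rp_ker_closed(2,5) psi_in_rp_ker) auto
    have x': "1 - inverse x \<notin> {0, 1}" "inverse (1 - x) \<notin> {0, 1}"
      using x by auto
    \<comment> \<open>This is \<open>3C - 2C\<close>: the differences move all arguments to
      \<open>x\<close>, and the last two summands undo the \<open>psi\<close> part of
      \<open>C_rep\<close>.\<close>
    have "C_at x = (C_at x + C_at (1 - inverse x) + C_at (inverse (1 - x)))
        + (C_at x - C_at (1 - inverse x)) + (C_at x - C_at (inverse (1 - x)))
        - (C_at x - C_at s) - (C_at x - C_at s) - (C_rep + C_rep)
        + (scale (1 - s) (psi_elt s) - scale 1 (psi_elt s)) + (scale (1 - s) (psi_elt s) - scale 1 (psi_elt s))"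
      unfolding C by (simp add: algebra_simps)
    also have "\<dots> \<in> rp_ker"
      by (intro rp_ker_closed(2)[of "_ - _"] rp_ker_closed(2)[of "_ + _"] rp_ker_closed(4) psi
          C_at_diff_in_rp_ker[OF x x'(1)] C_at_diff_in_rp_ker[OF x x'(2)] C_at_diff_in_rp_ker[OF x s]
          C_at_sum_in_rp_ker[OF x] double_C_in_rp_ker)
    finally show ?thesis .
  qed
qed

text \<open>The five-term relation at \<open>(x, y)\<close> and \<open><x>\<close> times the one at
  \<open>(1/x, y/x)\<close> contain \<open>[y]\<close> and \<open><x>[y/x]\<close> with opposite
  signs. Their sum leaves the two terms of \<open>phi_elt x\<close> and two pairs that vanish by
  \<open>swap\<close>. An auxiliary \<open>y\<close> outside \<open>0, 1, x\<close> needs a fourth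
  element, hence the separate treatment of small fields.\<close>

lemma phi_in_rp_ker:
  fixes x :: "'a::field"
  assumes "x \<noteq> 0"
  shows "phi_elt x \<in> rp_ker"
proof -
  consider "x = 1" | "x \<noteq> 1" "card (UNIV :: 'a set) = 2" | "x \<noteq> 1" "card (UNIV :: 'a set) = 3"
    | "x \<noteq> 1" "card (UNIV :: 'a set) \<noteq> 2" "card (UNIV :: 'a set) \<noteq> 3"
    by blast
  then show ?thesis
  proof cases
    case 1
    then show ?thesis
      using rp_ker_closed(4)[OF one_in_rp_ker one_in_rp_ker] by (simp add: phi_elt_def)
  next
    case 2
    then show ?thesis
      using card2_cases[of x] assms by simp
  next
    case 3
    then have "x = - 1"
      using card3_cases[of x] assms by simp
    then show ?thesis
      using psi_in_rp_ker[of x] by (simp add: phi_elt_def psi_elt_def)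
  next
    case 4
    obtain y where y: "y \<notin> {0, 1, x}"
      using ex_other_element[OF 4(2,3)] .
    \<comment> \<open>The map \<open>z \<mapsto> z / (z - 1)\<close> is composed of inversion,
      \<open>t \<mapsto> 1 - t\<close> and inversion again, and each of the three contributes a
      factor \<open>- <-1>\<close>.\<close>
    have swap: "rp_elt 1 z + rp_elt (-1) (z / (z - 1)) \<in> rp_ker" if z: "z \<notin> {0, 1}" for z :: 'a
    proof -
      have "inverse (1 - inverse z) = z / (z - 1)"
        using z by (auto simp: field_simps)
      then have "rp_elt 1 z + rp_elt (-1) (z / (z - 1)) = psi_elt z + psi_elt (1 - inverse z) - C_at (1 - inverse z)"
        by (simp add: psi_elt_def C_at_def)
      also have "\<dots> \<in> rp_ker"
        using z by (intro rp_ker_closed(2,4) psi_in_rp_ker C_at_in_rp_ker) auto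
      finally show ?thesis .
    qed
    define z where "z = ((1 - x) * y) / (x * (1 - y))"
    define w where "w = (1 - x) / (1 - y)"
    have nz: "x \<noteq> 0" "y \<noteq> 0" "1 - x \<noteq> 0" "1 - y \<noteq> 0" "y - x \<noteq> 0" "x - y \<noteq> 0"
      using y 4 assms by auto
    have xy: "x \<notin> {0, 1}" "y \<notin> {0, 1}" "inverse x \<notin> {0, 1}" "y / x \<notin> {0, 1}"
      using y 4 assms by auto
    have z1: "z - 1 = (y - x) / (x * (1 - y))"
      using nz by (simp add: z_def field_simps)
    have z: "z \<notin> {0, 1}"
      using nz z1 by (auto simp: z_def)
    have w1: "w - 1 = (y - x) / (1 - y)"
      using nz by (simp add: w_def field_simps)
    have w: "w \<notin> {0, 1}"
      using nz w1 by (auto simp: w_def)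
    \<comment> \<open>Replacing \<open>(x, y)\<close> by \<open>(1/x, y/x)\<close> sends the last
      two arguments \<open>z\<close> and \<open>w\<close> to their images under
      \<open>t \<mapsto> t / (t - 1)\<close>.\<close>
    have zarg: "((1 - inverse x) * (y / x)) / (inverse x * (1 - y / x)) = z / (z - 1)"
      unfolding z1 unfolding z_def using nz by (simp add: divide_simps) (simp add: algebra_simps)
    have warg: "(1 - inverse x) / (1 - y / x) = w / (w - 1)"
      unfolding w1 unfolding w_def using nz by (simp add: divide_simps) (simp add: algebra_simps)
    have "scale x (five_elt (inverse x) (y / x)) =
        rp_elt x (inverse x) - rp_elt x (y / x) + rp_elt 1 y
        - rp_elt (x * (inverse x * (1 - inverse x))) (z / (z - 1)) + rp_elt (x * (1 - inverse x)) (w / (w - 1))"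
      unfolding five_elt_canonical[OF xy(3,4)] zarg warg using nz by (simp add: scale_add scale_diff)
    moreover have "rp_elt (x * (inverse x * (1 - inverse x))) t = rp_elt (- (x * (1 - x))) t" for t
      by (rule rp_elt_eqI[where z = "inverse x"]) (use nz in \<open>auto simp: field_simps\<close>)
    moreover have "x * (1 - inverse x) = - (1 - x)"
      using nz by (simp add: algebra_simps)
    moreover have "five_elt x y = rp_elt 1 x - rp_elt 1 y + rp_elt x (y / x) - rp_elt (x * (1 - x)) z + rp_elt (1 - x) w"
      unfolding z_def w_def by (rule five_elt_canonical[OF xy(1,2)])
    ultimately have "phi_elt x = five_elt x y + scale x (five_elt (inverse x) (y / x))
        + scale (x * (1 - x)) (rp_elt 1 z + rp_elt (-1) (z / (z - 1)))
        - scale (1 - x) (rp_elt 1 w + rp_elt (-1) (w / (w - 1)))"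
      using nz by (simp add: phi_elt_def scale_add)
    also have "\<dots> \<in> rp_ker"
      using nz xy by (intro rp_ker_closed(2,4,5) five_elt_in_rp_ker swap z w) auto
    finally show ?thesis .
  qed
qed

text \<open>\<open>psi_elt\<close> and \<open>phi_elt\<close> both express \<open>[1/a]\<close>
  through \<open>[a]\<close>, with coefficients that differ by \<open><- a>\<close>; so
  \<open><- a>\<close> fixes \<open>[a]\<close>.\<close>

lemma neg_in_rp_ker:
  fixes a :: "'a::field"
  assumes "a \<noteq> 0"
  shows "rp_elt (- a) a - rp_elt 1 a \<in> rp_ker"
proof -
  have "rp_elt (- a) a - rp_elt 1 a = scale (- a) (psi_elt a) - phi_elt a"
    using assms by (simp add: psi_elt_def phi_elt_def scale_add)
  also have "\<dots> \<in> rp_ker"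
    using assms by (intro rp_ker_closed(2,5) psi_in_rp_ker phi_in_rp_ker) auto
  finally show ?thesis .
qed

lemma rp_induct [consumes 1, case_names zero diff rp_elt const]:
  fixes f :: "'a::field rp_gen \<Rightarrow> ('a set \<Rightarrow>\<^sub>0 int)"
  assumes f: "f \<in> rp_X"
    and zero: "P 0"
    and diff: "\<And>f g. \<lbrakk>f \<in> rp_X; g \<in> rp_X; P f; P g\<rbrakk> \<Longrightarrow> P (f - g)"
    and rp_elt: "\<And>c x. \<lbrakk>c \<noteq> 0; x \<noteq> 0\<rbrakk> \<Longrightarrow> P (rp_elt c x)"
    and const: "\<And>c. \<lbrakk>c \<noteq> 0; card (UNIV :: 'a set) = 2\<rbrakk> \<Longrightarrow> P (free_elt (sq_coset c) Const)"
  shows "P f"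
proof -
  have "f \<in> carrier (free_module (group_ring (sq_group TYPE('a))) (rp_gens TYPE('a)))"
    using f by (simp add: rp_free_eq)
  then show ?thesis
  proof (induction rule: comm_group.free_module_induct[OF comm_group_sq_group,
        consumes 1, case_names zero diff free_elt])
    case (diff f g)
    then show ?case
      by (intro assms(3)) (simp_all add: rp_free_eq)
  next
    case (free_elt c s)
    then obtain d where d: "d \<noteq> 0" "c = sq_coset d"
      by (auto simp: carrier_sq_group)
    show ?case
    proof (cases s)
      case (Sym x)
      then have "x \<noteq> 0"
        using free_elt by (auto simp: rp_gens_def split: if_splits)
      then show ?thesis
        using rp_elt[OF d(1)] by (simp add: rp_elt_def d Sym)
    next
      case Const
      then have "card (UNIV :: 'a set) = 2"
        using free_elt by (auto simp: rp_gens_def split: if_splits)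
      then show ?thesis
        using const[OF d(1)] by (simp add: d Const)
    qed
  qed (rule zero)
qed

text \<open>The additional generator over two elements lies in the kernel, so modulo
  \<open>rp_ker\<close> the symbols generate everything.\<close>

lemma rp_X_subset:
  fixes Z :: "('a::field rp_gen \<Rightarrow> ('a set \<Rightarrow>\<^sub>0 int)) set"
  assumes Z: "rp_invariant Z" and rp_elt: "\<And>x. x \<noteq> 0 \<Longrightarrow> rp_elt 1 x \<in> Z" and ker: "rp_ker \<subseteq> Z"
    and f: "f \<in> rp_X"
  shows "f \<in> Z"
  using f
proof (induction rule: rp_induct)
  case zero
  show ?case by (rule rp_invariantD(1)[OF Z])
next
  case (diff f g)
  then show ?case by (intro rp_invariantD(2)[OF Z])
next
  case (rp_elt c x)
  then show ?case
    using rp_invariantD(5)[OF Z, of c "rp_elt 1 x"] assms(2) by simp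
next
  case (const c)
  then show ?case
    using const_in_rp_ker ker by blast
qed

definition rp_rep :: "_ \<Rightarrow> ('a::field rp_gen \<Rightarrow> ('a set \<Rightarrow>\<^sub>0 int))" where
  "rp_rep m = (SOME f. f \<in> rp_X \<and> rp_proj f = m)"

lemma rp_rep:
  assumes "m \<in> carrier (RP_bar TYPE('a::field))"
  shows "rp_rep m \<in> rp_X" "rp_proj (rp_rep m) = m"
proof -
  have "\<exists>f. f \<in> rp_X \<and> rp_proj f = m"
    using assms by (auto simp: RP_bar.carrier_eq)
  from someI_ex[OF this] show "rp_rep m \<in> rp_X" "rp_proj (rp_rep m) = m"
    by (simp_all add: rp_rep_def)
qed

lemma rp_rep_proj: "f \<in> rp_X \<Longrightarrow> rp_rep (rp_proj f) - f \<in> (rp_ker :: ('a::field rp_gen \<Rightarrow> _) set)"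
  using rp_rep[OF RP_bar.proj_closed[of f]] RP_bar.proj_eq_iff[of "rp_rep (rp_proj f)" f]
  by (simp add: rp_ker_def)

section \<open>Valuations\<close>

locale valued_field =
  fixes v :: "'a::field \<Rightarrow> 'g::linordered_ab_group_add" and red :: "'a \<Rightarrow> 'k::field"
  assumes val: "valuation v" and res: "residue_field v red"
begin

lemma v_mult: "\<lbrakk>a \<noteq> 0; b \<noteq> 0\<rbrakk> \<Longrightarrow> v (a * b) = v a + v b"
  using val by (simp add: valuation_def)

lemma v_add: "\<lbrakk>a \<noteq> 0; b \<noteq> 0; a + b \<noteq> 0\<rbrakk> \<Longrightarrow> min (v a) (v b) \<le> v (a + b)"
  using val by (simp add: valuation_def)

lemma v_one [simp]: "v 1 = 0"
  using v_mult[of 1 1] by simp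

lemma v_inverse [simp]: "a \<noteq> 0 \<Longrightarrow> v (inverse a) = - v a"
  using v_mult[of a "inverse a"] by (simp add: eq_neg_iff_add_eq_0 add.commute)

lemma v_divide: "\<lbrakk>a \<noteq> 0; b \<noteq> 0\<rbrakk> \<Longrightarrow> v (a / b) = v a - v b"
  by (simp add: divide_inverse v_mult)

lemma v_uminus [simp]: "v (- a) = v a"
proof (cases "a = 0")
  case False
  have "v (- 1) + v (- 1) = 0"
    using v_mult[of "- 1" "- 1"] by simp
  \<comment> \<open>A linearly ordered group has no element of order two.\<close>
  then have "v (- 1) = 0"
    by (simp add: double_zero)
  then show ?thesis
    using v_mult[of "- 1" a] False by simp
qed simp

lemma v_less_add:
  assumes "a \<noteq> 0" "b \<noteq> 0" "v a < v b"
  shows "v (a + b) = v a" "a + b \<noteq> 0"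
proof -
  show nz: "a + b \<noteq> 0"
    using assms by (auto simp: add_eq_0_iff)
  have "v a \<le> v (a + b)"
    using v_add[of a b] assms nz by simp
  moreover have "min (v (a + b)) (v b) \<le> v a"
    using v_add[of "a + b" "- b"] assms nz by simp
  ultimately show "v (a + b) = v a"
    using assms by (simp add: min_def split: if_splits)
qed

lemma v_one_minus_pos: "\<lbrakk>a \<noteq> 0; 0 < v a\<rbrakk> \<Longrightarrow> v (1 - a) = 0"
  using v_less_add[of 1 "- a"] by simp

lemma v_one_minus_neg: "\<lbrakk>a \<noteq> 0; v a < 0\<rbrakk> \<Longrightarrow> v (1 - a) = v a"
  using v_less_add[of "- a" 1] by simp

lemma v_one_minus_unit: "\<lbrakk>a \<noteq> 0; a \<noteq> 1; v a = 0\<rbrakk> \<Longrightarrow> 0 \<le> v (1 - a)"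
  using v_add[of 1 "- a"] by simp

definition unit :: "'a \<Rightarrow> bool" where "unit x \<longleftrightarrow> x \<noteq> 0 \<and> v x = 0"

lemma unit_mult [simp]: "\<lbrakk>unit x; unit y\<rbrakk> \<Longrightarrow> unit (x * y)"
  by (simp add: unit_def v_mult)

lemma unit_divide [simp]: "\<lbrakk>unit x; unit y\<rbrakk> \<Longrightarrow> unit (x / y)"
  by (simp add: unit_def v_divide)

lemma unit_inverse [simp]: "unit (inverse x) \<longleftrightarrow> unit x"
  by (auto simp: unit_def)

lemma unit_uminus [simp]: "unit (- x) \<longleftrightarrow> unit x"
  by (simp add: unit_def)

lemma unit_one [simp]: "unit 1"
  by (simp add: unit_def)

lemma unit_nonzero: "unit x \<Longrightarrow> x \<noteq> 0"
  by (simp add: unit_def)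

lemma mem_valuation_ring: "a \<in> valuation_ring v \<longleftrightarrow> a = 0 \<or> 0 \<le> v a"
  by (simp add: valuation_ring_def)

lemma red_add: "\<lbrakk>a = 0 \<or> 0 \<le> v a; b = 0 \<or> 0 \<le> v b\<rbrakk> \<Longrightarrow> red (a + b) = red a + red b"
  using res unfolding residue_field_def mem_valuation_ring[symmetric] by blast

lemma red_mult: "\<lbrakk>a = 0 \<or> 0 \<le> v a; b = 0 \<or> 0 \<le> v b\<rbrakk> \<Longrightarrow> red (a * b) = red a * red b"
  using res unfolding residue_field_def mem_valuation_ring[symmetric] by blast

lemma red_one [simp]: "red 1 = 1"
  using res by (simp add: residue_field_def)

lemma red_zero [simp]: "red 0 = 0"
  using red_add[of 0 0] by (metis add_cancel_right_right)

lemma red_uminus: "a = 0 \<or> 0 \<le> v a \<Longrightarrow> red (- a) = - red a"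
  using red_add[of a "- a"] by (simp add: eq_neg_iff_add_eq_0 add.commute)

lemma red_one_minus: "a = 0 \<or> 0 \<le> v a \<Longrightarrow> red (1 - a) = 1 - red a"
  using red_add[of 1 "- a"] by (simp add: red_uminus)

lemma red_eq_0_iff: "a = 0 \<or> 0 \<le> v a \<Longrightarrow> red a = 0 \<longleftrightarrow> a = 0 \<or> 0 < v a"
proof -
  assume a: "a = 0 \<or> 0 \<le> v a"
  have "{a \<in> valuation_ring v. red a = 0} = valuation_ideal v"
    using res by (simp add: residue_field_def)
  then have "a \<in> valuation_ring v \<and> red a = 0 \<longleftrightarrow> a \<in> valuation_ideal v"
    by blast
  then show ?thesis
    using a by (auto simp: valuation_ring_def valuation_ideal_def)
qed

lemma red_surj: obtains a where "a = 0 \<or> 0 \<le> v a" "red a = b"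
proof -
  have "b \<in> red ` valuation_ring v"
    using res by (simp add: residue_field_def)
  then show thesis
    using that by (auto simp: valuation_ring_def)
qed

lemma red_unit_surj:
  assumes "b \<noteq> 0"
  obtains a where "unit a" "red a = b"
proof -
  obtain a where "a = 0 \<or> 0 \<le> v a" "red a = b"
    by (rule red_surj)
  then show thesis
    using that[of a] red_eq_0_iff[of a] assms by (auto simp: unit_def)
qed

lemma unit_ring: "unit a \<Longrightarrow> a = 0 \<or> 0 \<le> v a"
  by (simp add: unit_def)

lemma red_unit_nonzero [simp]: "unit a \<Longrightarrow> red a \<noteq> 0"
  using red_eq_0_iff[of a] by (auto simp: unit_def)

lemma red_unit_mult [simp]: "\<lbrakk>unit a; unit b\<rbrakk> \<Longrightarrow> red (a * b) = red a * red b"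
  by (intro red_mult unit_ring)

lemma red_unit_uminus [simp]: "unit a \<Longrightarrow> red (- a) = - red a"
  by (intro red_uminus unit_ring)

lemma red_unit_one_minus [simp]: "unit a \<Longrightarrow> red (1 - a) = 1 - red a"
  by (intro red_one_minus unit_ring)

lemma red_unit_inverse [simp]: "unit a \<Longrightarrow> red (inverse a) = inverse (red a)"
  using red_unit_mult[of a "inverse a"] by (simp add: unit_nonzero inverse_unique)

lemma red_unit_divide [simp]: "\<lbrakk>unit a; unit b\<rbrakk> \<Longrightarrow> red (a / b) = red a / red b"
  by (simp add: divide_inverse)

text \<open>The position of the residue of \<open>x\<close> on the projective line over
  \<open>k\<close>: outside \<open>0, 1, \<infinity>\<close>, or at one of these points. Each case
  also records how \<open>1 - x\<close> behaves.\<close>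

lemma residue_cases [consumes 1, case_names generic zero one infinity]:
  assumes x: "x \<notin> {0, 1}"
  obtains "unit x" "unit (1 - x)" "red x \<notin> {0, 1}"
    | "0 < v x" "unit (1 - x)" "red (1 - x) = 1"
    | "unit x" "red x = 1" "0 < v (1 - x)"
    | "v x < 0" "v (1 - x) = v x"
proof -
  consider "0 < v x" | "v x < 0" | "v x = 0" "v (1 - x) = 0" | "v x = 0" "0 < v (1 - x)"
    using v_one_minus_unit[of x] x by fastforce
  then show thesis
  proof cases
    case 1
    then have "red x = 0"
      using red_eq_0_iff[of x] by (simp add: less_imp_le)
    then have "red (1 - x) = 1"
      using 1 red_one_minus[of x] by (simp add: less_imp_le)
    then show thesis
      using that(2) x v_one_minus_pos[of x] 1 by (simp add: unit_def)
  next
    case 2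
    then show thesis
      using that(4) x v_one_minus_neg[of x] by simp
  next
    case 3
    then have "red (1 - x) \<noteq> 0" "unit x"
      using red_eq_0_iff[of "1 - x"] x by (simp_all add: unit_def)
    then show thesis
      using that(1) 3 x by (simp add: unit_def)
  next
    case 4
    then have "red (1 - x) = 0" "unit x"
      using red_eq_0_iff[of "1 - x"] x by (simp_all add: unit_def)
    then show thesis
      using that(3) 4 x by simp
  qed
qed

section \<open>Square classes of units\<close>

definition unit_coset :: "'a \<Rightarrow> 'a set" where
  "unit_coset u = group_squares (val_units v) #>\<^bsub>val_units v\<^esub> u"

lemma carrier_unit_sq_ring:
  "a \<in> carrier (unit_sq_ring v) \<longleftrightarrow> Poly_Mapping.keys a \<subseteq> unit_coset ` {u. unit u}"
  by (auto simp: unit_sq_ring_def FactGroup_def RCOSETS_def unit_coset_def val_units_def unit_def)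

lemma mem_unit_coset: "x \<in> unit_coset u \<longleftrightarrow> (\<exists>w. unit w \<and> x = (w * w) * u)"
  by (auto simp: unit_coset_def r_coset_def group_squares_def val_units_def unit_def)

lemma mem_squares: "x \<in> group_squares (field_units TYPE('b::field)) \<longleftrightarrow> (\<exists>w. w \<noteq> 0 \<and> x = w * w)"
  by (auto simp: group_squares_def)

lemma unit_incl_coset [simp]: "unit u \<Longrightarrow> unit_incl (frag_of (unit_coset u)) = sq_class u"
proof -
  assume u: "unit u"
  have "group_squares (field_units TYPE('a)) <#>\<^bsub>field_units TYPE('a)\<^esub> unit_coset u = sq_coset u"
  proof (intro Set.set_eqI iffI)
    fix x assume "x \<in> group_squares (field_units TYPE('a)) <#>\<^bsub>field_units TYPE('a)\<^esub> unit_coset u"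
    then obtain z w where "z \<noteq> 0" "unit w" "x = (z * z) * ((w * w) * u)"
      by (auto simp: set_mult_def mem_squares mem_unit_coset)
    then have "z * w \<noteq> 0" "x = u * ((z * w) * (z * w))"
      by (auto simp: unit_def)
    then show "x \<in> sq_coset u"
      unfolding mem_sq_coset by blast
  next
    fix x assume "x \<in> sq_coset u"
    then obtain z where "z \<noteq> 0" "x = (z * z) * u"
      by (auto simp: mem_sq_coset)
    moreover have "u \<in> unit_coset u"
      unfolding mem_unit_coset by (rule exI[of _ 1]) simp
    ultimately show "x \<in> group_squares (field_units TYPE('a)) <#>\<^bsub>field_units TYPE('a)\<^esub> unit_coset u"
      by (fastforce simp: set_mult_def mem_squares)
  qed
  then show ?thesis
    by (simp add: unit_incl_def sq_class_eq)
qed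

lemma unit_red_coset [simp]: "unit u \<Longrightarrow> unit_red red (frag_of (unit_coset u)) = sq_class (red u)"
proof -
  assume u: "unit u"
  have "group_squares (field_units TYPE('k)) <#>\<^bsub>field_units TYPE('k)\<^esub> red ` unit_coset u = sq_coset (red u)"
  proof (intro Set.set_eqI iffI)
    fix x assume "x \<in> group_squares (field_units TYPE('k)) <#>\<^bsub>field_units TYPE('k)\<^esub> red ` unit_coset u"
    then obtain z w where "z \<noteq> 0" "unit w" "x = (z * z) * red ((w * w) * u)"
      by (auto simp: set_mult_def mem_squares mem_unit_coset)
    then have "z * red w \<noteq> 0" "x = red u * ((z * red w) * (z * red w))"
      using u by simp_all
    then show "x \<in> sq_coset (red u)"
      unfolding mem_sq_coset by blast
  next
    fix x assume "x \<in> sq_coset (red u)"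
    then obtain z where "z \<noteq> 0" "x = (z * z) * red u"
      by (auto simp: mem_sq_coset)
    moreover have "u \<in> unit_coset u"
      unfolding mem_unit_coset by (rule exI[of _ 1]) simp
    ultimately show "x \<in> group_squares (field_units TYPE('k)) <#>\<^bsub>field_units TYPE('k)\<^esub> red ` unit_coset u"
      by (fastforce simp: set_mult_def mem_squares)
  qed
  then show ?thesis
    by (simp add: unit_red_def sq_class_eq)
qed

lemma unit_incl_closed:
  assumes "a \<in> carrier (unit_sq_ring v)"
  shows "unit_incl a \<in> carrier (sq_ring TYPE('a))"
proof -
  have "Poly_Mapping.keys a \<subseteq> unit_coset ` {u. unit u}"
    using assms by (simp add: carrier_unit_sq_ring)
  then show ?thesis
  proof (induction a rule: frag_induction)
    case (one x)
    then show ?case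
      by (auto simp: unit_nonzero)
  next
    case (diff a b)
    then show ?case
      using keys_diff[of "unit_incl a" "unit_incl b"]
      by (auto simp: sq_ring_eq unit_incl_def frag_extend_diff)
  qed (simp add: unit_incl_def sq_ring_eq)
qed

lemma unit_red_closed:
  assumes "a \<in> carrier (unit_sq_ring v)"
  shows "unit_red red a \<in> carrier (sq_ring TYPE('k))"
proof -
  have "Poly_Mapping.keys a \<subseteq> unit_coset ` {u. unit u}"
    using assms by (simp add: carrier_unit_sq_ring)
  then show ?thesis
  proof (induction a rule: frag_induction)
    case (one x)
    then show ?case
      by (auto simp: unit_nonzero)
  next
    case (diff a b)
    then show ?case
      using keys_diff[of "unit_red red a" "unit_red red b"]
      by (auto simp: sq_ring_eq unit_red_def frag_extend_diff)
  qed (simp add: unit_red_def sq_ring_eq)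
qed

section \<open>The specialization map\<close>

abbreviation RPk where "RPk \<equiv> restrict_scalars (unit_red red) (RP_bar TYPE('k))"

lemma RPk_simps [simp]:
  "carrier RPk = carrier (RP_bar TYPE('k))"
  "x \<oplus>\<^bsub>RPk\<^esub> y = x \<oplus>\<^bsub>RP_bar TYPE('k)\<^esub> y"
  "a \<odot>\<^bsub>RPk\<^esub> x = unit_red red a \<odot>\<^bsub>RP_bar TYPE('k)\<^esub> x"
  by (simp_all add: restrict_scalars_def)

sublocale T: scalar_extension "sq_ring TYPE('a)" "unit_sq_ring v" unit_incl RPk
proof -
  interpret cring "sq_ring TYPE('a)"
    by (rule cring_sq_ring)
  show "scalar_extension (sq_ring TYPE('a)) (unit_sq_ring v) unit_incl RPk"
    by unfold_locales (simp_all add: unit_incl_closed unit_red_closed)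
qed

text \<open>The pure tensor of \<open><c>\<close> and the class of \<open>f\<close>, as a formal
  symbol before the tensor relations are divided out.\<close>

definition tens :: "'a \<Rightarrow> ('k rp_gen \<Rightarrow> ('k set \<Rightarrow>\<^sub>0 int)) \<Rightarrow> _" where
  "tens c f = frag_of (sq_class c, rp_proj f)"

definition tens_eq (infix \<open>\<doteq>\<close> 50) where "a \<doteq> b \<longleftrightarrow> a - b \<in> T.N"

lemma tens_eq_refl [simp]: "a \<doteq> a"
  by (simp add: tens_eq_def T.tensor_kernel_zero)

lemma tens_eq_sym: "a \<doteq> b \<Longrightarrow> b \<doteq> a"
  using T.tensor_kernel_minus[of "a - b"] by (simp add: tens_eq_def)

lemma tens_eq_trans [trans]: "a \<doteq> b \<Longrightarrow> b \<doteq> c \<Longrightarrow> a \<doteq> c"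
  using T.tensor_kernel_add[of "a - b" "b - c"] by (simp add: tens_eq_def)

lemma tens_eq_eq_trans [trans]: "a \<doteq> b \<Longrightarrow> b = c \<Longrightarrow> a \<doteq> c" "a = b \<Longrightarrow> b \<doteq> c \<Longrightarrow> a \<doteq> c"
  by simp_all

lemma tens_eq_add: "a \<doteq> b \<Longrightarrow> c \<doteq> d \<Longrightarrow> a + c \<doteq> b + d"
  using T.tensor_kernel_add[of "a - b" "c - d"] by (simp add: tens_eq_def algebra_simps)

lemma tens_eq_diff: "a \<doteq> b \<Longrightarrow> c \<doteq> d \<Longrightarrow> a - c \<doteq> b - d"
  using T.tensor_kernel_diff[of "a - b" "c - d"] by (simp add: tens_eq_def algebra_simps)

lemma tens_eq_0_iff: "a \<doteq> 0 \<longleftrightarrow> a \<in> T.N"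
  by (simp add: tens_eq_def)

lemma tens_add: "\<lbrakk>c \<noteq> 0; f \<in> rp_X; g \<in> rp_X\<rbrakk> \<Longrightarrow> tens c (f + g) \<doteq> tens c f + tens c g"
  using T.tensor_kernel_right_add[of "sq_class c" "rp_proj f" "rp_proj g"]
  by (simp add: tens_def tens_eq_def RP_bar.proj_add diff_diff_eq)

lemma tens_zero: "c \<noteq> 0 \<Longrightarrow> tens c 0 \<doteq> 0"
  using tens_add[of c 0 0] T.tensor_kernel_minus by (simp add: tens_eq_def) fastforce

lemma tens_diff:
  assumes "c \<noteq> 0" "f \<in> rp_X" "g \<in> rp_X"
  shows "tens c (f - g) \<doteq> tens c f - tens c g"
  using tens_eq_sym[OF tens_add[of c "f - g" g]] assms
  by (simp add: tens_eq_def algebra_simps)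

lemma tens_cong: "\<lbrakk>f \<in> rp_X; g \<in> rp_X; f - g \<in> rp_ker\<rbrakk> \<Longrightarrow> tens c f = tens c g"
  using RP_bar.proj_eq_iff[of f g] by (simp add: tens_def rp_ker_def)

lemma tens_ker: "\<lbrakk>c \<noteq> 0; f \<in> rp_ker\<rbrakk> \<Longrightarrow> tens c f \<doteq> 0"
  using tens_cong[of f 0 c] tens_zero[of c] by (simp add: rp_ker_closed)

text \<open>The balancing relation for the class of \<open>u\<close>. It is the only means of moving
  a coefficient into the right factor, and it is limited to units.\<close>

lemma tens_unit:
  assumes "c \<noteq> 0" "unit u" "f \<in> rp_X"
  shows "tens (c * u) f \<doteq> tens c (scale (red u) f)"
proof -
  have "frag_of (unit_coset u) \<in> carrier (unit_sq_ring v)"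
    using assms by (auto simp: carrier_unit_sq_ring)
  from T.tensor_kernel_balanced[OF _ this, of "sq_class c" "rp_proj f"] show ?thesis
    using assms
    by (simp add: tens_def tens_eq_def RP_bar.proj_smult unit_nonzero flip: scale_def)
      (simp add: sq_ring_eq sq_class_eq unit_nonzero)
qed

text \<open>Collects terms into a single tensor, so that a relation in \<open>RP_bar\<close> over
  \<open>k\<close> can be applied to its right factor.\<close>

lemma tens_unit_combine:
  assumes "c \<noteq> 0" "unit u" "f \<in> rp_X" "g \<in> rp_X"
  shows "tens c f + tens (c * u) g \<doteq> tens c (f + scale (red u) g)"
    "tens c f - tens (c * u) g \<doteq> tens c (f - scale (red u) g)"
proof -
  have 1: "tens (c * u) g \<doteq> tens c (scale (red u) g)"
    by (rule tens_unit) (use assms in simp_all)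
  have 2: "tens c f + tens c (scale (red u) g) \<doteq> tens c (f + scale (red u) g)"
    by (rule tens_eq_sym[OF tens_add]) (use assms in simp_all)
  have 3: "tens c f - tens c (scale (red u) g) \<doteq> tens c (f - scale (red u) g)"
    by (rule tens_eq_sym[OF tens_diff]) (use assms in simp_all)
  show "tens c f + tens (c * u) g \<doteq> tens c (f + scale (red u) g)"
    by (rule tens_eq_trans[OF tens_eq_add[OF tens_eq_refl 1] 2])
  show "tens c f - tens (c * u) g \<doteq> tens c (f - scale (red u) g)"
    by (rule tens_eq_trans[OF tens_eq_diff[OF tens_eq_refl 1] 3])
qed

text \<open>The symbol that \<open>S_v\<close> attaches to \<open>[x]\<close>. For residue
  \<open>1\<close> it is \<open>[1]\<close>, which is zero only after projection.\<close>

definition res_sym :: "'a \<Rightarrow> 'k rp_gen \<Rightarrow> ('k set \<Rightarrow>\<^sub>0 int)" where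
  "res_sym x = (if unit x then rp_elt 1 (red x) else 0)"

lemma res_sym_closed [simp]: "res_sym x \<in> rp_X"
  by (simp add: res_sym_def)

lemma res_sym_cong: "\<lbrakk>unit u; red u = 1; x \<noteq> 0\<rbrakk> \<Longrightarrow> res_sym (x * u) = res_sym x"
  by (auto simp: res_sym_def unit_def v_mult)

lemma res_sym_not_unit: "\<not> unit x \<Longrightarrow> res_sym x = 0"
  by (simp add: res_sym_def)

lemma res_sym_one: "\<lbrakk>unit u; red u = 1\<rbrakk> \<Longrightarrow> res_sym u \<in> rp_ker"
  by (simp add: res_sym_def one_in_rp_ker)

text \<open>Covers both ways in which a term disappears: nonzero valuation, or residue
  \<open>1\<close> together with \<open>[1] = 0\<close>.\<close>

lemma tens_sp_zero:
  assumes "c \<noteq> 0" "unit x \<Longrightarrow> red x = 1"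
  shows "tens c (res_sym x) \<doteq> 0"
  using assms res_sym_one[of x] by (cases "unit x") (simp_all add: tens_ker tens_zero res_sym_not_unit)

text \<open>The element \<open>- 1\<close> is a unit, so its class can always be moved, whatever the
  valuation of \<open>x\<close>.\<close>

lemma tens_sp_psi:
  assumes "c \<noteq> 0" "x \<noteq> 0"
  shows "tens c (res_sym x) + tens (c * (- 1)) (res_sym (inverse x)) \<doteq> 0"
proof -
  have "tens c (res_sym x) + tens (c * (- 1)) (res_sym (inverse x)) \<doteq> tens c (res_sym x + scale (red (- 1)) (res_sym (inverse x)))"
    by (rule tens_unit_combine) (use assms in simp_all)
  also have "\<dots> \<doteq> 0"
  proof (rule tens_ker)
    show "res_sym x + scale (red (- 1)) (res_sym (inverse x)) \<in> rp_ker"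
    proof (cases "unit x")
      case True
      then have "res_sym x + scale (red (- 1)) (res_sym (inverse x)) = psi_elt (red x)"
        by (simp add: res_sym_def psi_elt_def)
      then show ?thesis
        using psi_in_rp_ker[of "red x"] True by simp
    next
      case False
      then show ?thesis
        using rp_ker_closed(1) by (simp add: res_sym_not_unit)
    qed
  qed (use assms in simp)
  finally show ?thesis .
qed

text \<open>For a unit \<open>x\<close> the coefficient moves across and the relation over
  \<open>k\<close> applies. For a nonunit it cannot be moved, but both symbols vanish.\<close>

lemma tens_sp_phi:
  assumes "c \<noteq> 0" "x \<noteq> 0"
  shows "tens c (res_sym x) + tens (c * x) (res_sym (inverse x)) \<doteq> 0"
proof (cases "unit x")
  case True
  have "tens c (res_sym x) + tens (c * x) (res_sym (inverse x)) \<doteq> tens c (res_sym x + scale (red x) (res_sym (inverse x)))"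
    by (rule tens_unit_combine) (use assms True in simp_all)
  also have "\<dots> \<doteq> 0"
  proof (rule tens_ker)
    have "res_sym x + scale (red x) (res_sym (inverse x)) = phi_elt (red x)"
      using True by (simp add: res_sym_def phi_elt_def)
    then show "res_sym x + scale (red x) (res_sym (inverse x)) \<in> rp_ker"
      using phi_in_rp_ker[of "red x"] True by simp
  qed (use assms in simp)
  finally show ?thesis .
next
  case False
  then show ?thesis
    using tens_eq_add[OF tens_sp_zero[of c x] tens_sp_zero[of "c * x" "inverse x"]] assms by simp
qed

text \<open>If the residue of \<open>x\<close> is \<open>0\<close>, \<open>1\<close> or
  \<open>\<infinity>\<close>, then \<open>x\<close> and \<open>1 - x\<close> are each a nonunit or
  have residue \<open>1\<close>, and both terms vanish.\<close>

lemma tens_sp_c: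
  assumes "x \<notin> {0, 1}"
  shows "tens 1 (res_sym x) + tens (- 1) (res_sym (1 - x)) \<doteq> 0"
proof -
  have zero: "tens 1 (res_sym x) + tens (- 1) (res_sym (1 - x)) \<doteq> 0"
    if "unit x \<Longrightarrow> red x = 1" "unit (1 - x) \<Longrightarrow> red (1 - x) = 1"
    using tens_eq_add[OF tens_sp_zero[of 1 x] tens_sp_zero[of "- 1" "1 - x"]] that by simp
  show ?thesis
    using assms
  proof (cases rule: residue_cases)
    case generic
    have "tens 1 (res_sym x) + tens (1 * (- 1)) (res_sym (1 - x)) \<doteq> tens 1 (res_sym x + scale (red (- 1)) (res_sym (1 - x)))"
      by (rule tens_unit_combine) simp_all
    also have "\<dots> \<doteq> 0"
    proof (rule tens_ker)
      have "res_sym x + scale (red (- 1)) (res_sym (1 - x)) = C_at (red x)"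
        using generic by (simp add: res_sym_def C_at_def)
      then show "res_sym x + scale (red (- 1)) (res_sym (1 - x)) \<in> rp_ker"
        using C_at_in_rp_ker[of "red x"] generic by simp
    qed simp
    finally show ?thesis
      by simp
  qed (rule zero; simp add: unit_def)+
qed

section \<open>The five-term relation under specialization\<close>

definition cross_ratio :: "'a \<Rightarrow> 'a \<Rightarrow> 'a" where
  "cross_ratio x y = ((1 - x) * y) / (x * (1 - y))"

definition tens_five :: "'a \<Rightarrow> 'a \<Rightarrow> _" where
  "tens_five x y = tens 1 (res_sym x) - tens 1 (res_sym y) + tens x (res_sym (y / x))
     - tens (x * (1 - x)) (res_sym (cross_ratio x y)) + tens (1 - x) (res_sym ((1 - x) / (1 - y)))"

lemma tens_sq: "\<lbrakk>c = d * (z * z); d \<noteq> 0; z \<noteq> 0\<rbrakk> \<Longrightarrow> tens c f = tens d f"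
  using sq_coset_eqI[of c d z] by (simp add: tens_def sq_class_eq)

text \<open>Exchanging \<open>x\<close> and \<open>y\<close> reduces the number of cases in the five-term relation.\<close>

lemma tens_five_swap:
  assumes x: "x \<notin> {0, 1}" and y: "y \<notin> {0, 1}"
  shows "tens_five x y + tens_five y x \<doteq> 0"
proof -
  have nz: "x \<noteq> 0" "y \<noteq> 0" "1 - x \<noteq> 0" "1 - y \<noteq> 0"
    using x y by auto
  define z where "z = cross_ratio x y"
  define w where "w = (1 - x) / (1 - y)"
  have z: "z \<noteq> 0" and w: "w \<noteq> 0"
    using nz by (simp_all add: z_def w_def cross_ratio_def)
  have inv: "cross_ratio y x = inverse z" "(1 - y) / (1 - x) = inverse w" "x / y = inverse (y / x)"
    by (simp_all add: z_def w_def cross_ratio_def mult_ac)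
  have 1: "tens x (res_sym (y / x)) + tens (x * (y / x)) (res_sym (inverse (y / x))) \<doteq> 0"
    by (rule tens_sp_phi) (use nz in simp_all)
  have 2: "tens (x * (1 - x)) (res_sym z) + tens (x * (1 - x) * z) (res_sym (inverse z)) \<doteq> 0"
    by (rule tens_sp_phi) (use nz z in simp_all)
  have 3: "tens (1 - x) (res_sym w) + tens ((1 - x) * w) (res_sym (inverse w)) \<doteq> 0"
    by (rule tens_sp_phi) (use nz w in simp_all)
  have "tens y f = tens (x * (y / x)) f" for f
    using nz by simp
  \<comment> \<open>The coefficients in the relation at \<open>(y, x)\<close> are those of
    \<open>tens_sp_phi\<close> at the terms for \<open>(x, y)\<close>, up to squares of
    \<open>(1 - y) / (1 - x)\<close>.\<close>
  moreover have "tens (y * (1 - y)) f = tens (x * (1 - x) * z) f" for f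
    by (rule tens_sq[where z = "(1 - y) / (1 - x)"])
      (use nz z in \<open>simp_all add: z_def cross_ratio_def divide_simps\<close>)
  moreover have "tens (1 - y) f = tens ((1 - x) * w) f" for f
    by (rule tens_sq[where z = "(1 - y) / (1 - x)"])
      (use nz w in \<open>simp_all add: w_def divide_simps\<close>)
  ultimately have "tens_five x y + tens_five y x =
      (tens x (res_sym (y / x)) + tens (x * (y / x)) (res_sym (inverse (y / x))))
      - (tens (x * (1 - x)) (res_sym z) + tens (x * (1 - x) * z) (res_sym (inverse z)))
      + (tens (1 - x) (res_sym w) + tens ((1 - x) * w) (res_sym (inverse w)))"
    unfolding tens_five_def inv by (simp add: w_def z_def)
  also have "\<dots> \<doteq> 0 - 0 + 0"
    by (intro tens_eq_add tens_eq_diff 1 2 3)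
  finally show ?thesis
    by simp
qed

lemma tens_five_swapD: "\<lbrakk>x \<notin> {0, 1}; y \<notin> {0, 1}; tens_five y x \<doteq> 0\<rbrakk> \<Longrightarrow> tens_five x y \<doteq> 0"
  using tens_eq_diff[OF tens_five_swap[of x y], of "tens_five y x" 0] by simp

lemma tens_five_sum_zero:
  assumes "tens 1 (res_sym x) \<doteq> 0" "tens 1 (res_sym y) \<doteq> 0" "tens x (res_sym (y / x)) \<doteq> 0"
    "tens (x * (1 - x)) (res_sym (cross_ratio x y)) \<doteq> 0" "tens (1 - x) (res_sym ((1 - x) / (1 - y))) \<doteq> 0"
  shows "tens_five x y \<doteq> 0"
  using tens_eq_add[OF tens_eq_diff[OF tens_eq_add[OF tens_eq_diff[OF assms(1,2)] assms(3)] assms(4)] assms(5)]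
  by (simp add: tens_five_def)

lemma tens_five_cong:
  assumes "tens 1 (res_sym x) \<doteq> a" "tens 1 (res_sym y) \<doteq> b" "tens x (res_sym (y / x)) \<doteq> c"
    "tens (x * (1 - x)) (res_sym (cross_ratio x y)) \<doteq> d" "tens (1 - x) (res_sym ((1 - x) / (1 - y))) \<doteq> e"
  shows "tens_five x y \<doteq> a - b + c - d + e"
  unfolding tens_five_def by (intro tens_eq_add tens_eq_diff assms)

lemma v_cross_ratio:
  assumes "x \<notin> {0, 1}" "y \<notin> {0, 1}"
  shows "v (cross_ratio x y) = v (1 - x) + v y - (v x + v (1 - y))"
  using assms by (simp add: cross_ratio_def v_divide v_mult)

text \<open>Such a unit moves across the tensor sign as the trivial square class.\<close>

lemma tens_U1:
  assumes "c \<noteq> 0" "unit u" "red u = 1"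
  shows "tens (c * u) (res_sym x) \<doteq> tens c (res_sym x)"
proof -
  have "scale 1 (res_sym x) = res_sym x"
    by (simp add: res_sym_def)
  then show ?thesis
    using tens_unit[of c u "res_sym x"] assms by simp
qed

text \<open>All coefficients and arguments are units, so everything moves into the right factor and
  becomes the five-term relation over \<open>k\<close> at the residues.\<close>

lemma tens_five_generic_generic:
  assumes x: "unit x" "unit (1 - x)" "red x \<notin> {0, 1}" and y: "unit y" "unit (1 - y)" "red y \<notin> {0, 1}"
  shows "tens_five x y \<doteq> 0"
proof -
  let ?X = "red x" let ?Y = "red y"
  define w where "w = (1 - x) / (1 - y)"
  define z where "z = cross_ratio x y"
  have u: "unit (y / x)" "unit w" "unit z"
    using x y by (simp_all add: w_def z_def cross_ratio_def)
  have red: "red (y / x) = ?Y / ?X" "red w = (1 - ?X) / (1 - ?Y)"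
    "red z = ((1 - ?X) * ?Y) / (?X * (1 - ?Y))"
    using x y by (simp_all add: w_def z_def cross_ratio_def)
  have nz: "?X \<noteq> 0" "?Y \<noteq> 0" "1 - ?X \<noteq> 0" "1 - ?Y \<noteq> 0"
    using x y by auto
  have r: "red (x * (1 - x)) = ?X * (1 - ?X)" "red (1 - x) = 1 - ?X"
    using x by simp_all
  have s: "res_sym x = rp_elt 1 ?X" "res_sym y = rp_elt 1 ?Y" "scale ?X (res_sym (y / x)) = rp_elt ?X (?Y / ?X)"
    "scale (1 - ?X) (res_sym w) = rp_elt (1 - ?X) ((1 - ?X) / (1 - ?Y))"
    "scale (?X * (1 - ?X)) (res_sym z) = rp_elt (?X * (1 - ?X)) (((1 - ?X) * ?Y) / (?X * (1 - ?Y)))"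
    using x y u nz by (simp_all add: res_sym_def red)
  have five_elt: "res_sym x - res_sym y + scale (red x) (res_sym (y / x)) - scale (red (x * (1 - x))) (res_sym z)
      + scale (red (1 - x)) (res_sym w) = five_elt ?X ?Y"
    unfolding r s by (rule five_elt_canonical[symmetric]) (use x y in simp_all)
  have m1: "res_sym x - res_sym y \<in> rp_X"
    by (rule free.X_diff[OF res_sym_closed res_sym_closed])
  have m2: "res_sym x - res_sym y + scale (red x) (res_sym (y / x)) \<in> rp_X"
    by (rule free.X_add[OF m1 scale_closed[OF nz(1) res_sym_closed]])
  have m3: "res_sym x - res_sym y + scale (red x) (res_sym (y / x)) - scale (red (x * (1 - x))) (res_sym z) \<in> rp_X"
    by (rule free.X_diff[OF m2 scale_closed[OF red_unit_nonzero[OF unit_mult[OF x(1,2)]] res_sym_closed]])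
  \<comment> \<open>The coefficients are written with a factor \<open>1\<close> to fit
    \<open>tens_unit_combine\<close>, which then absorbs one term at a time.\<close>
  have "tens_five x y = tens 1 (res_sym x) - tens 1 (res_sym y) + tens (1 * x) (res_sym (y / x)) - tens (1 * (x * (1 - x))) (res_sym z)
      + tens (1 * (1 - x)) (res_sym w)"
    by (simp only: tens_five_def z_def w_def mult_1_left)
  also have "\<dots> \<doteq> tens 1 (res_sym x - res_sym y) + tens (1 * x) (res_sym (y / x)) - tens (1 * (x * (1 - x))) (res_sym z)
      + tens (1 * (1 - x)) (res_sym w)"
    by (rule tens_eq_add[OF tens_eq_diff[OF tens_eq_add[OF tens_eq_sym[OF tens_diff[OF one_neq_zero res_sym_closed res_sym_closed]]
            tens_eq_refl] tens_eq_refl] tens_eq_refl])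
  also have "\<dots> \<doteq> tens 1 (res_sym x - res_sym y + scale (red x) (res_sym (y / x))) - tens (1 * (x * (1 - x))) (res_sym z)
      + tens (1 * (1 - x)) (res_sym w)"
    by (rule tens_eq_add[OF tens_eq_diff[OF tens_unit_combine(1)[OF one_neq_zero x(1) m1 res_sym_closed]
            tens_eq_refl] tens_eq_refl])
  also have "\<dots> \<doteq> tens 1 (res_sym x - res_sym y + scale (red x) (res_sym (y / x)) - scale (red (x * (1 - x))) (res_sym z))
      + tens (1 * (1 - x)) (res_sym w)"
    by (rule tens_eq_add[OF tens_unit_combine(2)[OF one_neq_zero unit_mult[OF x(1,2)] m2 res_sym_closed] tens_eq_refl])
  also have "\<dots> \<doteq> tens 1 (res_sym x - res_sym y + scale (red x) (res_sym (y / x)) - scale (red (x * (1 - x))) (res_sym z)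
      + scale (red (1 - x)) (res_sym w))"
    by (rule tens_unit_combine(1)[OF one_neq_zero x(2) m3 res_sym_closed])
  also have "\<dots> = tens 1 (five_elt ?X ?Y)"
    by (simp only: five_elt)
  also have "\<dots> \<doteq> 0"
    by (rule tens_ker[OF one_neq_zero five_elt_in_rp_ker[OF x(3) y(3)]])
  finally show ?thesis .
qed

text \<open>With \<open>X\<close> the residue of \<open>x\<close>, the surviving terms are
  \<open>[X] + <1 - X>[1 - X]\<close>. Since \<open><X - 1>\<close> fixes \<open>[1 - X]\<close>,
  this is \<open>C_at X\<close>.\<close>

lemma tens_five_generic_zero:
  assumes x: "unit x" "unit (1 - x)" "red x \<notin> {0, 1}"
    and y: "y \<notin> {0, 1}" "0 < v y" "unit (1 - y)" "red (1 - y) = 1"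
  shows "tens_five x y \<doteq> 0"
proof -
  let ?X = "red x"
  define w where "w = (1 - x) / (1 - y)"
  have x01: "x \<notin> {0, 1}" "?X \<noteq> 0" "1 - ?X \<noteq> 0"
    using x by (auto simp: unit_def)
  have nu: "\<not> unit y" "\<not> unit (y / x)" "\<not> unit (cross_ratio x y)"
    using x x01 y by (auto simp: unit_def v_cross_ratio v_divide)
  have w: "unit w" "red w = 1 - ?X"
    using x y by (simp_all add: w_def)
  have "tens_five x y \<doteq> tens 1 (res_sym x) - 0 + 0 - 0 + tens (1 * (1 - x)) (res_sym w)"
    by (rule tens_five_cong[OF tens_eq_refl tens_sp_zero tens_sp_zero tens_sp_zero])
      (use nu x01 in \<open>auto simp: w_def\<close>)
  also have "\<dots> = tens 1 (res_sym x) + tens (1 * (1 - x)) (res_sym w)"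
    by simp
  also have "\<dots> \<doteq> tens 1 (res_sym x + scale (red (1 - x)) (res_sym w))"
    by (rule tens_unit_combine) (use x in simp_all)
  also have "\<dots> \<doteq> 0"
  proof (rule tens_ker)
    have "res_sym x + scale (red (1 - x)) (res_sym w) =
        C_at ?X + scale (-1) (rp_elt (- (1 - ?X)) (1 - ?X) - rp_elt 1 (1 - ?X))"
      using x w x01 by (simp add: res_sym_def C_at_def scale_diff)
    also have "\<dots> \<in> rp_ker"
      using x x01 by (intro rp_ker_closed(4,5) C_at_in_rp_ker neg_in_rp_ker) auto
    finally show "res_sym x + scale (red (1 - x)) (res_sym w) \<in> rp_ker" .
  qed simp
  finally show ?thesis .
qed

text \<open>The surviving terms are \<open>[X] + <X>[1/X]\<close>, with \<open>X\<close> the residue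
  of \<open>x\<close>.\<close>

lemma tens_five_generic_one:
  assumes x: "unit x" "unit (1 - x)" "red x \<notin> {0, 1}"
    and y: "y \<notin> {0, 1}" "unit y" "red y = 1" "0 < v (1 - y)"
  shows "tens_five x y \<doteq> 0"
proof -
  have x01: "x \<notin> {0, 1}"
    using x by (auto simp: unit_def)
  have nu: "\<not> unit (cross_ratio x y)" "\<not> unit ((1 - x) / (1 - y))"
    using x x01 y by (auto simp: unit_def v_cross_ratio v_divide)
  have res_sym: "res_sym (y / x) = res_sym (inverse x)"
    using x y by (simp add: res_sym_def divide_inverse)
  have "tens_five x y \<doteq> tens 1 (res_sym x) - 0 + tens (1 * x) (res_sym (inverse x)) - 0 + 0"
    by (rule tens_five_cong[OF tens_eq_refl tens_sp_zero _ tens_sp_zero tens_sp_zero])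
      (use nu x01 y in \<open>auto simp: res_sym\<close>)
  also have "\<dots> = tens 1 (res_sym x) + tens (1 * x) (res_sym (inverse x))"
    by simp
  also have "\<dots> \<doteq> 0"
    by (rule tens_sp_phi) (use x01 in auto)
  finally show ?thesis .
qed

text \<open>Used through \<open>1 - x = x (1/x - 1)\<close>: for \<open>x\<close> with residue
  \<open>\<infinity>\<close> the factor \<open>1 - x\<close> is \<open>- x\<close> up to a unit of
  residue \<open>1\<close>.\<close>

lemma unit_at_infinity:
  assumes "x \<notin> {0, 1}" "v x < 0"
  shows "unit (inverse x - 1)" "red (inverse x - 1) = - 1"
proof -
  have pos: "0 < v (inverse x)"
    using assms by simp
  then have "v (1 - inverse x) = 0"
    using assms by (intro v_one_minus_pos) auto
  then have u: "unit (1 - inverse x)"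
    using assms by (auto simp: unit_def)
  have "red (1 - inverse x) = 1"
    using red_one_minus[of "inverse x"] red_eq_0_iff[of "inverse x"] pos by (simp add: less_imp_le)
  then show "unit (inverse x - 1)" "red (inverse x - 1) = - 1"
    using u unit_uminus[of "1 - inverse x"] red_unit_uminus[OF u] by simp_all
qed

text \<open>The surviving terms are \<open>[X] - <X (1 - X)>[1 - 1/X]\<close>, with \<open>X\<close>
  the residue of \<open>x\<close>. The coefficient is that of \<open>- (1 - 1/X)\<close> up to the
  square of \<open>X\<close>, so it fixes the symbol; what remains is \<open>psi_elt\<close> minus
  \<open>C_at\<close>.\<close>

lemma tens_five_generic_infinity:
  assumes x: "unit x" "unit (1 - x)" "red x \<notin> {0, 1}"
    and y: "y \<notin> {0, 1}" "v y < 0" "v (1 - y) = v y"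
  shows "tens_five x y \<doteq> 0"
proof -
  let ?X = "red x"
  define z where "z = cross_ratio x y"
  have x01: "x \<notin> {0, 1}" "?X \<noteq> 0" "1 - ?X \<noteq> 0"
    using x by (auto simp: unit_def)
  have nu: "\<not> unit y" "\<not> unit (y / x)" "\<not> unit ((1 - x) / (1 - y))"
    using x x01 y by (auto simp: unit_def v_divide)
  have z_eq: "z = ((1 - x) / x) / (inverse y - 1)"
    using x01 y by (auto simp: z_def cross_ratio_def divide_simps)
  have z: "unit z" "red z = ((1 - ?X) / ?X) / (- 1)"
    using x unit_at_infinity[OF y(1,2)] unfolding z_eq by simp_all
  then have z: "unit z" "red z = 1 - inverse ?X"
    using x01 by (simp_all add: field_simps)
  have "tens_five x y \<doteq> tens 1 (res_sym x) - 0 + 0 - tens (1 * (x * (1 - x))) (res_sym z) + 0"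
    by (rule tens_five_cong[OF tens_eq_refl tens_sp_zero tens_sp_zero _ tens_sp_zero])
      (use nu x01 in \<open>auto simp: z_def\<close>)
  also have "\<dots> = tens 1 (res_sym x) - tens (1 * (x * (1 - x))) (res_sym z)"
    by simp
  also have "\<dots> \<doteq> tens 1 (res_sym x - scale (red (x * (1 - x))) (res_sym z))"
    by (rule tens_unit_combine) (use x in simp_all)
  also have "\<dots> \<doteq> 0"
  proof (rule tens_ker)
    have c: "1 - inverse ?X \<noteq> 0" "1 - inverse ?X \<notin> {0, 1}"
      using x01 by auto
    have "rp_elt (?X * (1 - ?X)) t = rp_elt (- (1 - inverse ?X)) t" for t
      by (rule rp_elt_eqI[where z = ?X]) (use x01 c in \<open>auto simp: field_simps\<close>)
    then have "res_sym x - scale (red (x * (1 - x))) (res_sym z) = psi_elt ?X - C_at (1 - inverse ?X)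
        - (rp_elt (- (1 - inverse ?X)) (1 - inverse ?X) - rp_elt 1 (1 - inverse ?X))"
      using x z x01 by (simp add: res_sym_def C_at_def psi_elt_def)
    also have "\<dots> \<in> rp_ker"
      by (intro rp_ker_closed(2) psi_in_rp_ker C_at_in_rp_ker neg_in_rp_ker) (use x01 c in auto)
    finally show "res_sym x - scale (red (x * (1 - x))) (res_sym z) \<in> rp_ker" .
  qed simp
  finally show ?thesis .
qed

lemma cross_ratio_eq: "cross_ratio x y = (y / x) * ((1 - x) / (1 - y))"
  by (simp add: cross_ratio_def)

text \<open>The ratio \<open>y / x\<close> may have any valuation and any residue. The cross ratio
  is \<open>y / x\<close> times a unit of residue \<open>1\<close>, and \<open>1 - x\<close> has
  residue \<open>1\<close>, so the third and fourth terms cancel.\<close>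

lemma tens_five_zero_zero:
  assumes x: "x \<notin> {0, 1}" "0 < v x" "unit (1 - x)" "red (1 - x) = 1"
    and y: "y \<notin> {0, 1}" "0 < v y" "unit (1 - y)" "red (1 - y) = 1"
  shows "tens_five x y \<doteq> 0"
proof -
  have w: "unit ((1 - x) / (1 - y))" "red ((1 - x) / (1 - y)) = 1"
    using x y by simp_all
  have res_sym: "res_sym (cross_ratio x y) = res_sym (y / x)"
    unfolding cross_ratio_eq by (rule res_sym_cong[OF w]) (use x y in auto)
  have "tens_five x y \<doteq> 0 - 0 + tens x (res_sym (y / x)) - tens x (res_sym (y / x)) + 0"
  proof (rule tens_five_cong)
    show "tens (x * (1 - x)) (res_sym (cross_ratio x y)) \<doteq> tens x (res_sym (y / x))"
      unfolding res_sym by (rule tens_U1) (use x in auto)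
    show "tens (1 - x) (res_sym ((1 - x) / (1 - y))) \<doteq> 0"
      by (rule tens_sp_zero) (use x w in auto)
  qed (use x y in \<open>auto simp: unit_def intro!: tens_sp_zero\<close>)
  then show ?thesis
    by simp
qed

text \<open>The cross ratio is now \<open>(1 - x) / (1 - y)\<close> times a unit of residue
  \<open>1\<close>, so the fourth and fifth terms cancel.\<close>

lemma tens_five_one_one:
  assumes x: "x \<notin> {0, 1}" "unit x" "red x = 1" "0 < v (1 - x)"
    and y: "y \<notin> {0, 1}" "unit y" "red y = 1" "0 < v (1 - y)"
  shows "tens_five x y \<doteq> 0"
proof -
  let ?w = "(1 - x) / (1 - y)"
  have res_sym: "res_sym (cross_ratio x y) = res_sym ?w"
    unfolding cross_ratio_eq mult.commute[of "y / x"] by (rule res_sym_cong) (use x y in auto)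
  have "tens_five x y \<doteq> 0 - 0 + 0 - tens (1 - x) (res_sym ?w) + tens (1 - x) (res_sym ?w)"
  proof (rule tens_five_cong)
    show "tens (x * (1 - x)) (res_sym (cross_ratio x y)) \<doteq> tens (1 - x) (res_sym ?w)"
      unfolding res_sym mult.commute[of x] by (rule tens_U1) (use x in auto)
    show "tens x (res_sym (y / x)) \<doteq> 0"
      by (rule tens_sp_zero) (use x y in auto)
  qed (use x y in \<open>auto intro!: tens_sp_zero\<close>)
  then show ?thesis
    by simp
qed

text \<open>The cross ratio has residue \<open>1\<close>. As \<open>1 - x\<close> is
  \<open>- x\<close> up to a unit of residue \<open>1\<close>, the third and fifth terms form
  \<open><x>\<close> times the inversion relation at \<open>y / x\<close>.\<close>

lemma tens_five_infinity_infinity: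
  assumes x: "x \<notin> {0, 1}" "v x < 0" "v (1 - x) = v x"
    and y: "y \<notin> {0, 1}" "v y < 0" "v (1 - y) = v y"
  shows "tens_five x y \<doteq> 0"
proof -
  let ?u = "inverse x - 1" let ?t = "inverse y - 1"
  note u = unit_at_infinity[OF x(1,2)] and t = unit_at_infinity[OF y(1,2)]
  have nz: "x \<noteq> 0" "y \<noteq> 0" "1 - x \<noteq> 0" "1 - y \<noteq> 0" "?u \<noteq> 0" "?t \<noteq> 0"
    using x y u t by (auto simp: unit_def)
  have e: "1 - x = x * ?u" "1 - y = y * ?t"
    using nz by (simp_all add: algebra_simps)
  have "cross_ratio x y = ?u / ?t"
    unfolding cross_ratio_def e using nz by (simp del: right_minus_eq)
  then have z: "unit (cross_ratio x y)" "red (cross_ratio x y) = 1"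
    using u t by simp_all
  have w: "(1 - x) / (1 - y) = inverse (y / x) * (?u / ?t)"
    unfolding e using nz by (simp del: right_minus_eq)
  have res_sym: "res_sym ((1 - x) / (1 - y)) = res_sym (inverse (y / x))"
    unfolding w by (rule res_sym_cong) (use u t nz in auto)
  have sq: "tens (1 - x) (res_sym (inverse (y / x))) \<doteq> tens (x * (- 1)) (res_sym (inverse (y / x)))"
    unfolding e using tens_unit[of x ?u "res_sym (inverse (y / x))"]
      tens_eq_sym[OF tens_unit[of x "- 1" "res_sym (inverse (y / x))"]] u nz by (auto intro: tens_eq_trans)
  have "tens_five x y \<doteq> 0 - 0 + tens x (res_sym (y / x)) - 0 + tens (x * (- 1)) (res_sym (inverse (y / x)))"
  proof (rule tens_five_cong)
    show "tens (1 - x) (res_sym ((1 - x) / (1 - y))) \<doteq> tens (x * (- 1)) (res_sym (inverse (y / x)))"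
      unfolding res_sym by (rule sq)
    show "tens (x * (1 - x)) (res_sym (cross_ratio x y)) \<doteq> 0"
      by (rule tens_sp_zero) (use nz z in auto)
  qed (use x y in \<open>auto simp: unit_def intro!: tens_sp_zero\<close>)
  also have "\<dots> = tens x (res_sym (y / x)) + tens (x * (- 1)) (res_sym (inverse (y / x)))"
    by simp
  also have "\<dots> \<doteq> 0"
    by (rule tens_sp_psi) (use nz in auto)
  finally show ?thesis .
qed

text \<open>For two different residues among \<open>0, 1, \<infinity>\<close>, here and in the next
  two lemmas, the five terms vanish separately: each argument is a nonunit or has residue
  \<open>1\<close>.\<close>

lemma tens_five_zero_one:
  assumes x: "x \<notin> {0, 1}" "0 < v x" "unit (1 - x)" and y: "y \<notin> {0, 1}" "unit y" "red y = 1" "0 < v (1 - y)"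
  shows "tens_five x y \<doteq> 0"
proof -
  have "v (cross_ratio x y) < 0" "v ((1 - x) / (1 - y)) < 0" "v (y / x) < 0"
    using x y less_trans[of "- v x" 0 "v (1 - y)"] by (auto simp: v_cross_ratio v_divide unit_def)
  then show ?thesis
    by (intro tens_five_sum_zero tens_sp_zero) (use x y in \<open>auto simp: unit_def\<close>)
qed

lemma tens_five_zero_infinity:
  assumes x: "x \<notin> {0, 1}" "0 < v x" "unit (1 - x)" and y: "y \<notin> {0, 1}" "v y < 0" "v (1 - y) = v y"
  shows "tens_five x y \<doteq> 0"
proof -
  have "v (cross_ratio x y) < 0" "v ((1 - x) / (1 - y)) > 0" "v (y / x) < 0"
    using x y by (auto simp: v_cross_ratio v_divide unit_def)
  then show ?thesis
    by (intro tens_five_sum_zero tens_sp_zero) (use x y in \<open>auto simp: unit_def\<close>)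
qed

lemma tens_five_one_infinity:
  assumes x: "x \<notin> {0, 1}" "unit x" "red x = 1" "0 < v (1 - x)"
    and y: "y \<notin> {0, 1}" "v y < 0" "v (1 - y) = v y"
  shows "tens_five x y \<doteq> 0"
proof -
  have "v (cross_ratio x y) > 0" "v ((1 - x) / (1 - y)) > 0" "v (y / x) < 0"
    using x y less_trans[of "v y" 0 "v (1 - x)"] by (auto simp: v_cross_ratio v_divide unit_def)
  then show ?thesis
    by (intro tens_five_sum_zero tens_sp_zero) (use x y in \<open>auto simp: unit_def\<close>)
qed

text \<open>Of the sixteen pairs of residue types, the six below the diagonal follow from those
  above it by \<open>tens_five_swapD\<close>.\<close>

lemma tens_five_eq_zero:
  assumes x: "x \<notin> {0, 1}" and y: "y \<notin> {0, 1}"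
  shows "tens_five x y \<doteq> 0"
proof (use x in \<open>cases rule: residue_cases\<close>)
  case X: generic
  show ?thesis
  proof (use y in \<open>cases rule: residue_cases\<close>)
    case generic
    then show ?thesis using X by (intro tens_five_generic_generic)
  next
    case zero
    then show ?thesis using X y by (intro tens_five_generic_zero)
  next
    case one
    then show ?thesis using X y by (intro tens_five_generic_one)
  next
    case infinity
    then show ?thesis using X y by (intro tens_five_generic_infinity)
  qed
next
  case X: zero
  show ?thesis
  proof (use y in \<open>cases rule: residue_cases\<close>)
    case generic
    then show ?thesis using X x y by (intro tens_five_swapD[OF x y] tens_five_generic_zero)
  next
    case zero
    then show ?thesis using X x y by (intro tens_five_zero_zero)
  next
    case one
    then show ?thesis using X x y by (intro tens_five_zero_one)
  next
    case infinity
    then show ?thesis using X x y by (intro tens_five_zero_infinity)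
  qed
next
  case X: one
  show ?thesis
  proof (use y in \<open>cases rule: residue_cases\<close>)
    case generic
    then show ?thesis using X x y by (intro tens_five_swapD[OF x y] tens_five_generic_one)
  next
    case zero
    then show ?thesis using X x y by (intro tens_five_swapD[OF x y] tens_five_zero_one)
  next
    case one
    then show ?thesis using X x y by (intro tens_five_one_one)
  next
    case infinity
    then show ?thesis using X x y by (intro tens_five_one_infinity)
  qed
next
  case X: infinity
  show ?thesis
  proof (use y in \<open>cases rule: residue_cases\<close>)
    case generic
    then show ?thesis using X x y by (intro tens_five_swapD[OF x y] tens_five_generic_infinity)
  next
    case zero
    then show ?thesis using X x y by (intro tens_five_swapD[OF x y] tens_five_zero_infinity)
  next
    case one
    then show ?thesis using X x y by (intro tens_five_swapD[OF x y] tens_five_one_infinity)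
  next
    case infinity
    then show ?thesis using X x y by (intro tens_five_infinity_infinity)
  qed
qed

section \<open>Construction and uniqueness of the specialization map\<close>

sublocale Tm: presented_module "sq_ring TYPE('a)" "extend_scalars (unit_sq_ring v) unit_incl (sq_ring TYPE('a)) RPk"
  "carrier T.E" T.tensor_act "\<lambda>f. T.N #>\<^bsub>T.E\<^esub> f"
  by (rule T.presented_extend_scalars)

abbreviation IndT where "IndT \<equiv> Ind v red (RP_bar TYPE('k))"

lemma Ind_eq: "IndT = extend_scalars (unit_sq_ring v) unit_incl (sq_ring TYPE('a)) RPk"
  by (simp add: Ind_def)

definition tens_class where "tens_class f = T.N #>\<^bsub>T.E\<^esub> f"

lemma tens_class_eq_iff: "\<lbrakk>f \<in> carrier T.E; g \<in> carrier T.E\<rbrakk> \<Longrightarrow> tens_class f = tens_class g \<longleftrightarrow> f \<doteq> g"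
  unfolding tens_class_def tens_eq_def by (rule T.tensor_coset_eq_iff)

lemma tens_class_zero: "\<zero>\<^bsub>IndT\<^esub> = tens_class 0"
  unfolding Ind_eq tens_class_def by (rule Tm.proj_zero)

lemma tens_closed: "\<lbrakk>c \<noteq> 0; f \<in> rp_X\<rbrakk> \<Longrightarrow> tens c f \<in> carrier T.E"
  unfolding tens_def frag_of_in_free_Abelian_group by simp

text \<open>The class of \<open>Const\<close> vanishes in \<open>RP_bar\<close>, so \<open>0\<close>
  is its only possible image.\<close>

definition res_gen :: "'a rp_gen \<Rightarrow> 'k rp_gen \<Rightarrow> ('k set \<Rightarrow>\<^sub>0 int)" where
  "res_gen s = (case s of Sym x \<Rightarrow> res_sym x | Const \<Rightarrow> 0)"

text \<open>Maps between the quotients are studied through lifts to the free objects: \<open>sigma\<close> induces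
  \<open>S\<^sub>v\<close>, and \<open>tau\<close> below, built from the lifting map \<open>gamma\<close>, induces its inverse modulo \<open>L_sub v\<close>.\<close>

definition sigma where
  "sigma = free_extend (\<lambda>s. frag_extend (\<lambda>c. frag_of (frag_of c, rp_proj (res_gen s))))"

lemma sigma_rps [simp]: "sigma (rp_elt c x) = tens c (res_sym x)"
  by (simp add: sigma_def rp_elt_def tens_def sq_class_eq res_gen_def)

lemma sigma_const: "sigma (free_elt (sq_coset c) Const) = tens c 0"
  by (simp add: sigma_def tens_def sq_class_eq res_gen_def)

lemma sigma_zero [simp]: "sigma 0 = 0"
  by (simp add: sigma_def)

lemma sigma_diff: "\<lbrakk>f \<in> rp_X; g \<in> rp_X\<rbrakk> \<Longrightarrow> sigma (f - g) = sigma f - sigma g"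
  unfolding sigma_def rp_free_eq by (rule free_extend_diff) (rule frag_extend_diff)

lemma sigma_add:
  assumes "f \<in> rp_X" "g \<in> rp_X"
  shows "sigma (f + g) = sigma f + sigma g"
  using sigma_diff[of "f + g" g] free.X_add[OF assms] assms by (simp only: add_diff_cancel_right') simp

lemma sigma_closed: "f \<in> rp_X \<Longrightarrow> sigma f \<in> carrier T.E"
proof (induction rule: rp_induct)
  case zero
  show ?case unfolding sigma_zero by (rule Tm.X_zero)
next
  case (diff f g)
  then show ?case unfolding sigma_diff[OF diff(1,2)] by (intro Tm.X_diff)
next
  case (rp_elt c x)
  then show ?case unfolding sigma_rps by (intro tens_closed res_sym_closed)
next
  case (const c)
  then show ?case unfolding sigma_const by (intro tens_closed free.X_zero)
qed

lemma tensor_act_te: "\<lbrakk>c \<noteq> 0; d \<noteq> 0\<rbrakk> \<Longrightarrow> T.tensor_act (sq_class c) (tens d f) = tens (c * d) f"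
  unfolding tens_def T.tensor_act_of by (simp add: sq_ring_eq sq_class_eq)

lemma sigma_scale:
  assumes c: "c \<noteq> 0" and f: "f \<in> rp_X"
  shows "sigma (scale c f) = T.tensor_act (sq_class c) (sigma f)"
  using f
proof (induction rule: rp_induct)
  case (diff f g)
  show ?case
    unfolding scale_diff sigma_diff[OF diff(1,2)] T.tensor_act_diff
      sigma_diff[OF scale_closed[OF c diff(1)] scale_closed[OF c diff(2)]] diff(3,4) ..
next
  case (rp_elt d x)
  then show ?case
    using c by (simp add: tensor_act_te)
next
  case (const d)
  then show ?case
    using c by (simp add: tensor_act_te const_scale sigma_const)
next
  case zero
  show ?case
    by (simp only: scale_zero sigma_zero T.tensor_act_zero)
qed

lemma sigma_e5:
  assumes x: "x \<notin> {0, 1}" and y: "y \<notin> {0, 1}"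
  shows "sigma (five_elt x y) = tens_five x y"
proof -
  have nz: "x \<noteq> 0" "y \<noteq> 0" "1 - x \<noteq> 0" "1 - y \<noteq> 0"
    using x y by auto
  have cl: "rp_elt 1 x \<in> rp_X" "rp_elt 1 y \<in> rp_X" "rp_elt x (y / x) \<in> rp_X"
    "rp_elt (x * (1 - x)) ((1 - x) * y / (x * (1 - y))) \<in> rp_X" "rp_elt (1 - x) ((1 - x) / (1 - y)) \<in> rp_X"
    by (rule rp_elt_closed; use nz in simp)+
  show ?thesis
    unfolding five_elt_canonical[OF x y] tens_five_def cross_ratio_def
    by (simp only: sigma_add sigma_diff sigma_rps cl free.X_diff free.X_add)
qed

text \<open>The elements with image zero form an invariant set, so only the relations listed in
  \<open>rp_ker_subset\<close> have to be inspected. The five-term relation is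
  \<open>tens_five_eq_zero\<close>.\<close>

lemma sigma_ker:
  assumes "f \<in> rp_ker"
  shows "sigma f \<doteq> 0"
proof -
  define Z where "Z = {f \<in> rp_X. sigma f \<doteq> 0}"
  have "rp_ker \<subseteq> Z"
  proof (rule rp_ker_subset)
    show "rp_invariant Z"
    proof (rule rp_invariantI)
      show "Z \<subseteq> rp_X"
        by (auto simp: Z_def)
      show "0 \<in> Z"
        by (simp add: Z_def)
      show "f - g \<in> Z" if "f \<in> Z" "g \<in> Z" for f g
        using that tens_eq_diff[of "sigma f" 0 "sigma g" 0] by (simp add: Z_def sigma_diff)
      show "scale c f \<in> Z" if "c \<noteq> 0" "f \<in> Z" for c f
        using that T.tensor_act_kernel[of "sq_class c" "sigma f"]
        by (simp add: Z_def sigma_scale tens_eq_0_iff)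
    qed
    show "rp_elt 1 1 \<in> Z"
      using tens_sp_zero[of 1 1] by (simp add: Z_def)
    show "psi_elt x \<in> Z" if "x \<noteq> 0" for x
      using tens_sp_psi[of 1 x] that psi_elt_closed[OF that] by (simp add: Z_def psi_elt_def sigma_add)
    show "C_at x \<in> Z" if "x \<notin> {0, 1}" for x
      using tens_sp_c[OF that] that by (simp add: Z_def C_at_def sigma_add)
    show "five_elt x y \<in> Z" if "x \<notin> {0, 1}" "y \<notin> {0, 1}" for x y
      using that by (simp only: Z_def sigma_e5 tens_five_eq_zero five_elt_closed mem_Collect_eq simp_thms)
    show "free_elt (sq_coset 1) Const \<in> Z" if "card (UNIV :: 'a set) = 2"
      using that tens_zero[of 1] by (simp add: Z_def sigma_const const_closed)
  qed
  then show ?thesis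
    using assms by (auto simp: Z_def)
qed

lemma tensor_act_diff_left:
  assumes "r \<in> carrier (sq_ring TYPE('a))" "s \<in> carrier (sq_ring TYPE('a))" "f \<in> carrier T.E"
  shows "T.tensor_act (r - s) f \<doteq> T.tensor_act r f - T.tensor_act s f"
proof -
  have "r - s \<in> carrier (sq_ring TYPE('a))"
    using assms keys_diff[of r s] by (auto simp: sq_ring_eq)
  from T.tensor_act_add_left[OF this assms(2)] assms(3)
  have "T.tensor_act r f \<doteq> T.tensor_act (r - s) f + T.tensor_act s f"
    by (simp add: sq_ring_eq tens_eq_def)
  from tens_eq_sym[OF tens_eq_diff[OF this tens_eq_refl[of "T.tensor_act s f"]]] show ?thesis
    by (simp only: add_diff_cancel_right')
qed

text \<open>Exact for a single square class by \<open>sigma_scale\<close>. For integral combinations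
  it is only a congruence, because \<open>tensor_act\<close> is additive in the scalar only modulo
  the tensor relations.\<close>

lemma sigma_smult:
  assumes f: "f \<in> rp_X" and r: "r \<in> carrier (sq_ring TYPE('a))"
  shows "sigma (r \<odot>\<^bsub>rp_free TYPE('a)\<^esub> f) \<doteq> T.tensor_act r (sigma f)"
  using r
proof (induction rule: sq_ring_induct)
  case zero
  have 0: "0 \<in> carrier (sq_ring TYPE('a))"
    by (simp add: sq_ring_eq)
  \<comment> \<open>Even the action of the scalar \<open>0\<close> vanishes only modulo the tensor
    relations, since a pair with first entry \<open>0\<close> is a basis element.\<close>
  have "T.tensor_act (0 - 0) (sigma f) \<doteq> T.tensor_act 0 (sigma f) - T.tensor_act 0 (sigma f)"
    by (rule tensor_act_diff_left[OF 0 0 sigma_closed[OF f]])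
  then have "0 \<doteq> T.tensor_act 0 (sigma f)"
    unfolding diff_self by (rule tens_eq_sym)
  moreover have "0 \<odot>\<^bsub>rp_free TYPE('a)\<^esub> f = 0"
    unfolding rp_free_eq by (rule free_module_smult_zero)
  ultimately show ?case
    by (simp only: sigma_zero)
next
  case (sq_class c)
  show ?case
    using sigma_scale[OF sq_class f] unfolding scale_def by (simp only: tens_eq_refl)
next
  case (diff a b)
  have "sigma ((a - b) \<odot>\<^bsub>rp_free TYPE('a)\<^esub> f) = sigma (a \<odot>\<^bsub>rp_free TYPE('a)\<^esub> f) - sigma (b \<odot>\<^bsub>rp_free TYPE('a)\<^esub> f)"
    unfolding rp_free_eq free_module_smult_diff(2) unfolding rp_free_eq[symmetric]
    by (rule sigma_diff[OF free.act_closed[OF diff(1) f] free.act_closed[OF diff(2) f]])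
  also have "\<dots> \<doteq> T.tensor_act a (sigma f) - T.tensor_act b (sigma f)"
    by (rule tens_eq_diff[OF diff(3,4)])
  also have "\<dots> \<doteq> T.tensor_act (a - b) (sigma f)"
    by (rule tens_eq_sym[OF tensor_act_diff_left[OF diff(1,2) sigma_closed[OF f]]])
  finally show ?case .
qed

text \<open>The restriction to the carrier matches the extensionality demanded in
  \<open>specialization\<close>.\<close>

definition specialize where
  "specialize = restrict (\<lambda>X. tens_class (sigma (rp_rep X))) (carrier (RP_bar TYPE('a)))"

lemma specialize_proj:
  assumes f: "f \<in> rp_X"
  shows "specialize (rp_proj f) = tens_class (sigma f)"
proof -
  let ?g = "rp_rep (rp_proj f)"
  have g: "?g \<in> rp_X"
    using rp_rep f by blast
  have "sigma (?g - f) \<doteq> 0"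
    by (rule sigma_ker[OF rp_rep_proj[OF f]])
  then have "sigma ?g \<doteq> sigma f"
    unfolding sigma_diff[OF g f] by (simp add: tens_eq_def)
  then have "tens_class (sigma ?g) = tens_class (sigma f)"
    using tens_class_eq_iff[OF sigma_closed[OF g] sigma_closed[OF f]] by blast
  then show ?thesis
    using f by (simp add: specialize_def)
qed

lemma specialize_hom: "specialize \<in> module_hom (sq_ring TYPE('a)) (RP_bar TYPE('a)) IndT"
  unfolding module_hom_def
proof (intro CollectI conjI ballI funcsetI)
  fix x assume x: "x \<in> carrier (RP_bar TYPE('a))"
  then obtain f where f: "f \<in> rp_X" "x = rp_proj f"
    by (auto simp: RP_bar.carrier_eq)
  show "specialize x \<in> carrier IndT"
    unfolding f(2) specialize_proj[OF f(1)] Ind_eq tens_class_def by (rule Tm.proj_closed[OF sigma_closed[OF f(1)]])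
  show "specialize (x \<oplus>\<^bsub>RP_bar TYPE('a)\<^esub> y) = specialize x \<oplus>\<^bsub>IndT\<^esub> specialize y" if "y \<in> carrier (RP_bar TYPE('a))" for y
  proof -
    from that obtain g where g: "g \<in> rp_X" "y = rp_proj g"
      by (auto simp: RP_bar.carrier_eq)
    have "specialize (x \<oplus>\<^bsub>RP_bar TYPE('a)\<^esub> y) = tens_class (sigma f + sigma g)"
      unfolding f(2) g(2) RP_bar.proj_add[OF f(1) g(1)] specialize_proj[OF free.X_add[OF f(1) g(1)]]
      by (simp only: sigma_add f g)
    also have "\<dots> = specialize x \<oplus>\<^bsub>IndT\<^esub> specialize y"
      unfolding f(2) g(2) specialize_proj[OF f(1)] specialize_proj[OF g(1)] Ind_eq tens_class_def
      by (rule Tm.proj_add[symmetric]) (intro sigma_closed f g)+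
    finally show ?thesis .
  qed
next
  fix r x assume r: "r \<in> carrier (sq_ring TYPE('a))" and x: "x \<in> carrier (RP_bar TYPE('a))"
  then obtain f where f: "f \<in> rp_X" "x = rp_proj f"
    by (auto simp: RP_bar.carrier_eq)
  have rf: "r \<odot>\<^bsub>rp_free TYPE('a)\<^esub> f \<in> rp_X"
    by (rule free.act_closed[OF r f(1)])
  have "specialize (r \<odot>\<^bsub>RP_bar TYPE('a)\<^esub> x) = tens_class (sigma (r \<odot>\<^bsub>rp_free TYPE('a)\<^esub> f))"
    unfolding f(2) RP_bar.proj_smult[OF r f(1)] by (rule specialize_proj[OF rf])
  also have "\<dots> = tens_class (T.tensor_act r (sigma f))"
    using tens_class_eq_iff[OF sigma_closed[OF rf] Tm.act_closed[OF r sigma_closed[OF f(1)]]]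
      sigma_smult[OF f(1) r] by blast
  also have "\<dots> = r \<odot>\<^bsub>IndT\<^esub> specialize x"
    unfolding f(2) specialize_proj[OF f(1)] Ind_eq tens_class_def
    by (rule Tm.proj_smult[OF r sigma_closed[OF f(1)], symmetric])
  finally show "specialize (r \<odot>\<^bsub>RP_bar TYPE('a)\<^esub> x) = r \<odot>\<^bsub>IndT\<^esub> specialize x" .
qed

lemma module_Ind: "Module.module (sq_ring TYPE('a)) IndT"
  unfolding Ind_eq by (rule Tm.presented_is_module)

lemma specialize_rp_bar:
  assumes "a \<noteq> 0"
  shows "v a = 0 \<Longrightarrow> specialize (rp_bar a) = ind_one v red (RP_bar TYPE('k)) (rp_bar (red a))"
    "v a \<noteq> 0 \<Longrightarrow> specialize (rp_bar a) = \<zero>\<^bsub>IndT\<^esub>"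
proof -
  have s: "specialize (rp_bar a) = tens_class (tens 1 (res_sym a))"
    using assms by (simp add: rp_bar_eq specialize_proj)
  have one: "\<one>\<^bsub>sq_ring TYPE('a)\<^esub> = sq_class 1"
    by (simp add: sq_ring_eq sq_class_eq)
  show "specialize (rp_bar a) = ind_one v red (RP_bar TYPE('k)) (rp_bar (red a))" if "v a = 0"
  proof -
    have "res_sym a = rp_elt 1 (red a)"
      using that assms by (simp add: res_sym_def unit_def)
    then show ?thesis
      unfolding s unfolding ind_one_def tensor_elt_def tens_class_def tens_def rp_bar_eq one RPk_simps by (rule arg_cong)
  qed
  show "specialize (rp_bar a) = \<zero>\<^bsub>IndT\<^esub>" if "v a \<noteq> 0"
  proof -
    have "tens 1 (res_sym a) \<doteq> 0"
      by (rule tens_sp_zero) (use that in \<open>auto simp: unit_def\<close>)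
    then show ?thesis
      unfolding s tens_class_zero using tens_class_eq_iff[OF tens_closed[OF one_neq_zero res_sym_closed] Tm.X_zero] by blast
  qed
qed

text \<open>A second candidate agrees with \<open>specialize\<close> on a submodule that contains
  all symbols, and by \<open>rp_X_subset\<close> such a submodule is everything.\<close>

lemma specialization_eq: "specialization v red = specialize"
  unfolding specialization_def
proof (rule the_equality, intro conjI allI impI)
  show "specialize \<in> extensional (carrier (RP_bar TYPE('a)))"
    by (simp add: specialize_def)
next
  fix S
  assume S: "S \<in> extensional (carrier (RP_bar TYPE('a))) \<and>
     S \<in> module_hom (sq_ring TYPE('a)) (RP_bar TYPE('a)) IndT \<and>
     (\<forall>a. a \<noteq> 0 \<longrightarrow> v a = 0 \<longrightarrow> S (rp_bar a) = ind_one v red (RP_bar TYPE('k)) (rp_bar (red a))) \<and>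
     (\<forall>a. a \<noteq> 0 \<longrightarrow> v a \<noteq> 0 \<longrightarrow> S (rp_bar a) = \<zero>\<^bsub>IndT\<^esub>)"
  define H where "H = {x \<in> carrier (RP_bar TYPE('a)). S x = specialize x}"
  have H: "submodule H (sq_ring TYPE('a)) (RP_bar TYPE('a))"
    unfolding H_def by (rule submodule_equalizer[OF RP_bar.presented_is_module module_Ind _ specialize_hom]) (use S in blast)
  have "f \<in> {f \<in> rp_X. rp_proj f \<in> H}" if "f \<in> rp_X" for f
  proof (rule rp_X_subset[OF RP_bar.invariant_preimage[OF H] _ _ that])
    fix x :: 'a assume x: "x \<noteq> 0"
    then have "S (rp_bar x) = specialize (rp_bar x)"
      using S specialize_rp_bar[OF x] by (cases "v x = 0") auto
    then show "rp_elt 1 x \<in> {f \<in> rp_X. rp_proj f \<in> H}"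
      using x by (simp add: H_def rp_bar_eq)
  next
    show "rp_ker \<subseteq> {f \<in> rp_X. rp_proj f \<in> H}"
      using RP_bar.M.submodule_zero[OF H] by (auto simp: rp_ker_def)
  qed
  then have "S x = specialize x" if "x \<in> carrier (RP_bar TYPE('a))" for x
    using that by (auto simp: RP_bar.carrier_eq H_def)
  then show "S = specialize"
    using S by (intro extensionalityI[of _ "carrier (RP_bar TYPE('a))"]) (auto simp: specialize_def)
qed (use specialize_hom specialize_rp_bar in auto)

section \<open>The kernel of the specialization map\<close>

lemma submodule_L: "submodule (L_sub v) (sq_ring TYPE('a)) (RP_bar TYPE('a))"
  unfolding L_sub_def by (rule RP_bar.M.span_is_submodule) (auto simp: rp_bar_eq)

definition L_pre :: "('a rp_gen \<Rightarrow> ('a set \<Rightarrow>\<^sub>0 int)) set" where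
  "L_pre = {f \<in> rp_X. rp_proj f \<in> L_sub v}"

lemma L_pre_invariant: "rp_invariant L_pre"
  unfolding L_pre_def by (rule RP_bar.invariant_preimage[OF submodule_L])

lemmas L_closed = rp_invariantD[OF L_pre_invariant]

lemma rp_ker_L: "f \<in> rp_ker \<Longrightarrow> f \<in> L_pre"
  using RP_bar.M.submodule_zero[OF submodule_L] by (auto simp: L_pre_def rp_ker_def)

lemma rp_elt_L: "\<lbrakk>c \<noteq> 0; x \<noteq> 0; v x \<noteq> 0\<rbrakk> \<Longrightarrow> rp_elt c x \<in> L_pre"
proof -
  assume c: "c \<noteq> 0" and x: "x \<noteq> 0" "v x \<noteq> 0"
  have "rp_bar x \<in> L_sub v"
    unfolding L_sub_def by (rule subsetD[OF RP_bar.M.subset_span]) (use x in blast)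
  then have "rp_elt 1 x \<in> L_pre"
    using x by (simp add: L_pre_def rp_bar_eq)
  from L_closed(5)[OF c this] show ?thesis
    using c by simp
qed

definition L_eq (infix \<open>\<triangleq>\<close> 50) where "f \<triangleq> g \<longleftrightarrow> f - g \<in> L_pre"

lemma L_eq_refl [simp]: "f \<triangleq> f"
  unfolding L_eq_def diff_self by (rule L_closed(1))

lemma L_eq_sym: "f \<triangleq> g \<Longrightarrow> g \<triangleq> f"
  unfolding L_eq_def using L_closed(3)[of "f - g"] by (simp only: minus_diff_eq)

lemma L_eq_trans [trans]: "f \<triangleq> g \<Longrightarrow> g \<triangleq> h \<Longrightarrow> f \<triangleq> h"
proof -
  have e: "f - h = (f - g) + (g - h)"
    by (simp only: add_diff_eq diff_add_cancel)
  show "f \<triangleq> g \<Longrightarrow> g \<triangleq> h \<Longrightarrow> f \<triangleq> h"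
    unfolding L_eq_def e by (rule L_closed(4))
qed

lemma L_eq_eq_trans [trans]: "f \<triangleq> g \<Longrightarrow> g = h \<Longrightarrow> f \<triangleq> h" "f = g \<Longrightarrow> g \<triangleq> h \<Longrightarrow> f \<triangleq> h"
  by (simp_all only:)

lemma L_eq_diff: "f \<triangleq> g \<Longrightarrow> f' \<triangleq> g' \<Longrightarrow> f - f' \<triangleq> g - g'"
proof -
  have e: "(f - f') - (g - g') = (f - g) - (f' - g')"
    by (simp only: algebra_simps)
  show "f \<triangleq> g \<Longrightarrow> f' \<triangleq> g' \<Longrightarrow> f - f' \<triangleq> g - g'"
    unfolding L_eq_def e by (rule L_closed(2))
qed

lemma L_eq_add: "f \<triangleq> g \<Longrightarrow> f' \<triangleq> g' \<Longrightarrow> f + f' \<triangleq> g + g'"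
proof -
  have e: "(f + f') - (g + g') = (f - g) + (f' - g')"
    by (simp only: algebra_simps)
  show "f \<triangleq> g \<Longrightarrow> f' \<triangleq> g' \<Longrightarrow> f + f' \<triangleq> g + g'"
    unfolding L_eq_def e by (rule L_closed(4))
qed

lemma L_eq_scale: "c \<noteq> 0 \<Longrightarrow> f \<triangleq> g \<Longrightarrow> scale c f \<triangleq> scale c g"
  unfolding L_eq_def scale_diff[symmetric] by (rule L_closed(5))

lemma L_eq_mem_iff: "f \<triangleq> g \<Longrightarrow> f \<in> L_pre \<longleftrightarrow> g \<in> L_pre"
  unfolding L_eq_def using L_closed(2)[of f "f - g"] L_closed(4)[of "f - g" g]
  by (auto simp only: diff_add_cancel diff_diff_eq2 add_diff_cancel_left')

lemma L_eq_ker: "f - g \<in> rp_ker \<Longrightarrow> f \<triangleq> g"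
  unfolding L_eq_def by (rule rp_ker_L)

lemma L_eq_0: "f \<in> L_pre \<Longrightarrow> f \<triangleq> 0"
  by (simp only: L_eq_def diff_zero)

lemma rp_elt_one_unit_L:
  assumes u: "unit u" "red u = 1" and c: "c \<noteq> 0"
  shows "rp_elt c u \<in> L_pre"
proof -
  have "rp_elt 1 u \<in> L_pre"
  proof (cases "u = 1")
    case True
    then show ?thesis
      using rp_ker_L[OF one_in_rp_ker] by simp
  next
    case False
    have "0 \<le> v (1 - u)"
      using u False v_one_minus_unit[of u] by (simp add: unit_def)
    then have "0 < v (1 - u)"
      using red_eq_0_iff[of "1 - u"] u False by simp
    \<comment> \<open>In \<open>[u] + <-1>[1 - u] = 0\<close> the second symbol has an argument of
      positive valuation, so the first lies in \<open>L\<close> as well.\<close>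
    then have "rp_elt (- 1) (1 - u) \<in> L_pre"
      using False by (intro rp_elt_L) auto
    moreover have "C_at u \<in> L_pre"
      using u False by (intro rp_ker_L C_at_in_rp_ker) (auto simp: unit_def)
    ultimately have "C_at u - rp_elt (- 1) (1 - u) \<in> L_pre"
      by (intro L_closed(2))
    then show ?thesis
      by (simp only: C_at_def add_diff_cancel_right')
  qed
  from L_closed(5)[OF c this] show ?thesis
    using c by simp
qed

text \<open>The five-term relation at \<open>(x, 1 - 1 / u)\<close>, three of whose terms have nonzero valuation.\<close>

lemma five_term_U1:
  assumes x: "unit x" "unit (1 - x)" "red x \<notin> {0, 1}" and u: "unit u" "red u = 1" "u \<noteq> 1"
  shows "rp_elt 1 x + rp_elt (1 - x) ((1 - x) * u) \<in> L_pre"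
proof -
  define y where "y = 1 - inverse u"
  have nz: "x \<noteq> 0" "1 - x \<noteq> 0" "u \<noteq> 0"
    using x u by (auto simp: unit_def)
  have y: "y \<notin> {0, 1}" "1 - y = inverse u"
    using u nz by (auto simp: y_def)
  have uy: "unit (1 - y)"
    using u by (simp add: y)
  have "red y = 0" "0 \<le> v y"
    using u y v_one_minus_unit[of "inverse u"] by (simp_all add: y_def unit_def)
  then have vy: "0 < v y"
    using red_eq_0_iff[of y] y by simp
  have x01: "x \<notin> {0, 1}"
    using nz by auto
  have "rp_elt 1 x + rp_elt (1 - x) ((1 - x) * u) =
      five_elt x y + rp_elt 1 y - rp_elt x (y / x) + rp_elt (x * (1 - x)) (cross_ratio x y)"
    unfolding five_elt_canonical[OF x01 y(1)] cross_ratio_def y(2) using nz by (simp add: divide_inverse)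
  also have "\<dots> \<in> L_pre"
  proof (intro L_closed(2,4))
    show "five_elt x y \<in> L_pre"
      by (rule rp_ker_L[OF five_elt_in_rp_ker[OF x01 y(1)]])
    show "rp_elt 1 y \<in> L_pre"
      by (rule rp_elt_L) (use y vy in auto)
    show "rp_elt x (y / x) \<in> L_pre"
      by (rule rp_elt_L) (use x y vy nz in \<open>auto simp: v_divide unit_def\<close>)
    have "v (cross_ratio x y) = v y"
      using x uy by (simp add: v_cross_ratio[OF x01 y(1)] unit_def)
    then show "rp_elt (x * (1 - x)) (cross_ratio x y) \<in> L_pre"
      by (intro rp_elt_L) (use y vy nz in \<open>auto simp: cross_ratio_def\<close>)
  qed
  finally show ?thesis .
qed

lemma rp_elt_mult_U1:
  assumes x: "unit x" and u: "unit u" "red u = 1"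
  shows "rp_elt 1 (x * u) \<triangleq> rp_elt 1 x"
proof -
  consider "u = 1" | "red x = 1" | "u \<noteq> 1" "red x \<noteq> 1"
    by blast
  then show ?thesis
  proof cases
    case 1
    then show ?thesis by simp
  next
    case 2
    \<comment> \<open>If \<open>x\<close> has residue \<open>1\<close>, then \<open>1 - x\<close> is
      not a unit and \<open>five_term_U1\<close> is out of reach, but both symbols lie in
      \<open>L\<close>.\<close>
    then have "rp_elt 1 (x * u) \<in> L_pre" "rp_elt 1 x \<in> L_pre"
      using x u by (intro rp_elt_one_unit_L; simp)+
    then show ?thesis
      unfolding L_eq_def by (rule L_closed(2))
  next
    case 3
    have "red (1 - x) \<noteq> 0"
      using 3 x by simp
    moreover have "x \<noteq> 1"
      using 3 by auto
    ultimately have x': "unit (1 - x)"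
      using v_one_minus_unit[of x] red_eq_0_iff[of "1 - x"] x by (auto simp: unit_def)
    have nz: "x \<noteq> 0" "x \<notin> {0, 1}" "u \<noteq> 0"
      using x u \<open>x \<noteq> 1\<close> by (auto simp: unit_def)
    \<comment> \<open>Taken at \<open>1 - x\<close>, so that the perturbed argument is
      \<open>x * u\<close>. Multiplication by \<open><x>\<close> then removes its
      coefficient.\<close>
    have "rp_elt 1 (1 - x) + rp_elt x (x * u) \<in> L_pre"
      using five_term_U1[of "1 - x" u] x x' u 3 by simp
    then have "scale x (rp_elt 1 (1 - x) + rp_elt x (x * u)) \<in> L_pre"
      using nz by (intro L_closed(5))
    moreover have "rp_elt (x * x) t = rp_elt 1 t" for t
      by (rule rp_elt_eqI[where z = x]) (use nz in auto)
    ultimately have 1: "rp_elt x (1 - x) + rp_elt 1 (x * u) \<in> L_pre"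
      using nz by (simp add: scale_add)
    have 2: "scale (- x) (C_at x) \<in> L_pre"
      by (intro L_closed(5) rp_ker_L C_at_in_rp_ker) (use nz in auto)
    have 3: "rp_elt (- x) x - rp_elt 1 x \<in> L_pre"
      by (intro rp_ker_L neg_in_rp_ker) (use nz in auto)
    have "rp_elt 1 (x * u) - rp_elt 1 x = (rp_elt x (1 - x) + rp_elt 1 (x * u)) - scale (- x) (C_at x) + (rp_elt (- x) x - rp_elt 1 x)"
      using nz by (simp add: C_at_def scale_add)
    also have "\<dots> \<in> L_pre"
      by (intro L_closed(2)[of "_ + _" "scale _ _"] L_closed(4)[of "_ - _"] 1 2 3)
    finally show ?thesis
      unfolding L_eq_def .
  qed
qed

lemma rp_elt_scale_U1:
  assumes x: "unit x" and u: "unit u" "red u = 1"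
  shows "rp_elt u x \<triangleq> rp_elt 1 x"
proof -
  have nz: "x \<noteq> 0" "u \<noteq> 0" "- (x * u) \<noteq> 0"
    using x u by (auto simp: unit_def)
  have neg: "rp_elt (- a) a \<triangleq> rp_elt 1 a" if "a \<noteq> 0" for a
    by (rule L_eq_ker[OF neg_in_rp_ker[OF that]])
  have "rp_elt u x \<triangleq> rp_elt (- (x * u)) x"
    using L_eq_sym[OF L_eq_scale[OF nz(2) neg[OF nz(1)]]] nz by (simp add: mult_ac)
  also have "\<dots> \<triangleq> rp_elt (- (x * u)) (x * u)"
    using L_eq_sym[OF L_eq_scale[OF nz(3) rp_elt_mult_U1[OF x u]]] nz by simp
  also have "\<dots> \<triangleq> rp_elt 1 (x * u)"
    by (rule neg) (use nz in simp)
  also have "\<dots> \<triangleq> rp_elt 1 x"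
    by (rule rp_elt_mult_U1[OF x u])
  finally show ?thesis .
qed

text \<open>A square root of the ratio of the residues lifts to a unit \<open>w\<close>, and then
  \<open>c\<close> equals \<open>c'\<close> times the square of \<open>w\<close> times a unit of
  residue \<open>1\<close>. The square is invisible, and units of residue \<open>1\<close> act
  trivially modulo \<open>L\<close>.\<close>

lemma rp_elt_residue_cong:
  assumes c: "unit c" "unit c'" "sq_coset (red c) = sq_coset (red c')"
    and x: "unit x" "unit x'" "red x = red x'"
  shows "rp_elt c x \<triangleq> rp_elt c' x'"
proof -
  obtain z where z: "z \<noteq> 0" "red c = red c' * (z * z)"
    using sq_coset_eqD[OF c(3)] .
  obtain w where w: "unit w" "red w = z"
    using red_unit_surj[OF z(1)] .
  define u where "u = c / (c' * (w * w))"
  have nz: "c \<noteq> 0" "c' \<noteq> 0" "w \<noteq> 0" "x \<noteq> 0" "x' \<noteq> 0"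
    using c x w by (auto simp: unit_def)
  have u: "unit u" "red u = 1"
    using c z w by (simp_all add: u_def)
  have "rp_elt c x = rp_elt (c' * u) x"
    by (rule rp_elt_eqI[where z = w]) (use nz in \<open>simp_all add: u_def\<close>)
  also have "\<dots> \<triangleq> rp_elt c' x"
    using L_eq_scale[OF nz(2) rp_elt_scale_U1[OF x(1) u]] nz u by (simp add: unit_nonzero)
  also have "\<dots> = rp_elt c' (x' * (x / x'))"
    using nz by simp
  also have "\<dots> \<triangleq> rp_elt c' x'"
    using L_eq_scale[OF nz(2) rp_elt_mult_U1[OF x(2), of "x / x'"]] nz x by simp
  finally show ?thesis .
qed

section \<open>The lifting map and the inverse modulo L\<close>

definition lift :: "'k \<Rightarrow> 'a" where
  "lift b = (SOME a. unit a \<and> red a = b)"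

definition lift_class :: "'k set \<Rightarrow> 'a" where
  "lift_class C = (SOME c. unit c \<and> sq_coset (red c) = C)"

lemma lift:
  assumes "b \<noteq> 0"
  shows "unit (lift b)" "red (lift b) = b"
proof -
  obtain a where "unit a" "red a = b"
    using red_unit_surj[OF assms] .
  then have "unit a \<and> red a = b" ..
  from someI[of "\<lambda>a. unit a \<and> red a = b", OF this] show "unit (lift b)" "red (lift b) = b"
    by (simp_all add: lift_def)
qed

lemma lift_class:
  assumes "b \<noteq> 0"
  shows "unit (lift_class (sq_coset b))" "sq_coset (red (lift_class (sq_coset b))) = sq_coset b"
proof -
  obtain a where "unit a" "red a = b"
    using red_unit_surj[OF assms] .
  then have "unit a \<and> sq_coset (red a) = sq_coset b"
    by simp
  from someI[of "\<lambda>a. unit a \<and> sq_coset (red a) = sq_coset b", OF this]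
  show "unit (lift_class (sq_coset b))" "sq_coset (red (lift_class (sq_coset b))) = sq_coset b"
    by (simp_all add: lift_class_def)
qed

text \<open>The choices in \<open>lift\<close> and \<open>lift_class\<close> are unrelated to
  products, so \<open>gamma\<close> is additive but compatible with square classes only modulo
  \<open>L_pre\<close>.\<close>

definition gamma :: "('k rp_gen \<Rightarrow> ('k set \<Rightarrow>\<^sub>0 int)) \<Rightarrow> ('a rp_gen \<Rightarrow> ('a set \<Rightarrow>\<^sub>0 int))" where
  "gamma = free_extend (\<lambda>s r. case s of
     Sym b \<Rightarrow> (\<lambda>t. if t = Sym (lift b) then frag_extend (\<lambda>C. frag_of (sq_coset (lift_class C))) r else 0)
   | Const \<Rightarrow> 0)"

lemma gamma_rps: "gamma (rp_elt b x) = rp_elt (lift_class (sq_coset b)) (lift x)"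
  unfolding gamma_def rp_elt_def free_extend_free_elt rp_gen.case frag_extend_of
  unfolding free_elt_def ..

lemma gamma_const: "gamma (free_elt c Const) = 0"
  unfolding gamma_def free_extend_free_elt by (simp only: rp_gen.case)

lemma gamma_zero: "gamma 0 = 0"
  unfolding gamma_def by (rule free_extend_zero)

lemma gamma_diff: "\<lbrakk>f \<in> rp_X; g \<in> rp_X\<rbrakk> \<Longrightarrow> gamma (f - g) = gamma f - gamma g"
  unfolding gamma_def rp_free_eq
  by (rule free_extend_diff) (auto simp: fun_eq_iff frag_extend_diff split: rp_gen.split)

lemma gamma_add:
  assumes "f \<in> rp_X" "g \<in> rp_X"
  shows "gamma (f + g) = gamma f + gamma g"
  using gamma_diff[OF free.X_add[OF assms] assms(2)] by (simp only: add_diff_cancel_right' diff_add_cancel)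

lemma gamma_closed: "f \<in> rp_X \<Longrightarrow> gamma f \<in> rp_X"
proof (induction rule: rp_induct)
  case zero
  show ?case unfolding gamma_zero by (rule free.X_zero)
next
  case (diff f g)
  show ?case unfolding gamma_diff[OF diff(1,2)] by (rule free.X_diff[OF diff(3,4)])
next
  case (rp_elt c x)
  show ?case unfolding gamma_rps
    using lift_class(1)[OF rp_elt(1)] lift(1)[OF rp_elt(2)] by (intro rp_elt_closed unit_nonzero)
next
  case (const c)
  show ?case unfolding gamma_const by (rule free.X_zero)
qed

lemma gamma_rps_red:
  assumes "unit c" "unit x"
  shows "gamma (rp_elt (red c) (red x)) \<triangleq> rp_elt c x"
  unfolding gamma_rps
  using lift_class[of "red c"] lift[of "red x"] assms by (intro rp_elt_residue_cong) simp_all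

text \<open>On a generator both sides are congruent to one symbol over \<open>F\<close> with unit
  coefficient and argument, since \<open>L_pre\<close> identifies all lifts of the same
  residues.\<close>

lemma gamma_scale:
  assumes u: "unit u" and f: "f \<in> rp_X"
  shows "gamma (scale (red u) f) \<triangleq> scale u (gamma f)"
  using f
proof (induction rule: rp_induct)
  case zero
  show ?case
    by (simp only: scale_zero gamma_zero L_eq_refl)
next
  case (diff f g)
  note cl = scale_closed[OF red_unit_nonzero[OF u] diff(1)] scale_closed[OF red_unit_nonzero[OF u] diff(2)]
  show ?case
    unfolding scale_diff gamma_diff[OF diff(1,2)] gamma_diff[OF cl] by (rule L_eq_diff[OF diff(3,4)])
next
  case (rp_elt b y)
  obtain c where c: "unit c" "red c = b"
    using red_unit_surj[OF rp_elt(1)] .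
  obtain x where x: "unit x" "red x = y"
    using red_unit_surj[OF rp_elt(2)] .
  have "gamma (scale (red u) (rp_elt b y)) = gamma (rp_elt (red (u * c)) (red x))"
    using u c x rp_elt by simp
  also have "\<dots> \<triangleq> rp_elt (u * c) x"
    by (rule gamma_rps_red) (use u c x in simp_all)
  also have "\<dots> = scale u (rp_elt c x)"
    using u c by (simp add: unit_nonzero)
  also have "\<dots> \<triangleq> scale u (gamma (rp_elt b y))"
    using L_eq_scale[OF unit_nonzero[OF u] L_eq_sym[OF gamma_rps_red[OF c(1) x(1)]]]
    unfolding c(2) x(2) .
  finally show ?case .
next
  case (const c)
  show ?case
    unfolding const_scale[OF red_unit_nonzero[OF u] const(1)] gamma_const scale_zero by (rule L_eq_refl)
qed

text \<open>Each relation over \<open>k\<close> is the reduction of the relation of the same shape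
  over \<open>F\<close> at lifted arguments, and \<open>gamma\<close> sends it to something
  congruent to that relation.\<close>

lemma gamma_ker:
  assumes "f \<in> rp_ker"
  shows "gamma f \<in> L_pre"
proof -
  define Z where "Z = {f \<in> rp_X. gamma f \<in> L_pre}"
  have ZI: "f \<in> Z" if "f \<in> rp_X" "gamma f \<triangleq> g" "g \<in> rp_ker" for f g
    using that L_eq_mem_iff[OF that(2)] rp_ker_L by (simp add: Z_def)
  have one: "gamma (rp_elt 1 (red x)) \<triangleq> rp_elt 1 x" "gamma (rp_elt (- 1) (red x)) \<triangleq> rp_elt (- 1) x" if "unit x" for x
    using gamma_rps_red[of 1 x] gamma_rps_red[of "- 1" x] that by simp_all
  have "rp_ker \<subseteq> Z"
  proof (rule rp_ker_subset)
    show "rp_invariant Z"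
    proof (rule rp_invariantI)
      show "Z \<subseteq> rp_X"
        by (auto simp: Z_def)
      show "0 \<in> Z"
        unfolding Z_def mem_Collect_eq gamma_zero using L_closed(1) free.X_zero by (rule conjI[rotated])
      show "f - g \<in> Z" if "f \<in> Z" "g \<in> Z" for f g
        using that unfolding Z_def mem_Collect_eq
        by (simp only: gamma_diff free.X_diff L_closed(2) simp_thms)
      show "scale b f \<in> Z" if b: "b \<noteq> 0" and f: "f \<in> Z" for b f
      proof -
        obtain c where c: "unit c" "red c = b"
          using red_unit_surj[OF b] .
        have f: "f \<in> rp_X" "gamma f \<in> L_pre"
          using f by (simp_all add: Z_def)
        have "gamma (scale b f) \<in> L_pre"
          using L_eq_mem_iff[OF gamma_scale[OF c(1) f(1)]] L_closed(5)[OF unit_nonzero[OF c(1)] f(2)]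
          unfolding c(2) by blast
        then show ?thesis
          using f b by (simp add: Z_def)
      qed
    qed
    show "rp_elt 1 1 \<in> Z"
      by (rule ZI[OF _ _ one_in_rp_ker]) (use one(1)[of 1] in simp_all)
    show "psi_elt b \<in> Z" if b: "b \<noteq> 0" for b
    proof -
      obtain x where x: "unit x" "red x = b"
        using red_unit_surj[OF b] .
      have "gamma (psi_elt (red x)) \<triangleq> psi_elt x"
        using L_eq_add[OF one(1)[of x] one(2)[of "inverse x"]] x b
        by (simp add: psi_elt_def gamma_add)
      then show ?thesis
        unfolding x(2) by (rule ZI[OF psi_elt_closed[OF b] _ psi_in_rp_ker[OF unit_nonzero[OF x(1)]]])
    qed
    \<comment> \<open>With both \<open>x\<close> and \<open>1 - x\<close> units, all coefficients
      and arguments of the lifted relations are units, so \<open>gamma_rps_red\<close> applies term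
      by term.\<close>
    have lift01: "\<exists>x. unit x \<and> unit (1 - x) \<and> red x = b \<and> x \<notin> {0, 1}" if b: "b \<notin> {0, 1}" for b
    proof -
      from b have "b \<noteq> 0" by simp
      then obtain x where x: "unit x" "red x = b"
        by (rule red_unit_surj)
      have "x \<notin> {0, 1}"
        using x b by (auto simp: unit_def)
      then have "unit (1 - x)"
        by (cases rule: residue_cases) (use x b in \<open>auto simp: unit_def\<close>)
      then show ?thesis
        using x \<open>x \<notin> {0, 1}\<close> by blast
    qed
    show "C_at b \<in> Z" if b: "b \<notin> {0, 1}" for b
    proof -
      obtain x where x: "unit x" "unit (1 - x)" "red x = b" "x \<notin> {0, 1}"
        using lift01[OF b] by blast
      have cl: "rp_elt 1 (red x) \<in> rp_X" "rp_elt (- 1) (red (1 - x)) \<in> rp_X"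
        by (rule rp_elt_closed[OF _ red_unit_nonzero[OF x(1)]], simp)
          (rule rp_elt_closed[OF _ red_unit_nonzero[OF x(2)]], simp)
      have e: "C_at (red x) = rp_elt 1 (red x) + rp_elt (- 1) (red (1 - x))"
        using x by (simp add: C_at_def)
      have "gamma (C_at (red x)) \<triangleq> C_at x"
        unfolding e gamma_add[OF cl] unfolding C_at_def by (rule L_eq_add[OF one(1)[OF x(1)] one(2)[OF x(2)]])
      moreover have "C_at (red x) \<in> rp_X"
        unfolding e by (rule free.X_add[OF cl])
      ultimately show ?thesis
        unfolding x(3) by (intro ZI[OF _ _ C_at_in_rp_ker[OF x(4)]])
    qed
    show "five_elt a b \<in> Z" if a: "a \<notin> {0, 1}" and b: "b \<notin> {0, 1}" for a b
    proof -
      obtain x where x: "unit x" "unit (1 - x)" "red x = a" "x \<notin> {0, 1}"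
        using lift01[OF a] by blast
      obtain y where y: "unit y" "unit (1 - y)" "red y = b" "y \<notin> {0, 1}"
        using lift01[OF b] by blast
      let ?z = "((1 - x) * y) / (x * (1 - y))" let ?w = "(1 - x) / (1 - y)"
      have u: "unit (y / x)" "unit (x * (1 - x))" "unit ?z" "unit ?w"
        using x y by simp_all
      have r: "red (y / x) = b / a" "red (x * (1 - x)) = a * (1 - a)" "red (1 - x) = 1 - a"
        "red ?z = ((1 - a) * b) / (a * (1 - b))" "red ?w = (1 - a) / (1 - b)"
        using x y by simp_all
      note g = gamma_rps_red[OF unit_one x(1), unfolded red_one x(3)]
        gamma_rps_red[OF unit_one y(1), unfolded red_one y(3)]
        gamma_rps_red[OF x(1) u(1), unfolded x(3) r] gamma_rps_red[OF u(2,3), unfolded r]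
        gamma_rps_red[OF x(2) u(4), unfolded r]
      have cl: "rp_elt 1 a \<in> rp_X" "rp_elt 1 b \<in> rp_X" "rp_elt a (b / a) \<in> rp_X"
        "rp_elt (a * (1 - a)) ((1 - a) * b / (a * (1 - b))) \<in> rp_X" "rp_elt (1 - a) ((1 - a) / (1 - b)) \<in> rp_X"
        by (rule rp_elt_closed; use a b in simp)+
      have "gamma (five_elt a b) \<triangleq> five_elt x y"
        unfolding five_elt_canonical[OF a b] five_elt_canonical[OF x(4) y(4)]
        by (simp only: gamma_add gamma_diff cl free.X_diff free.X_add)
          (rule L_eq_add[OF L_eq_diff[OF L_eq_add[OF L_eq_diff[OF g(1,2)] g(3)] g(4)] g(5)])
      then show ?thesis
        by (rule ZI[OF five_elt_closed[OF a b] _ five_elt_in_rp_ker[OF x(4) y(4)]])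
    qed
    show "free_elt (sq_coset 1) Const \<in> Z" if "card (UNIV :: 'k set) = 2"
      using const_closed[OF that one_neq_zero] L_closed(1)
      by (simp only: Z_def mem_Collect_eq gamma_const simp_thms)
  qed
  then show ?thesis
    using assms by (auto simp: Z_def)
qed

lemma gamma_cong:
  assumes "f \<in> rp_X" "g \<in> rp_X" "f - g \<in> rp_ker"
  shows "gamma f \<triangleq> gamma g"
  using gamma_ker[OF assms(3)] unfolding gamma_diff[OF assms(1,2)] L_eq_def .

lemma gamma_rep: "f \<in> rp_X \<Longrightarrow> gamma (rp_rep (rp_proj f)) \<triangleq> gamma f"
  by (rule gamma_cong[OF rp_rep(1)[OF RP_bar.proj_closed] _ rp_rep_proj])

text \<open>Induced by sending \<open>(r, m)\<close> to \<open>r\<close> times \<open>gamma\<close>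
  of a representative of \<open>m\<close>. The definition is pointwise in \<open>t\<close> because
  \<open>frag_extend\<close> takes values in finitely supported functions, not in functions into
  them.\<close>

definition tau where
  "tau e = (\<lambda>t. frag_extend (\<lambda>(r, m). (r \<odot>\<^bsub>rp_free TYPE('a)\<^esub> gamma (rp_rep m)) t) e)"

lemma tau_zero: "tau 0 = 0"
  by (simp add: tau_def zero_fun_def)

lemma tau_diff: "tau (e - e') = tau e - tau e'"
  by (simp add: tau_def fun_eq_iff frag_extend_diff)

lemma tau_of: "tau (frag_of (r, m)) = r \<odot>\<^bsub>rp_free TYPE('a)\<^esub> gamma (rp_rep m)"
  by (simp add: tau_def)

text \<open>For one square class of units this is \<open>gamma_scale\<close>, and both sides are
  additive in \<open>a\<close>. It makes \<open>tau\<close> respect the balancing relation.\<close>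

lemma gamma_balanced:
  assumes a: "a \<in> carrier (unit_sq_ring v)" and f: "f \<in> rp_X"
  shows "unit_incl a \<odot>\<^bsub>rp_free TYPE('a)\<^esub> gamma f \<triangleq> gamma (unit_red red a \<odot>\<^bsub>rp_free TYPE('k)\<^esub> f)"
proof (rule free_Abelian_group_induct[where S = "unit_coset ` {u. unit u}"])
  show "Poly_Mapping.keys a \<subseteq> unit_coset ` {u. unit u}"
    using a by (simp add: carrier_unit_sq_ring)
next
  have "unit_incl (0 :: 'a set \<Rightarrow>\<^sub>0 int) = 0" "unit_red red 0 = 0"
    by (simp_all add: unit_incl_def unit_red_def)
  moreover have "0 \<odot>\<^bsub>rp_free TYPE('a)\<^esub> gamma f = 0" "0 \<odot>\<^bsub>rp_free TYPE('k)\<^esub> f = 0"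
    unfolding rp_free_eq by (rule free_module_smult_zero)+
  ultimately show "unit_incl 0 \<odot>\<^bsub>rp_free TYPE('a)\<^esub> gamma f \<triangleq> gamma (unit_red red 0 \<odot>\<^bsub>rp_free TYPE('k)\<^esub> f)"
    by (simp only: gamma_zero L_eq_refl)
next
  fix x y
  assume xy: "Poly_Mapping.keys x \<subseteq> unit_coset ` {u. unit u}" "Poly_Mapping.keys y \<subseteq> unit_coset ` {u. unit u}"
    and IH: "unit_incl x \<odot>\<^bsub>rp_free TYPE('a)\<^esub> gamma f \<triangleq> gamma (unit_red red x \<odot>\<^bsub>rp_free TYPE('k)\<^esub> f)"
      "unit_incl y \<odot>\<^bsub>rp_free TYPE('a)\<^esub> gamma f \<triangleq> gamma (unit_red red y \<odot>\<^bsub>rp_free TYPE('k)\<^esub> f)"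
  have cl: "unit_red red x \<odot>\<^bsub>rp_free TYPE('k)\<^esub> f \<in> rp_X" "unit_red red y \<odot>\<^bsub>rp_free TYPE('k)\<^esub> f \<in> rp_X"
    using xy by (auto intro!: free.act_closed unit_red_closed f simp: carrier_unit_sq_ring)
  have e: "unit_incl (x - y) = unit_incl x - unit_incl y" "unit_red red (x - y) = unit_red red x - unit_red red y"
    by (simp_all add: unit_incl_def unit_red_def frag_extend_diff)
  show "unit_incl (x - y) \<odot>\<^bsub>rp_free TYPE('a)\<^esub> gamma f \<triangleq> gamma (unit_red red (x - y) \<odot>\<^bsub>rp_free TYPE('k)\<^esub> f)"
    unfolding e rp_free_eq free_module_smult_diff(2) unfolding rp_free_eq[symmetric] gamma_diff[OF cl]
    by (rule L_eq_diff[OF IH])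
next
  fix c assume "c \<in> unit_coset ` {u. unit u}"
  then obtain u where u: "unit u" "c = unit_coset u"
    by auto
  show "unit_incl (frag_of c) \<odot>\<^bsub>rp_free TYPE('a)\<^esub> gamma f \<triangleq> gamma (unit_red red (frag_of c) \<odot>\<^bsub>rp_free TYPE('k)\<^esub> f)"
    unfolding u(2) unit_incl_coset[OF u(1)] unit_red_coset[OF u(1)]
    using L_eq_sym[OF gamma_scale[OF u(1) f]] unfolding scale_def .
qed

lemma L_smult: "\<lbrakk>r \<in> carrier (sq_ring TYPE('a)); f \<in> L_pre\<rbrakk> \<Longrightarrow> r \<odot>\<^bsub>rp_free TYPE('a)\<^esub> f \<in> L_pre"
  using L_pre_invariant unfolding free.invariant_def by blast

text \<open>Additivity in the scalar is exact. The other two families of relations hold modulo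
  \<open>L_pre\<close>, where neither the representatives \<open>rp_rep\<close> nor the lifts
  matter.\<close>

lemma tau_kernel:
  assumes "e \<in> T.N"
  shows "tau e \<in> L_pre"
  using assms
proof (induction rule: T.tensor_kernel_induct)
  case zero
  show ?case unfolding tau_zero by (rule L_closed(1))
next
  case (diff e e')
  show ?case unfolding tau_diff by (rule L_closed(2)[OF diff(3,4)])
next
  case (left r r' m)
  have "(r + r') \<odot>\<^bsub>rp_free TYPE('a)\<^esub> g - r \<odot>\<^bsub>rp_free TYPE('a)\<^esub> g - r' \<odot>\<^bsub>rp_free TYPE('a)\<^esub> g = 0" for g
    unfolding rp_free_eq free_module_smult_add(2) by (simp only: add_diff_cancel_left' diff_self)
  moreover have "r \<oplus>\<^bsub>sq_ring TYPE('a)\<^esub> r' = r + r'"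
    by (simp add: sq_ring_eq)
  ultimately show ?case
    unfolding tau_diff tau_of using L_closed(1) by (simp only:)
next
  case (right r m m')
  define f where "f = rp_rep m"
  define g where "g = rp_rep m'"
  define h where "h = rp_rep (m \<oplus>\<^bsub>RP_bar TYPE('k)\<^esub> m')"
  have m: "m \<in> carrier (RP_bar TYPE('k))" "m' \<in> carrier (RP_bar TYPE('k))"
    using right by simp_all
  have fg: "f \<in> rp_X" "g \<in> rp_X" "rp_proj f = m" "rp_proj g = m'"
    unfolding f_def g_def using rp_rep m by blast+
  have "gamma h \<triangleq> gamma (f + g)"
    unfolding h_def using gamma_rep[OF free.X_add[OF fg(1,2)]]
    by (simp only: RP_bar.proj_add[OF fg(1,2), symmetric] fg(3,4))
  then have "gamma h - (gamma f + gamma g) \<in> L_pre"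
    unfolding L_eq_def gamma_add[OF fg(1,2)] .
  then have "r \<odot>\<^bsub>rp_free TYPE('a)\<^esub> (gamma h - (gamma f + gamma g)) \<in> L_pre"
    using right by (intro L_smult)
  then show ?case
    unfolding tau_diff tau_of RPk_simps
    unfolding rp_free_eq free_module_smult_diff(1) free_module_smult_add(1) f_def g_def h_def diff_diff_eq .
next
  case (balanced r a m)
  define f where "f = rp_rep m"
  have m: "m \<in> carrier (RP_bar TYPE('k))"
    using balanced by simp
  have f: "f \<in> rp_X" "rp_proj f = m"
    unfolding f_def using rp_rep m by blast+
  have a: "unit_red red a \<in> carrier (sq_ring TYPE('k))" "unit_incl a \<in> carrier (sq_ring TYPE('a))"
    by (rule unit_red_closed unit_incl_closed, rule balanced)+
  let ?h = "rp_rep (unit_red red a \<odot>\<^bsub>RP_bar TYPE('k)\<^esub> m)"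
  have "gamma ?h \<triangleq> gamma (unit_red red a \<odot>\<^bsub>rp_free TYPE('k)\<^esub> f)"
    using gamma_rep[OF free.act_closed[OF a(1) f(1)]]
    by (simp only: RP_bar.proj_smult[OF a(1) f(1), symmetric] f(2))
  also have "\<dots> \<triangleq> unit_incl a \<odot>\<^bsub>rp_free TYPE('a)\<^esub> gamma f"
    by (rule L_eq_sym[OF gamma_balanced[OF balanced(2) f(1)]])
  finally have "unit_incl a \<odot>\<^bsub>rp_free TYPE('a)\<^esub> gamma f - gamma ?h \<in> L_pre"
    unfolding L_eq_def[symmetric] by (rule L_eq_sym)
  then have "r \<odot>\<^bsub>rp_free TYPE('a)\<^esub> (unit_incl a \<odot>\<^bsub>rp_free TYPE('a)\<^esub> gamma f - gamma ?h) \<in> L_pre"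
    using balanced by (intro L_smult)
  moreover have "(r \<otimes>\<^bsub>sq_ring TYPE('a)\<^esub> unit_incl a) \<odot>\<^bsub>rp_free TYPE('a)\<^esub> gamma f =
      r \<odot>\<^bsub>rp_free TYPE('a)\<^esub> (unit_incl a \<odot>\<^bsub>rp_free TYPE('a)\<^esub> gamma f)"
    by (rule free.act_mult[OF balanced(1) a(2) gamma_closed[OF f(1)]])
  ultimately show ?case
    unfolding tau_diff tau_of RPk_simps f_def by (simp only: rp_free_eq free_module_smult_diff(1))
qed

lemma tau_te:
  assumes "c \<noteq> 0" "f \<in> rp_X"
  shows "tau (tens c f) \<triangleq> scale c (gamma f)"
  unfolding tens_def tau_of scale_def[symmetric] by (rule L_eq_scale[OF assms(1) gamma_rep[OF assms(2)]])

text \<open>For a unit argument, lifting its residue gives back the symbol modulo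
  \<open>L_pre\<close>. For a nonunit the symbol itself lies in \<open>L_pre\<close> and its image
  is trivial.\<close>

lemma tau_sigma: "f \<in> rp_X \<Longrightarrow> tau (sigma f) \<triangleq> f"
proof (induction rule: rp_induct)
  case zero
  show ?case unfolding sigma_zero tau_zero by (rule L_eq_refl)
next
  case (diff f g)
  show ?case unfolding sigma_diff[OF diff(1,2)] tau_diff by (rule L_eq_diff[OF diff(3,4)])
next
  case (rp_elt c x)
  have "tau (sigma (rp_elt c x)) \<triangleq> scale c (gamma (res_sym x))"
    unfolding sigma_rps by (rule tau_te[OF rp_elt(1) res_sym_closed])
  also have "\<dots> \<triangleq> rp_elt c x"
  proof (cases "unit x")
    case True
    then have "gamma (res_sym x) \<triangleq> rp_elt 1 x"
      using gamma_rps_red[OF unit_one True] by (simp add: res_sym_def)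
    from L_eq_scale[OF rp_elt(1) this] show ?thesis
      using rp_elt by simp
  next
    case False
    then have "rp_elt c x \<in> L_pre"
      using rp_elt by (intro rp_elt_L) (auto simp: unit_def)
    then show ?thesis
      unfolding res_sym_not_unit[OF False] gamma_zero scale_zero by (rule L_eq_sym[OF L_eq_0])
  qed
  finally show ?case .
next
  case (const c)
  have "tau (sigma (free_elt (sq_coset c) Const)) \<triangleq> scale c (gamma 0)"
    unfolding sigma_const by (rule tau_te[OF const(1) free.X_zero])
  also have "\<dots> = 0"
    unfolding gamma_zero by (rule scale_zero)
  also have "\<dots> \<triangleq> free_elt (sq_coset c) Const"
    by (rule L_eq_sym[OF L_eq_0[OF rp_ker_L[OF const_in_rp_ker[OF const(2,1)]]]])
  finally show ?case .
qed

text \<open>If \<open>sigma f\<close> is a tensor relation, then \<open>f\<close>, being congruent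
  to \<open>tau (sigma f)\<close>, lies in \<open>L_pre\<close>. Conversely the generators of
  \<open>L_sub v\<close> specialize to zero.\<close>

lemma specialize_kernel: "{x \<in> carrier (RP_bar TYPE('a)). specialize x = \<zero>\<^bsub>IndT\<^esub>} = L_sub v"
proof
  show "{x \<in> carrier (RP_bar TYPE('a)). specialize x = \<zero>\<^bsub>IndT\<^esub>} \<subseteq> L_sub v"
  proof
    fix x assume x: "x \<in> {x \<in> carrier (RP_bar TYPE('a)). specialize x = \<zero>\<^bsub>IndT\<^esub>}"
    then obtain f where f: "f \<in> rp_X" "x = rp_proj f"
      by (auto simp: RP_bar.carrier_eq)
    have "tens_class (sigma f) = tens_class 0"
      using x f specialize_proj[OF f(1)] by (simp add: tens_class_zero)
    then have "sigma f \<doteq> 0"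
      using tens_class_eq_iff[OF sigma_closed[OF f(1)] Tm.X_zero] by blast
    then have "tau (sigma f) \<in> L_pre"
      unfolding tens_eq_0_iff by (rule tau_kernel)
    then have "f \<in> L_pre"
      using L_eq_mem_iff[OF tau_sigma[OF f(1)]] by blast
    then show "x \<in> L_sub v"
      by (simp add: L_pre_def f)
  qed
  have "submodule {x \<in> carrier (RP_bar TYPE('a)). specialize x = \<zero>\<^bsub>IndT\<^esub>} (sq_ring TYPE('a)) (RP_bar TYPE('a))"
    by (rule submodule_equalizer[OF RP_bar.presented_is_module module_Ind specialize_hom zero_module_hom[OF module_Ind]])
  then show "L_sub v \<subseteq> {x \<in> carrier (RP_bar TYPE('a)). specialize x = \<zero>\<^bsub>IndT\<^esub>}"
    unfolding L_sub_def
    by (rule RP_bar.M.span_least) (use specialize_rp_bar(2) in \<open>auto simp: rp_bar_eq\<close>)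
qed

text \<open>For units \<open>u\<close> and \<open>x\<close> lifting \<open>b\<close> and
  \<open>y\<close>, the tensor of \<open><c>\<close> with \<open><b>[y]\<close> equals that of
  \<open><cu>\<close> with \<open>[y]\<close>, which is the image of \<open><cu>[x]\<close>.\<close>

lemma tens_image:
  assumes c: "c \<noteq> 0" and g: "g \<in> rp_X"
  shows "\<exists>f\<in>rp_X. tens c g \<doteq> sigma f"
  using g
proof (induction rule: rp_induct)
  case zero
  show ?case
    using tens_zero[OF c] sigma_zero free.X_zero by metis
next
  case (diff g h)
  then obtain f f' where f: "f \<in> rp_X" "tens c g \<doteq> sigma f" "f' \<in> rp_X" "tens c h \<doteq> sigma f'"
    by blast
  have "tens c (g - h) \<doteq> tens c g - tens c h"
    by (rule tens_diff[OF c diff(1,2)])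
  also have "\<dots> \<doteq> sigma f - sigma f'"
    by (rule tens_eq_diff[OF f(2,4)])
  also have "\<dots> = sigma (f - f')"
    by (rule sigma_diff[OF f(1,3), symmetric])
  finally show ?case
    using free.X_diff[OF f(1,3)] by blast
next
  case (rp_elt b y)
  obtain u where u: "unit u" "red u = b"
    using red_unit_surj[OF rp_elt(1)] .
  obtain x where x: "unit x" "red x = y"
    using red_unit_surj[OF rp_elt(2)] .
  have "tens c (rp_elt b y) = tens c (scale (red u) (res_sym x))"
    using u x by (simp add: res_sym_def rp_elt)
  also have "\<dots> \<doteq> tens (c * u) (res_sym x)"
    by (rule tens_eq_sym[OF tens_unit[OF c u(1) res_sym_closed]])
  also have "\<dots> = sigma (rp_elt (c * u) x)"
    by (rule sigma_rps[symmetric])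
  finally have *: "tens c (rp_elt b y) \<doteq> sigma (rp_elt (c * u) x)" .
  have "rp_elt (c * u) x \<in> rp_X"
    by (rule rp_elt_closed) (use c u x unit_nonzero in auto)
  with * show ?case
    by blast
next
  case (const d)
  have "tens c (free_elt (sq_coset d) Const) \<doteq> 0"
    by (rule tens_ker[OF c const_in_rp_ker[OF const(2,1)]])
  then show ?case
    using sigma_zero free.X_zero by metis
qed

lemma frag_image:
  assumes r: "r \<in> carrier (sq_ring TYPE('a))" and g: "g \<in> rp_X"
  shows "\<exists>f\<in>rp_X. frag_of (r, rp_proj g) \<doteq> sigma f"
  using r
proof (induction rule: sq_ring_induct)
  case zero
  \<comment> \<open>Left additivity with both scalars equal to \<open>0\<close> shows that the pair
    with first entry \<open>0\<close> is itself a tensor relation.\<close>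
  have "frag_of (0 \<oplus>\<^bsub>sq_ring TYPE('a)\<^esub> 0, rp_proj g) - frag_of (0, rp_proj g) - frag_of (0, rp_proj g) \<in> T.N"
    by (rule T.tensor_kernel_left_add) (use g in \<open>simp_all add: sq_ring_eq\<close>)
  then have "0 - frag_of (0, rp_proj g) \<in> T.N"
    by (simp add: sq_ring_eq)
  then have "frag_of (0, rp_proj g) \<doteq> 0"
    unfolding tens_eq_def[symmetric] by (rule tens_eq_sym)
  then show ?case
    using sigma_zero free.X_zero by metis
next
  case (diff r s)
  then obtain f f' where f: "f \<in> rp_X" "frag_of (r, rp_proj g) \<doteq> sigma f"
    "f' \<in> rp_X" "frag_of (s, rp_proj g) \<doteq> sigma f'"
    by blast
  have rs: "r - s \<in> carrier (sq_ring TYPE('a))"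
    using diff(1,2) keys_diff[of r s] by (auto simp: sq_ring_eq)
  have "frag_of ((r - s) \<oplus>\<^bsub>sq_ring TYPE('a)\<^esub> s, rp_proj g) - frag_of (r - s, rp_proj g) - frag_of (s, rp_proj g) \<in> T.N"
    by (rule T.tensor_kernel_left_add[OF rs diff(2)]) (use g in simp)
  moreover have "(r - s) \<oplus>\<^bsub>sq_ring TYPE('a)\<^esub> s = r"
    by (simp add: sq_ring_eq)
  ultimately have "frag_of (r, rp_proj g) - frag_of (s, rp_proj g) \<doteq> frag_of (r - s, rp_proj g)"
    unfolding tens_eq_def by (simp only: diff_diff_eq add.commute)
  from tens_eq_sym[OF this] have "frag_of (r - s, rp_proj g) \<doteq> frag_of (r, rp_proj g) - frag_of (s, rp_proj g)" .
  also have "\<dots> \<doteq> sigma f - sigma f'"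
    by (rule tens_eq_diff[OF f(2,4)])
  also have "\<dots> = sigma (f - f')"
    by (rule sigma_diff[OF f(1,3), symmetric])
  finally show ?case
    using free.X_diff[OF f(1,3)] by blast
next
  case (sq_class c)
  show ?case
    using tens_image[OF sq_class g] unfolding tens_def .
qed

lemma specialize_surj: "specialize ` carrier (RP_bar TYPE('a)) = carrier IndT"
proof
  show "specialize ` carrier (RP_bar TYPE('a)) \<subseteq> carrier IndT"
    using specialize_hom by (auto simp: module_hom_def)
  have "\<exists>f\<in>rp_X. e \<doteq> sigma f" if "e \<in> carrier T.E" for e
  proof (rule free_Abelian_group_induct[where S = "carrier (sq_ring TYPE('a)) \<times> carrier RPk"])
    show "Poly_Mapping.keys e \<subseteq> carrier (sq_ring TYPE('a)) \<times> carrier RPk"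
      using that by (simp only: carrier_free_Abelian_group_iff)
    show "\<exists>f\<in>rp_X. 0 \<doteq> sigma f"
      using sigma_zero free.X_zero tens_eq_refl by metis
    show "\<exists>f\<in>rp_X. e - e' \<doteq> sigma f" if "\<exists>f\<in>rp_X. e \<doteq> sigma f" "\<exists>f\<in>rp_X. e' \<doteq> sigma f" for e e'
      using that tens_eq_diff sigma_diff free.X_diff by metis
    show "\<exists>f\<in>rp_X. frag_of p \<doteq> sigma f" if p: "p \<in> carrier (sq_ring TYPE('a)) \<times> carrier RPk" for p
    proof -
      obtain r m where rm: "p = (r, m)" "r \<in> carrier (sq_ring TYPE('a))" "m \<in> carrier (RP_bar TYPE('k))"
        using p by auto
      then obtain g where "g \<in> rp_X" "m = rp_proj g"
        by (auto simp: RP_bar.carrier_eq)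
      then show ?thesis
        using frag_image[OF rm(2)] rm(1) by simp
    qed
  qed
  then show "carrier IndT \<subseteq> specialize ` carrier (RP_bar TYPE('a))"
  proof (intro subsetI)
    fix y assume H: "\<And>e. e \<in> carrier T.E \<Longrightarrow> \<exists>f\<in>rp_X. e \<doteq> sigma f" and "y \<in> carrier IndT"
    then obtain e where e: "e \<in> carrier T.E" "y = tens_class e"
      unfolding Ind_eq Tm.carrier_eq tens_class_def by blast
    then obtain f where f: "f \<in> rp_X" "e \<doteq> sigma f"
      using H by blast
    have "y = specialize (rp_proj f)"
      unfolding specialize_proj[OF f(1)] e(2) using tens_class_eq_iff[OF e(1) sigma_closed[OF f(1)]] f(2) by blast
    then show "y \<in> specialize ` carrier (RP_bar TYPE('a))"
      using f(1) by blast
  qed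
qed

end

theorem lemma5p1:
  fixes v :: "'a::field \<Rightarrow> 'g::linordered_ab_group_add"
    and red :: "'a \<Rightarrow> 'k::field"
  assumes "valuation v"
    and "residue_field v red"
  shows "short_exact_sequence (sq_ring TYPE('a))
           ((RP_bar TYPE('a))\<lparr>carrier := L_sub v\<rparr>) (\<lambda>x. x)
           (RP_bar TYPE('a)) (specialization v red)
           (Ind v red (RP_bar TYPE('k)))"
proof -
  interpret valued_field v red
    by (rule valued_field.intro[OF assms])
  have "L_sub v \<subseteq> carrier (RP_bar TYPE('a))"
    by (rule RP_bar.M.submoduleE(1)[OF submodule_L])
  then have incl: "(\<lambda>x. x) \<in> module_hom (sq_ring TYPE('a)) ((RP_bar TYPE('a))\<lparr>carrier := L_sub v\<rparr>) (RP_bar TYPE('a))"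
    by (auto simp: module_hom_def)
  show ?thesis
    unfolding short_exact_sequence_def specialization_eq
    using submodule.submodule_is_module[OF submodule_L RP_bar.presented_is_module]
      RP_bar.presented_is_module module_Ind incl specialize_hom specialize_kernel specialize_surj
    by (simp add: a_kernel_def kernel_def)
qed

end
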